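(* Let $(M,g)$ be a closed connected oriented smooth Riemannian manifold. Then the following assertions hold. \begin{itemize} \item Each affine connection $\nabla$ on $M$ lifts to an $\mathrm{End}(\mathscr V\mathscr C^\infty_b)$-valued $1$-form $\boldsymbol\Omega^\nabla$ (i.e. to an $\mathscr F\mathscr C^\infty_b$-bilinear map $(V,Z)\mapsto(\boldsymbol\Omega^\nabla Z)V\in\mathscr V\mathscr C^\infty_b$), given by $\big((\boldsymbol\Omega^\nabla Z)V\big)_\mu=\nabla_{V_\mu}Z_\mu$ for $V,Z\in\mathscr V\mathscr C^\infty_b$, $\mu\in\mathscr P$. \item For each affine connection $\nabla$ on $M$, $\boldsymbol\nabla^\nabla:=\boldsymbol\nabla^{\mathrm{int}}+\boldsymbol\Omega^\nabla$, that is, $\boldsymbol\nabla^\nabla_VZ:=\boldsymbol\nabla^{\mathrm{int}}_VZ+(\boldsymbol\Omega^\nabla Z)V$, is an affine connection acting on $\mathscr V\mathscr C^\infty_b$. \item The association $\nabla\mapsto\boldsymbol\nabla^\nabla$ preserves metric compatibility and torsion-freeness: if $\nabla$ is $g$-metric-compatible, then $\boldsymbol\nabla^\nabla$ is $\mathbf G^{\mathrm{der}}$-metric-compatible; if $\nabla$ is torsion-free, then $\boldsymbol\nabla^\nabla$ is torsion-free. \item The connection $\boldsymbol\nabla^{\nabla^{\mathrm{LC}}}$ induced by the Levi-Civita connection $\nabla^{\mathrm{LC}}$ of $(M,g)$ is the unique $\mathbf G^{\mathrm{der}}$-metric-compatible torsion-free affine connection on $\mathscr P$, i.e. it is the Levi-Civita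 connection of $(\mathscr V\mathscr C^\infty_b,\mathbf G^{\mathrm{der}})$. \end{itemize}
   Context: $\mathscr P$ is the set of Borel probability measures on $M$; $\mathfrak X^\infty$ the smooth vector fields on $M$; $\Omega^\infty_1$ the smooth $1$-forms on $M$. For $f\in C^\infty(M)$ put $f^\star(\mu)=\mu f=\int f\,d\mu$. Cylinder functions: $\mathscr F\mathscr C^\infty_b$ is the algebra of functions $u:\mathscr P\to\mathbb R$ of the form $u=F\circ(f_1^\star,\dots,f_k^\star)$, $k\in\mathbb N_0$, $F\in C^\infty(\mathbb R^k)$, $f_i\in C^\infty(M)$. Cylinder vector fields: $\mathscr V\mathscr C^\infty_b:=\mathscr F\mathscr C^\infty_b\otimes_{\mathbb R}\mathfrak X^\infty$ (algebraic tensor product), a module over $\mathscr F\mathscr C^\infty_b$; for $V=\sum_iu_i\otimes w_i$ set $V_\mu=\sum_iu_i(\mu)w_i\in\mathfrak X^\infty$. Cylinder $1$-forms: $\Omega_1\mathscr C^\infty_b:=\mathscr F\mathscr C^\infty_b\otimes_{\mathbb R}\Omega_1^\infty$, with evaluation $\Omega_\mu$ defined similarly. Differential: $\mathbf D:\mathscr F\mathscr C^\infty_b\to\Omega_1\mathscr C^\infty_b$, $\mathbf D_\mu u=\sum_i(\partial_iF)(f_1^\star\mu,\dots,f_k^\star\mu)\,df_i$ (independent of the representation of $u$). Action on functions: $(Vu)(\mu)=\int(\mathbf D_\mu u)(V_\mu)\,d\mu$, so $Vu\in\mathscr F\mathscr C^\infty_b$. The map sending $V$ to the derivation $u\mapsto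 Vu$ is injective, and cylinder vector fields are identified with the corresponding derivations. Bracket: $\llbracket V,Z\rrbracket\in\mathscr V\mathscr C^\infty_b$ is the cylinder vector field with $\llbracket V,Z\rrbracket u=V(Zu)-Z(Vu)$ for all $u\in\mathscr F\mathscr C^\infty_b$. Affine connection on $\mathscr P$ (acting on $\mathscr V\mathscr C^\infty_b$): an $\mathbb R$-bilinear map $(V,Z)\mapsto\boldsymbol\nabla_VZ\in\mathscr V\mathscr C^\infty_b$, $\mathscr F\mathscr C^\infty_b$-linear in $V$, with $\boldsymbol\nabla_V(vZ)=v\boldsymbol\nabla_VZ+(Vv)Z$ for $v\in\mathscr F\mathscr C^\infty_b$. It is torsion-free if $\boldsymbol\nabla_VZ-\boldsymbol\nabla_ZV=\llbracket V,Z\rrbracket$ for all $V,Z$. Intrinsic connection: $\boldsymbol\nabla^{\mathrm{int}}$ is determined by $\mathbb R$-linearity in $Z$ and $\boldsymbol\nabla^{\mathrm{int}}_V(u\otimes w)=(Vu)\otimes w$ for $u\in\mathscr F\mathscr C^\infty_b$, $w\in\mathfrak X^\infty$. Metric: $\mathbf G^{\mathrm{der}}(V,Z)\in\mathscr F\mathscr C^\infty_b$ is $\mathbf G^{\mathrm{der}}_\mu(V,Z)=\int g(V_\mu,Z_\mu)\,d\mu$. A connection $\boldsymbol\nabla$ is $\mathbf G^{\mathrm{der}}$-metric-compatible if $V^1\mathbf G^{\mathrm{der}}(V^2,V^3)=\mathbf G^{\mathrm{der}}(\boldsymbol\nabla_{V^1}V^2,V^3)+\mathbf G^{\mathrm{der}}(V^2,\boldsymbol\nabla_{V^1}V^3)$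 for all $V^1,V^2,V^3\in\mathscr V\mathscr C^\infty_b$. *)

theory Defs
  imports "HOL-Probability.Probability" "HOL-Library.Function_Algebras"
begin

section \<open>Smooth manifolds\<close>

primrec Ck_on :: "nat \<Rightarrow> 'a::real_normed_vector set \<Rightarrow> ('a \<Rightarrow> 'b::real_normed_vector) \<Rightarrow> bool"
  where
    "Ck_on 0 S f \<longleftrightarrow> continuous_on S f"
  | "Ck_on (Suc k) S f \<longleftrightarrow>
       (\<forall>x\<in>S. f differentiable at x) \<and>
       (\<forall>v. Ck_on k S (\<lambda>x. frechet_derivative f (at x) v))"

definition smooth_on :: "'a::real_normed_vector set \<Rightarrow> ('a \<Rightarrow> 'b::real_normed_vector) \<Rightarrow> bool"
  where "smooth_on S f \<longleftrightarrow> (\<forall>k. Ck_on k S f)"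

text \<open>The manifold is the whole type \<open>'m\<close> with its class topology; a chart is a pair \<open>(U, \<phi>)\<close>,
  where only the values of \<open>\<phi>\<close> on \<open>U\<close> matter. An atlas (not necessarily maximal) stands for the
  smooth structure it generates, and an oriented atlas also for the orientation it generates.\<close>

type_synonym ('m, 'n) chart = "'m set \<times> ('m \<Rightarrow> real ^ 'n)"

definition is_chart :: "('m::topological_space, 'n::finite) chart \<Rightarrow> bool"
  where "is_chart c \<longleftrightarrow> (case c of (U, \<phi>) \<Rightarrow>
    open U \<and> open (\<phi> ` U) \<and> homeomorphism U (\<phi> ` U) \<phi> (inv_into U \<phi>))"

definition transition_map ::
    "('m, 'n::finite) chart \<Rightarrow> ('m, 'n) chart \<Rightarrow> real ^ 'n \<Rightarrow> real ^ 'n"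
  where "transition_map c c' = snd c' \<circ> inv_into (fst c) (snd c)"

definition smooth_atlas :: "('m::topological_space, 'n::finite) chart set \<Rightarrow> bool"
  where "smooth_atlas A \<longleftrightarrow>
    (\<forall>c\<in>A. is_chart c) \<and> (\<Union>c\<in>A. fst c) = UNIV \<and>
    (\<forall>c\<in>A. \<forall>c'\<in>A. smooth_on (snd c ` (fst c \<inter> fst c')) (transition_map c c'))"

definition oriented_atlas :: "('m::topological_space, 'n::finite) chart set \<Rightarrow> bool"
  where "oriented_atlas A \<longleftrightarrow>
    (\<forall>c\<in>A. \<forall>c'\<in>A. \<forall>x \<in> snd c ` (fst c \<inter> fst c').
       det (matrix (frechet_derivative (transition_map c c') (at x))) > 0)"

definition smooth_functions :: "('m::topological_space, 'n::finite) chart set \<Rightarrow> ('m \<Rightarrow> real) set"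
  where "smooth_functions A =
    {f. \<forall>c\<in>A. smooth_on (snd c ` fst c) (f \<circ> inv_into (fst c) (snd c))}"

text \<open>Tangent vectors at \<open>p\<close> are the derivations at \<open>p\<close> of the algebra of smooth functions. They
  are total functionals, set to 0 outside this algebra so that HOL equality is the right equality.\<close>

type_synonym 'm tvec = "('m \<Rightarrow> real) \<Rightarrow> real"
type_synonym 'm vfield = "'m \<Rightarrow> 'm tvec"
type_synonym 'm form1 = "'m \<Rightarrow> 'm tvec \<Rightarrow> real"

definition tangent_space ::
    "('m::topological_space, 'n::finite) chart set \<Rightarrow> 'm \<Rightarrow> 'm tvec set"
  where "tangent_space A p = {v.
    (\<forall>f. f \<notin> smooth_functions A \<longrightarrow> v f = 0) \<and>
    (\<forall>f\<in>smooth_functions A. \<forall>h\<in>smooth_functions A. v (f + h) = v f + v h) \<and>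
    (\<forall>c. \<forall>f\<in>smooth_functions A. v (\<lambda>x. c * f x) = c * v f) \<and>
    (\<forall>f\<in>smooth_functions A. \<forall>h\<in>smooth_functions A. v (f * h) = f p * v h + h p * v f)}"

definition app :: "'m vfield \<Rightarrow> ('m \<Rightarrow> real) \<Rightarrow> 'm \<Rightarrow> real"
  where "app X f = (\<lambda>p. X p f)"

definition vector_fields :: "('m::topological_space, 'n::finite) chart set \<Rightarrow> 'm vfield set"
  where "vector_fields A = {X. (\<forall>p. X p \<in> tangent_space A p) \<and>
    (\<forall>f\<in>smooth_functions A. app X f \<in> smooth_functions A)}"

definition vmul :: "('m \<Rightarrow> real) \<Rightarrow> 'm vfield \<Rightarrow> 'm vfield"
  where "vmul f X = (\<lambda>p h. f p * X p h)"

definition lie_bracket ::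
    "('m::topological_space, 'n::finite) chart set \<Rightarrow> 'm vfield \<Rightarrow> 'm vfield \<Rightarrow> 'm vfield"
  where "lie_bracket A X Y = (\<lambda>p f.
    if f \<in> smooth_functions A then X p (app Y f) - Y p (app X f) else 0)"

definition differential ::
    "('m::topological_space, 'n::finite) chart set \<Rightarrow> ('m \<Rightarrow> real) \<Rightarrow> 'm form1"
  where "differential A f = (\<lambda>p v. if v \<in> tangent_space A p then v f else 0)"

definition riemannian_metric ::
    "('m::topological_space, 'n::finite) chart set \<Rightarrow> ('m \<Rightarrow> 'm tvec \<Rightarrow> 'm tvec \<Rightarrow> real) \<Rightarrow> bool"
  where "riemannian_metric A g \<longleftrightarrow>
    (\<forall>p. \<forall>v\<in>tangent_space A p. \<forall>w\<in>tangent_space A p. g p v w = g p w v) \<and>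
    (\<forall>p. \<forall>v\<in>tangent_space A p. \<forall>v'\<in>tangent_space A p. \<forall>w\<in>tangent_space A p.
       g p (v + v') w = g p v w + g p v' w) \<and>
    (\<forall>p c. \<forall>v\<in>tangent_space A p. \<forall>w\<in>tangent_space A p.
       g p (\<lambda>f. c * v f) w = c * g p v w) \<and>
    (\<forall>p. \<forall>v\<in>tangent_space A p. v \<noteq> 0 \<longrightarrow> g p v v > 0) \<and>
    (\<forall>X\<in>vector_fields A. \<forall>Y\<in>vector_fields A.
       (\<lambda>p. g p (X p) (Y p)) \<in> smooth_functions A)"

text \<open>A connection is a function on all pairs, of which only the values on \<open>vector_fields A\<close>
  matter; the same convention is used for cylinder vector fields below. Real scalars enter as
  constant functions.\<close>

type_synonym 'm connection = "'m vfield \<Rightarrow> 'm vfield \<Rightarrow> 'm vfield"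

definition affine_connection ::
    "('m::topological_space, 'n::finite) chart set \<Rightarrow> 'm connection \<Rightarrow> bool"
  where "affine_connection A D \<longleftrightarrow>
    (\<forall>X\<in>vector_fields A. \<forall>Y\<in>vector_fields A. D X Y \<in> vector_fields A) \<and>
    (\<forall>X\<in>vector_fields A. \<forall>X'\<in>vector_fields A. \<forall>Y\<in>vector_fields A.
       D (X + X') Y = D X Y + D X' Y) \<and>
    (\<forall>f\<in>smooth_functions A. \<forall>X\<in>vector_fields A. \<forall>Y\<in>vector_fields A.
       D (vmul f X) Y = vmul f (D X Y)) \<and>
    (\<forall>X\<in>vector_fields A. \<forall>Y\<in>vector_fields A. \<forall>Y'\<in>vector_fields A.
       D X (Y + Y') = D X Y + D X Y') \<and>
    (\<forall>c. \<forall>X\<in>vector_fields A. \<forall>Y\<in>vector_fields A.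
       D X (vmul (\<lambda>_. c) Y) = vmul (\<lambda>_. c) (D X Y)) \<and>
    (\<forall>f\<in>smooth_functions A. \<forall>X\<in>vector_fields A. \<forall>Y\<in>vector_fields A.
       D X (vmul f Y) = vmul f (D X Y) + vmul (app X f) Y)"

definition metric_compatible ::
    "('m::topological_space, 'n::finite) chart set \<Rightarrow> ('m \<Rightarrow> 'm tvec \<Rightarrow> 'm tvec \<Rightarrow> real) \<Rightarrow>
     'm connection \<Rightarrow> bool"
  where "metric_compatible A g D \<longleftrightarrow>
    (\<forall>X\<in>vector_fields A. \<forall>Y\<in>vector_fields A. \<forall>Z\<in>vector_fields A.
       app X (\<lambda>p. g p (Y p) (Z p)) = (\<lambda>p. g p (D X Y p) (Z p) + g p (Y p) (D X Z p)))"

definition torsion_free ::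
    "('m::topological_space, 'n::finite) chart set \<Rightarrow> 'm connection \<Rightarrow> bool"
  where "torsion_free A D \<longleftrightarrow>
    (\<forall>X\<in>vector_fields A. \<forall>Y\<in>vector_fields A. D X Y - D Y X = lie_bracket A X Y)"

definition levi_civita ::
    "('m::topological_space, 'n::finite) chart set \<Rightarrow> ('m \<Rightarrow> 'm tvec \<Rightarrow> 'm tvec \<Rightarrow> real) \<Rightarrow>
     'm connection \<Rightarrow> bool"
  where "levi_civita A g D \<longleftrightarrow>
    affine_connection A D \<and> metric_compatible A g D \<and> torsion_free A D"

section \<open>Cylinder functions\<close>

typedef (overloaded) 'm pmeas = "space (prob_algebra (borel :: 'm::topological_space measure))"
  morphisms meas_of Abs_pmeas
proof
  show "return borel undefined \<in> space (prob_algebra (borel :: 'm measure))"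
    by (simp add: space_prob_algebra prob_space_return)
qed

definition star :: "('m::topological_space \<Rightarrow> real) \<Rightarrow> 'm pmeas \<Rightarrow> real"
  where "star f \<mu> = (\<integral>x. f x \<partial>meas_of \<mu>)"

text \<open>Since \<open>k\<close> has to be a bound variable, a function on \<open>\<real>\<^sup>k\<close> is a function of a real sequence that
  depends on the first \<open>k\<close> entries only; it is smooth if all its iterated partial derivatives exist
  and are continuous. On such functions, continuity for the product topology on sequences is
  continuity on \<open>\<real>\<^sup>k\<close>.\<close>

definition partial :: "nat \<Rightarrow> ((nat \<Rightarrow> real) \<Rightarrow> real) \<Rightarrow> (nat \<Rightarrow> real) \<Rightarrow> real"
  where "partial i F x = deriv (\<lambda>t. F (x(i := t))) (x i)"

primrec Ck_Rk :: "nat \<Rightarrow> nat \<Rightarrow> ((nat \<Rightarrow> real) \<Rightarrow> real) \<Rightarrow> bool"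
  where
    "Ck_Rk 0 k F \<longleftrightarrow> continuous_on UNIV F"
  | "Ck_Rk (Suc m) k F \<longleftrightarrow> continuous_on UNIV F \<and>
       (\<forall>i<k. (\<forall>x. (\<lambda>t. F (x(i := t))) differentiable at (x i)) \<and> Ck_Rk m k (partial i F))"

definition smooth_Rk :: "nat \<Rightarrow> ((nat \<Rightarrow> real) \<Rightarrow> real) \<Rightarrow> bool"
  where "smooth_Rk k F \<longleftrightarrow>
    (\<forall>x y. (\<forall>i<k. x i = y i) \<longrightarrow> F x = F y) \<and> (\<forall>m. Ck_Rk m k F)"

definition cyl_rep ::
    "('m::topological_space, 'n::finite) chart set \<Rightarrow> nat \<Rightarrow> ((nat \<Rightarrow> real) \<Rightarrow> real) \<Rightarrow>
     (nat \<Rightarrow> 'm \<Rightarrow> real) \<Rightarrow> ('m pmeas \<Rightarrow> real) \<Rightarrow> bool"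
  where "cyl_rep A k F f u \<longleftrightarrow>
    smooth_Rk k F \<and> (\<forall>i<k. f i \<in> smooth_functions A) \<and> u = (\<lambda>\<mu>. F (\<lambda>i. star (f i) \<mu>))"

definition cyl_functions ::
    "('m::topological_space, 'n::finite) chart set \<Rightarrow> ('m pmeas \<Rightarrow> real) set"
  where "cyl_functions A = {u. \<exists>k F f. cyl_rep A k F f u}"

definition cyl_differential ::
    "('m::topological_space, 'n::finite) chart set \<Rightarrow> ('m pmeas \<Rightarrow> real) \<Rightarrow> 'm pmeas \<Rightarrow> 'm form1"
  where "cyl_differential A u = (THE \<omega>. \<exists>k F f. cyl_rep A k F f u \<and>
    \<omega> = (\<lambda>\<mu> p v. \<Sum>i<k. partial i F (\<lambda>j. star (f j) \<mu>) * differential A (f i) p v))"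

section \<open>Cylinder vector fields\<close>

text \<open>For spaces \<open>U\<close> of real functions on a set \<open>P\<close> and \<open>W\<close> of vector fields, the evaluation
  \<open>\<Sum> u\<^sub>i \<otimes> w\<^sub>i \<mapsto> (\<mu> \<mapsto> \<Sum> u\<^sub>i(\<mu>) w\<^sub>i)\<close> embeds the algebraic tensor product of \<open>U\<close> and \<open>W\<close> into the maps from
  \<open>P\<close> to \<open>W\<close>: by \<open>tensor_evaluation_injective\<close> below, if the evaluation of a sum of tensors
  vanishes, then so does its image under every bilinear map. Cylinder vector fields are therefore
  defined as the maps in the range of this evaluation.\<close>

type_synonym 'm cvfield = "'m pmeas \<Rightarrow> 'm vfield"

definition tensor :: "('p \<Rightarrow> real) \<Rightarrow> ('x \<Rightarrow> 'y \<Rightarrow> real) \<Rightarrow> 'p \<Rightarrow> 'x \<Rightarrow> 'y \<Rightarrow> real"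
  where "tensor u w = (\<lambda>\<mu> p h. u \<mu> * w p h)"

lemma tensor_evaluation_injective:
  fixes u :: "'i \<Rightarrow> 'p \<Rightarrow> real" and w :: "'i \<Rightarrow> 'x \<Rightarrow> 'y \<Rightarrow> real"
    and b :: "('p \<Rightarrow> real) \<Rightarrow> ('x \<Rightarrow> 'y \<Rightarrow> real) \<Rightarrow> 'c::real_vector"
  assumes U: "\<And>s t c. s \<in> U \<Longrightarrow> t \<in> U \<Longrightarrow> (\<lambda>\<mu>. s \<mu> + c * t \<mu>) \<in> U"
    and W: "\<And>y z c. y \<in> W \<Longrightarrow> z \<in> W \<Longrightarrow> (\<lambda>p h. y p h + c * z p h) \<in> W"
    and bU: "\<And>s t c z. s \<in> U \<Longrightarrow> t \<in> U \<Longrightarrow> z \<in> W \<Longrightarrow>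
               b (\<lambda>\<mu>. s \<mu> + c * t \<mu>) z = b s z + c *\<^sub>R b t z"
    and bW: "\<And>s y z c. s \<in> U \<Longrightarrow> y \<in> W \<Longrightarrow> z \<in> W \<Longrightarrow>
               b s (\<lambda>p h. y p h + c * z p h) = b s y + c *\<^sub>R b s z"
    and "finite J" "\<And>j. j \<in> J \<Longrightarrow> u j \<in> U" "\<And>j. j \<in> J \<Longrightarrow> w j \<in> W"
    and "\<And>\<mu> p h. (\<Sum>j\<in>J. tensor (u j) (w j) \<mu> p h) = 0"
  shows "(\<Sum>j\<in>J. b (u j) (w j)) = 0"
  using assms(5-8)
proof (induction "card J" arbitrary: J u)
  case 0
  then show ?case by simp
next
  case (Suc n)
  show ?case
  proof (cases "\<forall>j\<in>J. \<forall>\<mu>. u j \<mu> = 0")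
    case True
    have "b (u j) (w j) = 0" if "j \<in> J" for j
    proof -
      have "u j = (\<lambda>\<mu>. u j \<mu> + (-1) * u j \<mu>)"
        using True that by auto
      then have "b (u j) (w j) = b (u j) (w j) + (-1) *\<^sub>R b (u j) (w j)"
        using bU[of "u j" "u j" "w j" "-1"] Suc.prems that by metis
      then show ?thesis by simp
    qed
    then show ?thesis by simp
  next
    case False
    then obtain m \<mu>0 where m: "m \<in> J" "u m \<mu>0 \<noteq> 0" by blast
    define K where "K = J - {m}"
    define c where "c j = u j \<mu>0 / u m \<mu>0" for j
    have K: "finite K" "card K = n" "K \<subseteq> J" "m \<notin> K" "J = insert m K"
      using Suc.hyps(2) Suc.prems(1) m by (auto simp: K_def)
    have split: "u m \<mu> * w m p h = - (\<Sum>j\<in>K. u j \<mu> * w j p h)" for \<mu> p h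
      using Suc.prems(4)[of \<mu> p h] K by (simp add: tensor_def)
    have wm: "w m p h + (\<Sum>j\<in>K. c j * w j p h) = 0" for p h
    proof -
      have "(\<Sum>j\<in>K. c j * w j p h) = (\<Sum>j\<in>K. u j \<mu>0 * w j p h) / u m \<mu>0"
        by (simp add: c_def sum_divide_distrib)
      also have "\<dots> = - w m p h"
        using split[of \<mu>0 p h] m by (simp add: field_simps)
      finally show ?thesis by simp
    qed
    have lin: "(\<lambda>p h. w m p h + (\<Sum>j\<in>L. c j * w j p h)) \<in> W \<and>
        b (u m) (\<lambda>p h. w m p h + (\<Sum>j\<in>L. c j * w j p h)) =
        b (u m) (w m) + (\<Sum>j\<in>L. c j *\<^sub>R b (u m) (w j))" if "finite L" "L \<subseteq> K" for L
      using that
    proof (induction L rule: finite_induct)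
      case empty
      then show ?case using Suc.prems(3) m by simp
    next
      case (insert i L)
      let ?y = "\<lambda>p h. w m p h + (\<Sum>j\<in>L. c j * w j p h)"
      have eq: "(\<lambda>p h. w m p h + (\<Sum>j\<in>insert i L. c j * w j p h)) = (\<lambda>p h. ?y p h + c i * w i p h)"
        using insert by (simp add: algebra_simps)
      have i: "?y \<in> W" "w i \<in> W" "u m \<in> U"
        using insert K Suc.prems m by auto
      show ?case
        unfolding eq using W[OF i(1,2), of "c i"] bW[OF i(3) i(1,2), of "c i"] insert
        by (simp add: algebra_simps)
    qed
    have zero: "b (u m) (\<lambda>p h. 0) = 0"
      using bW[of "u m" "w m" "w m" "-1"] Suc.prems m by simp
    have bm: "b (u m) (w m) = - (\<Sum>j\<in>K. c j *\<^sub>R b (u m) (w j))"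
      using lin[OF K(1)] zero by (simp add: wm eq_neg_iff_add_eq_0)
    let ?u = "\<lambda>j \<mu>. u j \<mu> + (- c j) * u m \<mu>"
    have "(\<Sum>j\<in>K. b (?u j) (w j)) = 0"
    proof (rule Suc.hyps(1))
      show "(\<Sum>j\<in>K. tensor (?u j) (w j) \<mu> p h) = 0" for \<mu> p h
      proof -
        have "(\<Sum>j\<in>K. tensor (?u j) (w j) \<mu> p h) =
            (\<Sum>j\<in>K. u j \<mu> * w j p h) - u m \<mu> * (\<Sum>j\<in>K. c j * w j p h)"
          by (simp add: tensor_def algebra_simps sum_subtractf sum_distrib_left)
        also have "(\<Sum>j\<in>K. c j * w j p h) = - w m p h"
          using wm[of p h] by simp
        finally show ?thesis using split[of \<mu> p h] by simp
      qed
      show "?u j \<in> U" if "j \<in> K" for j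
        using U[of "u j" "u m" "- c j"] Suc.prems K m that by blast
    qed (use K Suc.prems in auto)
    moreover have "b (?u j) (w j) = b (u j) (w j) - c j *\<^sub>R b (u m) (w j)" if "j \<in> K" for j
      using bU[of "u j" "u m" "w j" "- c j"] Suc.prems K m that by auto
    ultimately have "(\<Sum>j\<in>K. b (u j) (w j)) = (\<Sum>j\<in>K. c j *\<^sub>R b (u m) (w j))"
      by (simp add: sum_subtractf)
    then show ?thesis using K bm by simp
  qed
qed

definition tensor_sum ::
    "nat \<Rightarrow> (nat \<Rightarrow> 'm::topological_space pmeas \<Rightarrow> real) \<Rightarrow> (nat \<Rightarrow> 'm vfield) \<Rightarrow> 'm cvfield"
  where "tensor_sum n u w = (\<Sum>j<n. tensor (u j) (w j))"

definition cyl_vector_fields ::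
    "('m::topological_space, 'n::finite) chart set \<Rightarrow> 'm cvfield set"
  where "cyl_vector_fields A = {V. \<exists>n u w.
    (\<forall>j<n. u j \<in> cyl_functions A \<and> w j \<in> vector_fields A) \<and> V = tensor_sum n u w}"

definition cmul :: "('m::topological_space pmeas \<Rightarrow> real) \<Rightarrow> 'm cvfield \<Rightarrow> 'm cvfield"
  where "cmul u V = (\<lambda>\<mu> p h. u \<mu> * V \<mu> p h)"

definition act ::
    "('m::topological_space, 'n::finite) chart set \<Rightarrow> 'm cvfield \<Rightarrow>
     ('m pmeas \<Rightarrow> real) \<Rightarrow> 'm pmeas \<Rightarrow> real"
  where "act A V u = (\<lambda>\<mu>. \<integral>p. cyl_differential A u \<mu> p (V \<mu> p) \<partial>meas_of \<mu>)"

definition cyl_bracket ::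
    "('m::topological_space, 'n::finite) chart set \<Rightarrow> 'm cvfield \<Rightarrow> 'm cvfield \<Rightarrow> 'm cvfield"
  where "cyl_bracket A V Z = (THE Y. Y \<in> cyl_vector_fields A \<and>
    (\<forall>u\<in>cyl_functions A. act A Y u = act A V (act A Z u) - act A Z (act A V u)))"

section \<open>Connections on the space of probability measures\<close>

type_synonym 'm cconnection = "'m cvfield \<Rightarrow> 'm cvfield \<Rightarrow> 'm cvfield"

definition cyl_affine_connection ::
    "('m::topological_space, 'n::finite) chart set \<Rightarrow> 'm cconnection \<Rightarrow> bool"
  where "cyl_affine_connection A N \<longleftrightarrow>
    (\<forall>V\<in>cyl_vector_fields A. \<forall>Z\<in>cyl_vector_fields A. N V Z \<in> cyl_vector_fields A) \<and>
    (\<forall>V\<in>cyl_vector_fields A. \<forall>V'\<in>cyl_vector_fields A. \<forall>Z\<in>cyl_vector_fields A.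
       N (V + V') Z = N V Z + N V' Z) \<and>
    (\<forall>v\<in>cyl_functions A. \<forall>V\<in>cyl_vector_fields A. \<forall>Z\<in>cyl_vector_fields A.
       N (cmul v V) Z = cmul v (N V Z)) \<and>
    (\<forall>V\<in>cyl_vector_fields A. \<forall>Z\<in>cyl_vector_fields A. \<forall>Z'\<in>cyl_vector_fields A.
       N V (Z + Z') = N V Z + N V Z') \<and>
    (\<forall>c. \<forall>V\<in>cyl_vector_fields A. \<forall>Z\<in>cyl_vector_fields A.
       N V (cmul (\<lambda>_. c) Z) = cmul (\<lambda>_. c) (N V Z)) \<and>
    (\<forall>v\<in>cyl_functions A. \<forall>V\<in>cyl_vector_fields A. \<forall>Z\<in>cyl_vector_fields A.
       N V (cmul v Z) = cmul v (N V Z) + cmul (act A V v) Z)"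

definition cyl_torsion_free ::
    "('m::topological_space, 'n::finite) chart set \<Rightarrow> 'm cconnection \<Rightarrow> bool"
  where "cyl_torsion_free A N \<longleftrightarrow>
    (\<forall>V\<in>cyl_vector_fields A. \<forall>Z\<in>cyl_vector_fields A. N V Z - N Z V = cyl_bracket A V Z)"

definition Gder ::
    "('m::topological_space \<Rightarrow> 'm tvec \<Rightarrow> 'm tvec \<Rightarrow> real) \<Rightarrow>
     'm cvfield \<Rightarrow> 'm cvfield \<Rightarrow> 'm pmeas \<Rightarrow> real"
  where "Gder g V Z = (\<lambda>\<mu>. \<integral>p. g p (V \<mu> p) (Z \<mu> p) \<partial>meas_of \<mu>)"

definition cyl_metric_compatible ::
    "('m::topological_space, 'n::finite) chart set \<Rightarrow> ('m \<Rightarrow> 'm tvec \<Rightarrow> 'm tvec \<Rightarrow> real) \<Rightarrow>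
     'm cconnection \<Rightarrow> bool"
  where "cyl_metric_compatible A g N \<longleftrightarrow>
    (\<forall>V1\<in>cyl_vector_fields A. \<forall>V2\<in>cyl_vector_fields A. \<forall>V3\<in>cyl_vector_fields A.
       act A V1 (Gder g V2 V3) = Gder g (N V1 V2) V3 + Gder g V2 (N V1 V3))"

definition cyl_levi_civita ::
    "('m::topological_space, 'n::finite) chart set \<Rightarrow> ('m \<Rightarrow> 'm tvec \<Rightarrow> 'm tvec \<Rightarrow> real) \<Rightarrow>
     'm cconnection \<Rightarrow> bool"
  where "cyl_levi_civita A g N \<longleftrightarrow>
    cyl_affine_connection A N \<and> cyl_metric_compatible A g N \<and> cyl_torsion_free A N"

definition nabla_int :: "('m::topological_space, 'n::finite) chart set \<Rightarrow> 'm cconnection"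
  where "nabla_int A V Z = (THE Y. \<exists>n u w.
    (\<forall>j<n. u j \<in> cyl_functions A \<and> w j \<in> vector_fields A) \<and>
    Z = tensor_sum n u w \<and> Y = tensor_sum n (\<lambda>j. act A V (u j)) w)"

text \<open>\<open>end_valued_form A \<Omega>\<close>: the map \<open>(V, Z) \<mapsto> (\<Omega> Z) V\<close> is bilinear over the cylinder functions,
  with values in the cylinder vector fields.\<close>

definition end_valued_form ::
    "('m::topological_space, 'n::finite) chart set \<Rightarrow> ('m cvfield \<Rightarrow> 'm cvfield \<Rightarrow> 'm cvfield) \<Rightarrow> bool"
  where "end_valued_form A \<Omega> \<longleftrightarrow>
    (\<forall>V\<in>cyl_vector_fields A. \<forall>Z\<in>cyl_vector_fields A. \<Omega> Z V \<in> cyl_vector_fields A) \<and>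
    (\<forall>V\<in>cyl_vector_fields A. \<forall>V'\<in>cyl_vector_fields A. \<forall>Z\<in>cyl_vector_fields A.
       \<Omega> Z (V + V') = \<Omega> Z V + \<Omega> Z V') \<and>
    (\<forall>V\<in>cyl_vector_fields A. \<forall>Z\<in>cyl_vector_fields A. \<forall>Z'\<in>cyl_vector_fields A.
       \<Omega> (Z + Z') V = \<Omega> Z V + \<Omega> Z' V) \<and>
    (\<forall>v\<in>cyl_functions A. \<forall>V\<in>cyl_vector_fields A. \<forall>Z\<in>cyl_vector_fields A.
       \<Omega> Z (cmul v V) = cmul v (\<Omega> Z V) \<and> \<Omega> (cmul v Z) V = cmul v (\<Omega> Z V))"

definition Omega :: "'m::topological_space connection \<Rightarrow> 'm cvfield \<Rightarrow> 'm cvfield \<Rightarrow> 'm cvfield"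
  where "Omega D Z V = (\<lambda>\<mu>. D (V \<mu>) (Z \<mu>))"

definition lifted_connection ::
    "('m::topological_space, 'n::finite) chart set \<Rightarrow> 'm connection \<Rightarrow> 'm cconnection"
  where "lifted_connection A D V Z = nabla_int A V Z + Omega D Z V"

end

(* On M, the Koszul formula defines a functional that is linear over the smooth functions, and such a
   functional is represented by a vector field: near a point this is Cramer's rule in a cut-off
   coordinate frame, and smoothness is a local property.

   On the space of measures, everything is read off the curves (1 - e) mu + e delta_p. The derivative
   at e = 0 of a cylinder function u along them is a function of p whose differential is D_mu u, so
   this differential does not depend on the representation of u. Moreover, a cylinder vector field V
   is determined by its action: the derivatives of the functions mu f only say that V_mu is divergence
   free with respect to mu, but a measure with an atom at p forces V_mu(p) = 0, and e -> 0 gives the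
   general case. The same argument makes G^der nondegenerate although a single measure is not. The
   intrinsic connection is differentiation of the values, nabla^int_V Z (mu, p) h = V(nu -> Z_nu(p) h),
   and the bracket of V and Z is nabla^int_V Z - nabla^int_Z V + [V_mu, Z_mu]. *)

theory Submission
  imports Defs "HOL-Real_Asymp.Real_Asymp"
begin

section \<open>Functions of class C^k on open sets\<close>

text \<open>Tangent vectors are derivations of the algebra of global smooth functions, so they
  cannot be applied to a function that exists only in a chart. Local arguments on M therefore become
  identities between global functions, multiplied by powers of a cut-off function and free of
  divisions; this is the origin of factors such as \<open>\<rho> q ^ 3\<close>.

  An integral of V_\<mu> against \<mu> depends on \<mu> twice, through the field and through the
  integration. Each product rule on measures separates the two: the values of the field contribute
  \<open>nabla_int\<close>, the integration contributes an expression on M with the field frozen.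
  The coefficients of a frozen field are constant in the point of M; this is why
  \<open>Omega\<close> is bilinear over the cylinder functions although a connection on M obeys a
  Leibniz rule. Acting twice brings in second partial derivatives, whose symmetry makes the
  commutator first order again.

  On measures, existence comes from lifting, and nondegeneracy of \<open>Gder\<close> enters in the
  uniqueness. On M, existence also serves to show that [V_\<mu>, Z_\<mu>] is a cylinder
  field.\<close>

lemma Ck_on_cong_imp:
  assumes "open S" "\<And>x. x \<in> S \<Longrightarrow> f x = g x" "Ck_on k S f"
  shows "Ck_on k S g"
  using assms(2,3)
proof (induction k arbitrary: f g)
  case 0
  then show ?case using continuous_on_cong by (metis Ck_on.simps(1))
next
  case (Suc k)
  have d: "f differentiable at x" if "x \<in> S" for x
    using Suc.prems that by auto
  have "g differentiable at x" if "x \<in> S" for x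
    using d[OF that] Suc.prems(1) assms(1) that
    by (metis has_derivative_transform_within_open differentiable_def)
  moreover have "frechet_derivative f (at x) = frechet_derivative g (at x)" if "x \<in> S" for x
    using frechet_derivative_transform_within_open[OF d[OF that] assms(1) that] Suc.prems(1) by auto
  ultimately show ?case
    using Suc.prems Suc.IH[of "\<lambda>x. frechet_derivative f (at x) v" "\<lambda>x. frechet_derivative g (at x) v" for v]
    by auto
qed

lemma Ck_on_subset: "Ck_on k S f \<Longrightarrow> T \<subseteq> S \<Longrightarrow> Ck_on k T f"
  by (induction k arbitrary: f) (auto intro: continuous_on_subset)

lemma Ck_on_imp_continuous_on: "Ck_on k S f \<Longrightarrow> continuous_on S f"
  by (cases k) (auto intro!: continuous_at_imp_continuous_on differentiable_imp_continuous_within)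

lemma Ck_on_SucD: "Ck_on (Suc k) S f \<Longrightarrow> Ck_on k S f"
proof (induction k arbitrary: f)
  case 0
  then show ?case using Ck_on_imp_continuous_on by (metis Ck_on.simps(1))
next
  case (Suc k)
  then show ?case by (metis Ck_on.simps(2))
qed

text \<open>Any pointwise derivative may be supplied, so inductions on k run on an explicit formula
  instead of on \<open>frechet_derivative\<close>. Openness allows the formula to replace the latter
  at all further orders.\<close>

lemma Ck_on_SucI:
  assumes "open S" "\<And>x. x \<in> S \<Longrightarrow> (f has_derivative f' x) (at x)"
    and "\<And>v. Ck_on k S (\<lambda>x. f' x v)"
  shows "Ck_on (Suc k) S f"
proof -
  have "Ck_on k S (\<lambda>x. frechet_derivative f (at x) v)" for v
    using assms(3)[of v]
  proof (rule Ck_on_cong_imp[OF assms(1), rotated])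
    show "f' x v = frechet_derivative f (at x) v" if "x \<in> S" for x
      using frechet_derivative_at[OF assms(2)[OF that]] by simp
  qed
  then show ?thesis using assms(2) by (auto simp: differentiable_def)
qed

lemma Ck_on_has_derivative:
  assumes "Ck_on (Suc k) S f" "x \<in> S"
  shows "(f has_derivative frechet_derivative f (at x)) (at x)"
  using assms frechet_derivative_works by auto

lemma Ck_on_const: "Ck_on k S (\<lambda>x. c)"
  by (induction k arbitrary: c) auto

lemma Ck_on_bounded_linear_comp:
  assumes "open S" "bounded_linear L" "Ck_on k S f"
  shows "Ck_on k S (\<lambda>x. L (f x))"
  using assms(3)
proof (induction k arbitrary: f)
  case 0
  then show ?case using assms(2) by (auto intro: bounded_linear.continuous_on)
next
  case (Suc k)
  show ?case
  proof (rule Ck_on_SucI[OF assms(1)])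
    show "((\<lambda>x. L (f x)) has_derivative (\<lambda>v. L (frechet_derivative f (at x) v))) (at x)" if "x \<in> S" for x
      using Ck_on_has_derivative[OF Suc.prems that] assms(2) by (rule bounded_linear.has_derivative[rotated])
    show "Ck_on k S (\<lambda>x. L (frechet_derivative f (at x) v))" for v
      using Suc by auto
  qed
qed

lemma Ck_on_ident: "open S \<Longrightarrow> Ck_on k S (\<lambda>x. x)"
proof (induction k)
  case (Suc k)
  show ?case by (rule Ck_on_SucI[OF Suc.prems, where f'="\<lambda>x v. v"]) (auto simp: Ck_on_const)
qed auto

lemma Ck_on_add:
  assumes "open S" "Ck_on k S f" "Ck_on k S g"
  shows "Ck_on k S (\<lambda>x. f x + g x)"
  using assms(2,3)
proof (induction k arbitrary: f g)
  case 0
  then show ?case by (auto intro: continuous_on_add)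
next
  case (Suc k)
  show ?case
  proof (rule Ck_on_SucI[OF assms(1)])
    show "((\<lambda>x. f x + g x) has_derivative
        (\<lambda>v. frechet_derivative f (at x) v + frechet_derivative g (at x) v)) (at x)" if "x \<in> S" for x
      using Suc.prems that by (intro has_derivative_add Ck_on_has_derivative)
  qed (use Suc in auto)
qed

lemma Ck_on_mult:
  fixes f g :: "'a::real_normed_vector \<Rightarrow> real"
  assumes "open S" "Ck_on k S f" "Ck_on k S g"
  shows "Ck_on k S (\<lambda>x. f x * g x)"
  using assms(2,3)
proof (induction k arbitrary: f g)
  case 0
  then show ?case by (auto intro: continuous_on_mult)
next
  case (Suc k)
  show ?case
  proof (rule Ck_on_SucI[OF assms(1)])
    show "((\<lambda>x. f x * g x) has_derivative
        (\<lambda>v. f x * frechet_derivative g (at x) v + frechet_derivative f (at x) v * g x)) (at x)"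
      if "x \<in> S" for x
      using Suc.prems that by (intro has_derivative_mult Ck_on_has_derivative)
    show "Ck_on k S (\<lambda>x. f x * frechet_derivative g (at x) v + frechet_derivative f (at x) v * g x)" for v
      using Suc.prems Ck_on_SucD[OF Suc.prems(1)] Ck_on_SucD[OF Suc.prems(2)]
      by (intro Ck_on_add[OF assms(1)] Suc.IH) auto
  qed
qed

lemma Ck_on_inverse:
  fixes f :: "'a::real_normed_vector \<Rightarrow> real"
  assumes "open S" "Ck_on k S f" "\<And>x. x \<in> S \<Longrightarrow> f x \<noteq> 0"
  shows "Ck_on k S (\<lambda>x. inverse (f x))"
  using assms(2)
proof (induction k)
  case 0
  then show ?case using assms(3) by (auto intro: continuous_on_inverse)
next
  case (Suc k)
  note IH = Suc.IH[OF Ck_on_SucD[OF Suc.prems]]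
  show ?case
  proof (rule Ck_on_SucI[OF assms(1)])
    show "((\<lambda>x. inverse (f x)) has_derivative
        (\<lambda>v. (-1) * (inverse (f x) * frechet_derivative f (at x) v * inverse (f x)))) (at x)"
      if "x \<in> S" for x
      using Suc.prems that assms(3)[OF that]
      by (auto intro!: derivative_eq_intros Ck_on_has_derivative)
    show "Ck_on k S (\<lambda>x. (-1) * (inverse (f x) * frechet_derivative f (at x) v * inverse (f x)))" for v
      using Suc.prems IH by (intro Ck_on_mult[OF assms(1)] Ck_on_const) auto
  qed
qed

lemma Ck_on_sum:
  assumes "open S" "\<And>i. i \<in> I \<Longrightarrow> Ck_on k S (f i)"
  shows "Ck_on k S (\<lambda>x. \<Sum>i\<in>I. f i x)"
proof (cases "finite I")
  case True
  then show ?thesis using assms(2)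
    by (induction I rule: finite_induct) (auto intro!: Ck_on_const Ck_on_add[OF assms(1)])
qed (simp add: Ck_on_const)

text \<open>\<open>Ck_on\<close> differentiates in a fixed direction, whereas the chain rule applies
  the derivative of f to a vector that moves with x. Expanding that vector in the basis leaves
  products of derivatives in fixed directions, to which the induction hypothesis applies.\<close>

lemma Ck_on_compose:
  fixes f :: "'b::euclidean_space \<Rightarrow> real" and \<phi> :: "'a::real_normed_vector \<Rightarrow> 'b"
  assumes "open S" "open T" "\<And>x. x \<in> S \<Longrightarrow> \<phi> x \<in> T" "Ck_on k S \<phi>" "Ck_on k T f"
  shows "Ck_on k S (\<lambda>x. f (\<phi> x))"
  using assms(4,5)
proof (induction k arbitrary: f)
  case 0
  then show ?case using assms(3) by (auto intro: continuous_on_compose2)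
next
  case (Suc k)
  show ?case
  proof (rule Ck_on_SucI[OF assms(1)])
    fix x assume x: "x \<in> S"
    let ?D = "frechet_derivative f (at (\<phi> x))" and ?E = "frechet_derivative \<phi> (at x)"
    have D: "(f has_derivative ?D) (at (\<phi> x))"
      using Ck_on_has_derivative[OF Suc.prems(2)] assms(3)[OF x] by blast
    then have "((\<lambda>x. f (\<phi> x)) has_derivative (\<lambda>v. ?D (?E v))) (at x)"
      using has_derivative_compose[OF Ck_on_has_derivative[OF Suc.prems(1) x]] by blast
    moreover have "?D (?E v) = (\<Sum>b\<in>Basis. ?D b * (?E v \<bullet> b))" for v
    proof -
      interpret bounded_linear ?D using D by (rule has_derivative_bounded_linear)
      have "?D (?E v) = ?D (\<Sum>b\<in>Basis. (?E v \<bullet> b) *\<^sub>R b)" by (simp add: euclidean_representation)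
      then show ?thesis by (simp add: sum scaleR mult.commute)
    qed
    ultimately show "((\<lambda>x. f (\<phi> x)) has_derivative (\<lambda>v. \<Sum>b\<in>Basis. ?D b * (?E v \<bullet> b))) (at x)"
      by simp
  next
    show "Ck_on k S (\<lambda>x. \<Sum>b\<in>Basis. frechet_derivative f (at (\<phi> x)) b * (frechet_derivative \<phi> (at x) v \<bullet> b))" for v
    proof (intro Ck_on_sum Ck_on_mult assms(1))
      fix b :: 'b
      show "Ck_on k S (\<lambda>x. frechet_derivative f (at (\<phi> x)) b)"
        using Suc.IH[OF Ck_on_SucD[OF Suc.prems(1)], of "\<lambda>x. frechet_derivative f (at x) b"] Suc.prems(2)
        by simp
      show "Ck_on k S (\<lambda>x. frechet_derivative \<phi> (at x) v \<bullet> b)"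
        using Ck_on_bounded_linear_comp[OF assms(1) bounded_linear_inner_left,
            of k "\<lambda>x. frechet_derivative \<phi> (at x) v" b] Suc.prems(1) by simp
    qed
  qed
qed

lemma Ck_on_locally:
  assumes "\<And>x. x \<in> S \<Longrightarrow> \<exists>T. open T \<and> x \<in> T \<and> Ck_on k T f"
  shows "Ck_on k S f"
  using assms
proof (induction k arbitrary: f)
  case 0
  have "isCont f x" if x: "x \<in> S" for x
    using 0[OF x] by (metis Ck_on.simps(1) continuous_on_eq_continuous_at)
  then show ?case by (simp add: continuous_at_imp_continuous_on)
next
  case (Suc k)
  have "Ck_on k S (\<lambda>x. frechet_derivative f (at x) v)" for v
    using Suc.prems by (intro Suc.IH) (metis Ck_on.simps(2))
  moreover have "f differentiable at x" if "x \<in> S" for x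
    using Suc.prems[OF that] by auto
  ultimately show ?case by simp
qed

text \<open>Near 0 the function is flat. The family over \<open>k\<close> is closed under differentiation, up to linear
  combinations.\<close>

definition flat_exp :: "nat \<Rightarrow> real \<Rightarrow> real"
  where "flat_exp k t = (if t > 0 then exp (- inverse t) * inverse t ^ k else 0)"

text \<open>Differentiating exp(-1/t) produces a factor t^-2, and differentiating t^-k a factor -k
  t^-1, hence the shifts by 2 and by 1. For t \<le> 0 both terms vanish, so one formula covers all
  three cases.\<close>

lemma flat_exp_has_derivative:
  "(flat_exp k has_real_derivative (flat_exp (k + 2) t - real k * flat_exp (Suc k) t)) (at t)"
proof -
  consider "t > 0" | "t < 0" | "t = 0" by linarith
  then show ?thesis
  proof cases
    case 1
    have "((\<lambda>t. exp (- inverse t) * inverse t ^ k) has_real_derivative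
        (flat_exp (k + 2) t - real k * flat_exp (Suc k) t)) (at t)"
      using 1 by (auto intro!: derivative_eq_intros simp: flat_exp_def power2_eq_square field_simps)
        (cases k; simp add: field_simps power2_eq_square)
    then show ?thesis
      by (rule has_field_derivative_transform_within_open[where S="{0<..}"]) (use 1 in \<open>auto simp: flat_exp_def\<close>)
  next
    case 2
    have "((\<lambda>t. 0) has_real_derivative 0) (at t)" by simp
    then have "(flat_exp k has_real_derivative 0) (at t)"
      by (rule has_field_derivative_transform_within_open[where S="{..<0}"]) (use 2 in \<open>auto simp: flat_exp_def\<close>)
    then show ?thesis using 2 by (simp add: flat_exp_def)
  next
    case 3
    have "((\<lambda>t. exp (- inverse t) * inverse t ^ Suc k) \<longlongrightarrow> 0) (at_right (0::real))"
      by real_asymp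
    then have "((\<lambda>t. flat_exp k t / t) \<longlongrightarrow> 0) (at_right 0)"
      by (rule Lim_transform_eventually)
        (auto simp: flat_exp_def eventually_at_filter divide_inverse)
    moreover have "((\<lambda>t. flat_exp k t / t) \<longlongrightarrow> 0) (at_left 0)"
      by (rule Lim_transform_eventually[where f="\<lambda>_. 0"])
        (auto simp: flat_exp_def eventually_at_filter)
    ultimately have "((\<lambda>t. flat_exp k t / t) \<longlongrightarrow> 0) (at 0)"
      by (rule filterlim_split_at[rotated])
    then show ?thesis using 3 by (simp add: has_field_derivative_iff flat_exp_def)
  qed
qed

lemma Ck_on_flat_exp: "Ck_on m UNIV (flat_exp k)"
proof (induction m arbitrary: k)
  case 0
  show ?case using DERIV_isCont[OF flat_exp_has_derivative] by (auto intro: continuous_at_imp_continuous_on)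
next
  case (Suc m)
  show ?case
  proof (rule Ck_on_SucI)
    show "(flat_exp k has_derivative
        (\<lambda>v. (flat_exp (k + 2) t + (- real k) * flat_exp (Suc k) t) * v)) (at t)" for t
      using flat_exp_has_derivative[of k t] by (simp add: has_field_derivative_def)
    show "Ck_on m UNIV (\<lambda>t. (flat_exp (k + 2) t + (- real k) * flat_exp (Suc k) t) * v)" for v
      using Suc.IH by (intro Ck_on_mult Ck_on_add Ck_on_const) auto
  qed auto
qed

section \<open>Integrals along segments and the Hadamard lemma\<close>

text \<open>Differentiation under the integral sign yields a factor t from the inner map x |-> b + t
  (x - b). The weight \<open>\<psi>\<close> absorbs it, so that the derivative is an integral of the
  same kind and the induction closes.\<close>

lemma Ck_on_segment_integral:
  fixes f :: "'a::euclidean_space \<Rightarrow> real" and b :: 'a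
  assumes S: "open S" "convex S" "b \<in> S" and \<psi>: "continuous_on {0..1} \<psi>" and f: "Ck_on k S f"
  shows "Ck_on k S (\<lambda>x. integral {0..1} (\<lambda>t. \<psi> t * f (b + t *\<^sub>R (x - b))))"
proof -
  have seg: "b + t *\<^sub>R (x - b) \<in> S" if "x \<in> S" "t \<in> {0..1}" for x t
  proof -
    have "b + t *\<^sub>R (x - b) = (1 - t) *\<^sub>R b + t *\<^sub>R x" by (simp add: algebra_simps)
    then show ?thesis using that S by (simp add: convexD_alt)
  qed
  have cont: "continuous_on (S \<times> {0..1}) (\<lambda>(x, t). \<psi> t * f (b + t *\<^sub>R (x - b)))"
    if "continuous_on S f" "continuous_on {0..1} \<psi>" for \<psi> and f :: "'a \<Rightarrow> real"
  proof -
    have "continuous_on (S \<times> {0..1}) (\<lambda>p. f (b + snd p *\<^sub>R (fst p - b)))"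
      by (rule continuous_on_compose2[OF that(1)]) (auto intro!: continuous_intros seg)
    moreover have "continuous_on (S \<times> {0..1}) (\<lambda>p. \<psi> (snd p))"
      by (rule continuous_on_compose2[OF that(2)]) (auto intro!: continuous_intros)
    ultimately show ?thesis by (auto simp: case_prod_beta intro: continuous_on_mult)
  qed
  have contt: "continuous_on {0..1} (\<lambda>t. \<psi> t * f (b + t *\<^sub>R (x - b)))"
    if "continuous_on S f" "continuous_on {0..1} \<psi>" "x \<in> S" for \<psi> x and f :: "'a \<Rightarrow> real"
  proof -
    have "continuous_on {0..1} (\<lambda>t. f (b + t *\<^sub>R (x - b)))"
      by (rule continuous_on_compose2[OF that(1)]) (auto intro!: continuous_intros seg that)
    then show ?thesis using that by (intro continuous_on_mult)
  qed
  show ?thesis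
    using \<psi> f
  proof (induction k arbitrary: f \<psi>)
    case (0 f \<psi>)
    then show ?case
      using integral_continuous_on_param[of S 0 1 "\<lambda>x t. \<psi> t * f (b + t *\<^sub>R (x - b))"] cont[of f \<psi>]
      by simp
  next
    case (Suc k f \<psi>)
    let ?D = "\<lambda>x. frechet_derivative f (at x)"
    have D: "(f has_derivative ?D x) (at x)" if "x \<in> S" for x
      using Ck_on_has_derivative[OF Suc.prems(2) that] .
    have Dcont: "continuous_on S (\<lambda>x. ?D x v)" for v
      using Suc.prems(2) Ck_on_imp_continuous_on[of k S "\<lambda>x. ?D x v"] by simp
    have fcont: "continuous_on S f" using Suc.prems(2) Ck_on_imp_continuous_on by blast
    \<comment> \<open>The Leibniz rule for integrals asks for a derivative that is continuous in
      operator norm, hence the bounded linear functions; in finite dimension this can be checked on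
      basis vectors.\<close>
    define B where "B x t = Blinfun (\<lambda>v. \<psi> t * (t * ?D (b + t *\<^sub>R (x - b)) v))" for x t
    have bl: "bounded_linear (\<lambda>v. \<psi> t * (t * ?D (b + t *\<^sub>R (x - b)) v))" if "x \<in> S" "t \<in> {0..1}" for x t
      using has_derivative_bounded_linear[OF D[OF seg[OF that]]]
      by (intro bounded_linear_const_mult)
    have B: "blinfun_apply (B x t) v = \<psi> t * (t * ?D (b + t *\<^sub>R (x - b)) v)" if "x \<in> S" "t \<in> {0..1}" for x t v
      unfolding B_def by (subst bounded_linear_Blinfun_apply[OF bl[OF that]]) simp
    have t\<psi>: "continuous_on {0..1} (\<lambda>t. \<psi> t * t)"
      using Suc.prems(1) by (intro continuous_intros)
    have Bcont: "continuous_on (S \<times> cbox 0 1) (\<lambda>(x, t). B x t)"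
    proof (rule continuous_on_blinfun_componentwise)
      fix i :: 'a
      have "continuous_on (S \<times> cbox 0 1) (\<lambda>p. case p of (x, t) \<Rightarrow> (\<psi> t * t) * ?D (b + t *\<^sub>R (x - b)) i)"
        using cont[OF Dcont t\<psi>] by simp
      then show "continuous_on (S \<times> cbox 0 1) (\<lambda>p. blinfun_apply (case p of (x, t) \<Rightarrow> B x t) i)"
        by (rule continuous_on_eq) (auto simp: B)
    qed
    have "((\<lambda>x. integral (cbox 0 1) (\<lambda>t. \<psi> t * f (b + t *\<^sub>R (x - b)))) has_derivative
        integral (cbox 0 1) (B x)) (at x within S)" if x: "x \<in> S" for x
    proof (rule leibniz_rule[OF _ _ Bcont x S(2)])
      fix x t assume xt: "x \<in> S" "t \<in> cbox 0 (1::real)"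
      have "((\<lambda>x. b + t *\<^sub>R (x - b)) has_derivative (\<lambda>v. t *\<^sub>R v)) (at x)"
        by (auto intro!: derivative_eq_intros)
      from has_derivative_compose[OF this D[OF seg]] xt
      have "((\<lambda>x. f (b + t *\<^sub>R (x - b))) has_derivative (\<lambda>v. ?D (b + t *\<^sub>R (x - b)) (t *\<^sub>R v))) (at x)"
        by simp
      then have "((\<lambda>x. \<psi> t * f (b + t *\<^sub>R (x - b))) has_derivative
          (\<lambda>v. \<psi> t * ?D (b + t *\<^sub>R (x - b)) (t *\<^sub>R v))) (at x)"
        by (rule has_derivative_mult_right)
      moreover have "?D (b + t *\<^sub>R (x - b)) (t *\<^sub>R v) = t * ?D (b + t *\<^sub>R (x - b)) v" for v
        using xt by (simp add: linear_cmul[OF has_derivative_linear[OF D[OF seg]]])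
      moreover have "blinfun_apply (B x t) = (\<lambda>v. \<psi> t * (t * ?D (b + t *\<^sub>R (x - b)) v))"
        using xt by (auto simp: B)
      ultimately show "((\<lambda>x. \<psi> t * f (b + t *\<^sub>R (x - b))) has_derivative blinfun_apply (B x t)) (at x within S)"
        by (simp add: has_derivative_at_withinI)
    next
      show "(\<lambda>t. \<psi> t * f (b + t *\<^sub>R (x - b))) integrable_on cbox 0 1" if "x \<in> S" for x
        using contt[OF fcont Suc.prems(1) that] by (intro integrable_continuous) simp
    qed
    moreover have "blinfun_apply (integral (cbox 0 1) (B x)) v =
        integral {0..1} (\<lambda>t. (\<psi> t * t) * ?D (b + t *\<^sub>R (x - b)) v)" if x: "x \<in> S" for x v
    proof -
      have "continuous_on (cbox 0 1) (B x)"
        using continuous_on_compose2[OF Bcont, of "cbox 0 1" "\<lambda>t. (x, t)"] x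
        by (simp add: continuous_on_Pair image_subset_iff)
      then have "B x integrable_on cbox 0 1" by (rule integrable_continuous)
      then have "blinfun_apply (integral (cbox 0 1) (B x)) v = integral (cbox 0 1) (\<lambda>t. blinfun_apply (B x t) v)"
        by (rule blinfun_apply_integral)
      also have "\<dots> = integral {0..1} (\<lambda>t. (\<psi> t * t) * ?D (b + t *\<^sub>R (x - b)) v)"
        using x by (auto intro!: integral_cong simp: B)
      finally show ?thesis .
    qed
    ultimately have d: "((\<lambda>x. integral {0..1} (\<lambda>t. \<psi> t * f (b + t *\<^sub>R (x - b)))) has_derivative
        (\<lambda>v. integral {0..1} (\<lambda>t. (\<psi> t * t) * ?D (b + t *\<^sub>R (x - b)) v))) (at x)" if "x \<in> S" for x
    proof -
      have "blinfun_apply (integral (cbox 0 1) (B x)) =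
          (\<lambda>v. integral {0..1} (\<lambda>t. (\<psi> t * t) * ?D (b + t *\<^sub>R (x - b)) v))"
        using \<open>\<And>x v. x \<in> S \<Longrightarrow> blinfun_apply (integral (cbox 0 1) (B x)) v = _ x v\<close>[OF that] by blast
      then show ?thesis
        using \<open>\<And>x. x \<in> S \<Longrightarrow> (_ has_derivative blinfun_apply (integral (cbox 0 1) (B x))) (at x within S)\<close>[OF that]
          at_within_open[OF that S(1)] by simp
    qed
    show ?case
      by (rule Ck_on_SucI[OF S(1) d]) (use Suc t\<psi> in auto)
  qed
qed

text \<open>Integrate the derivative of f along the segment from b to x and split x - b into
  coordinates: \<open>h i\<close> is the mean over the segment of the i-th partial derivative. A
  derivation at b applied to this expansion sees only the partial derivatives at b.\<close>

lemma hadamard: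
  fixes f :: "real ^ 'n \<Rightarrow> real"
  assumes S: "open S" "convex S" "b \<in> S" and f: "smooth_on S f"
  obtains h where "\<And>i. smooth_on S (h i)"
    "\<And>x. x \<in> S \<Longrightarrow> f x = f b + (\<Sum>i\<in>UNIV. (x $ i - b $ i) * h i x)"
    "\<And>i. h i b = frechet_derivative f (at b) (axis i 1)"
proof
  let ?D = "\<lambda>x. frechet_derivative f (at x)"
  \<comment> \<open>The factor 1 is the weight \<open>\<psi>\<close> of the segment
    integral.\<close>
  let ?h = "\<lambda>i x. integral {0..1} (\<lambda>t. 1 * ?D (b + t *\<^sub>R (x - b)) (axis i 1))"
  have f1: "Ck_on (Suc k) S f" for k using f by (simp only: smooth_on_def)
  have Dk: "Ck_on k S (\<lambda>x. ?D x v)" for k v using f1 by simp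
  show "smooth_on S (?h i)" for i
    unfolding smooth_on_def using Ck_on_segment_integral[OF S _ Dk, of "\<lambda>_. 1"] by simp
  show "?h i b = ?D b (axis i 1)" for i by simp
  fix x assume x: "x \<in> S"
  have seg: "b + t *\<^sub>R (x - b) \<in> S" if "t \<in> {0..1}" for t
  proof -
    have "b + t *\<^sub>R (x - b) = (1 - t) *\<^sub>R b + t *\<^sub>R x" by (simp add: algebra_simps)
    then show ?thesis using that S x by (simp add: convexD_alt)
  qed
  have lin: "linear (?D y)" if "y \<in> S" for y
    using has_derivative_linear[OF Ck_on_has_derivative[OF f1 that]] .
  have "((\<lambda>t. ?D (b + t *\<^sub>R (x - b)) (x - b)) has_integral f (b + 1 *\<^sub>R (x - b)) - f (b + 0 *\<^sub>R (x - b))) {0..1}"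
  proof (rule fundamental_theorem_of_calculus)
    fix t :: real assume t: "t \<in> {0..1}"
    have "((\<lambda>t. b + t *\<^sub>R (x - b)) has_derivative (\<lambda>s. s *\<^sub>R (x - b))) (at t within {0..1})"
      by (auto intro!: derivative_eq_intros)
    from has_derivative_compose[OF this Ck_on_has_derivative[OF f1 seg[OF t]]]
    show "((\<lambda>t. f (b + t *\<^sub>R (x - b))) has_vector_derivative ?D (b + t *\<^sub>R (x - b)) (x - b)) (at t within {0..1})"
      unfolding has_vector_derivative_def using linear_cmul[OF lin[OF seg[OF t]]] by simp
  qed simp
  then have "f x - f b = integral {0..1} (\<lambda>t. ?D (b + t *\<^sub>R (x - b)) (x - b))"
    by (simp add: integral_unique)
  also have "\<dots> = integral {0..1} (\<lambda>t. \<Sum>i\<in>UNIV. (x $ i - b $ i) * ?D (b + t *\<^sub>R (x - b)) (axis i 1))"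
  proof (rule integral_cong)
    fix t :: real assume t: "t \<in> {0..1}"
    have "?D (b + t *\<^sub>R (x - b)) (\<Sum>i\<in>UNIV. (x - b) $ i *s axis i 1) =
        (\<Sum>i\<in>UNIV. (x - b) $ i * ?D (b + t *\<^sub>R (x - b)) (axis i 1))"
      using lin[OF seg[OF t]] by (simp add: linear_sum linear_cmul scalar_mult_eq_scaleR)
    then show "?D (b + t *\<^sub>R (x - b)) (x - b) = (\<Sum>i\<in>UNIV. (x $ i - b $ i) * ?D (b + t *\<^sub>R (x - b)) (axis i 1))"
      unfolding basis_expansion by simp
  qed
  also have "\<dots> = (\<Sum>i\<in>UNIV. integral {0..1} (\<lambda>t. (x $ i - b $ i) * ?D (b + t *\<^sub>R (x - b)) (axis i 1)))"
  proof (rule integral_sum)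
    fix i :: 'n
    have "continuous_on {0..1} (\<lambda>t. ?D (b + t *\<^sub>R (x - b)) (axis i 1))"
      using Ck_on_imp_continuous_on[OF Dk]
      by (rule continuous_on_compose2) (auto intro!: continuous_intros seg)
    then show "(\<lambda>t. (x $ i - b $ i) * ?D (b + t *\<^sub>R (x - b)) (axis i 1)) integrable_on {0..1}"
      by (intro integrable_continuous_real continuous_on_mult_left)
  qed simp
  finally show "f x = f b + (\<Sum>i\<in>UNIV. (x $ i - b $ i) * ?h i x)" by simp
qed

section \<open>Smooth functions and vector fields on a closed manifold\<close>

lemma sum_fun_apply: "(\<Sum>i\<in>I. X i) p = (\<Sum>i\<in>I. X i p :: 'a::comm_monoid_add)"
  by (induction I rule: infinite_finite_induct) auto

locale closed_manifold =
  fixes A :: "('m::t2_space, 'n::finite) chart set"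
  assumes compact_UNIV: "compact (UNIV :: 'm set)" and atlas: "smooth_atlas A"
begin

abbreviation "C \<equiv> smooth_functions A"
abbreviation "VF \<equiv> vector_fields A"
abbreviation "T \<equiv> tangent_space A"

lemma chartD:
  assumes "(U, \<phi>) \<in> A"
  shows "open U" "open (\<phi> ` U)" "continuous_on U \<phi>" "continuous_on (\<phi> ` U) (inv_into U \<phi>)"
    "x \<in> U \<Longrightarrow> inv_into U \<phi> (\<phi> x) = x"
proof -
  have "is_chart (U, \<phi>)" using atlas assms by (auto simp: smooth_atlas_def)
  then have "open U" "open (\<phi> ` U)" "homeomorphism U (\<phi> ` U) \<phi> (inv_into U \<phi>)"
    by (auto simp: is_chart_def)
  then show "open U" "open (\<phi> ` U)" "continuous_on U \<phi>" "continuous_on (\<phi> ` U) (inv_into U \<phi>)"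
    "x \<in> U \<Longrightarrow> inv_into U \<phi> (\<phi> x) = x"
    by (auto simp: homeomorphism_def)
qed

lemma chart_at: obtains U \<phi> where "(U, \<phi>) \<in> A" "p \<in> U"
proof -
  have "p \<in> (\<Union>c\<in>A. fst c)" using atlas by (simp add: smooth_atlas_def)
  then show ?thesis using that by auto
qed

lemma C_iff: "f \<in> C \<longleftrightarrow> (\<forall>U \<phi> k. (U, \<phi>) \<in> A \<longrightarrow> Ck_on k (\<phi> ` U) (\<lambda>x. f (inv_into U \<phi> x)))"
  by (auto simp: smooth_functions_def smooth_on_def o_def)

lemma C_const [simp]: "(\<lambda>p. c) \<in> C"
  by (simp add: C_iff Ck_on_const)

lemma C_add [simp]: "f \<in> C \<Longrightarrow> h \<in> C \<Longrightarrow> (\<lambda>p. f p + h p) \<in> C"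
  unfolding C_iff by (auto intro: Ck_on_add chartD)

lemma C_mult [simp]: "f \<in> C \<Longrightarrow> h \<in> C \<Longrightarrow> (\<lambda>p. f p * h p) \<in> C"
  unfolding C_iff by (auto intro: Ck_on_mult chartD)

lemma C_uminus [simp]: "f \<in> C \<Longrightarrow> (\<lambda>p. - f p) \<in> C"
  using C_mult[OF C_const, of f "-1"] by simp

lemma C_diff [simp]: "f \<in> C \<Longrightarrow> h \<in> C \<Longrightarrow> (\<lambda>p. f p - h p) \<in> C"
  using C_add[of f "\<lambda>p. - h p"] by simp

lemma C_power [simp]: "f \<in> C \<Longrightarrow> (\<lambda>p. f p ^ k) \<in> C"
  by (induction k) auto

lemma C_sum [simp]: "(\<And>i. i \<in> I \<Longrightarrow> f i \<in> C) \<Longrightarrow> (\<lambda>p. \<Sum>i\<in>I. f i p) \<in> C"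
  by (induction I rule: infinite_finite_induct) auto

lemma C_prod [simp]: "(\<And>i. i \<in> I \<Longrightarrow> f i \<in> C) \<Longrightarrow> (\<lambda>p. \<Prod>i\<in>I. f i p) \<in> C"
  by (induction I rule: infinite_finite_induct) auto

lemma C_continuous: "f \<in> C \<Longrightarrow> continuous_on S f"
proof -
  assume f: "f \<in> C"
  have "isCont f p" for p
  proof -
    obtain U \<phi> where U: "(U, \<phi>) \<in> A" "p \<in> U" by (rule chart_at)
    have "continuous_on (\<phi> ` U) (\<lambda>x. f (inv_into U \<phi> x))"
      using f U(1) unfolding C_iff by (metis Ck_on.simps(1))
    then have "continuous_on U (\<lambda>q. f (inv_into U \<phi> (\<phi> q)))"
      by (rule continuous_on_compose2) (use chartD[OF U(1)] in auto)
    then have "continuous_on U f"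
      by (rule continuous_on_eq) (simp add: chartD[OF U(1)])
    then show ?thesis using U chartD(1)[OF U(1)] continuous_on_eq_continuous_at by blast
  qed
  then show ?thesis by (simp add: continuous_at_imp_continuous_on)
qed

lemma C_bounded: "f \<in> C \<Longrightarrow> \<exists>B. \<forall>p. \<bar>f p\<bar> \<le> B"
proof -
  assume "f \<in> C"
  then have "compact (range f)"
    using compact_continuous_image[OF C_continuous compact_UNIV] by blast
  then have "bounded (range f)" by (rule compact_imp_bounded)
  then show ?thesis by (auto simp: bounded_iff)
qed

text \<open>Near \<open>p0\<close> the function u is the quotient of l by k. The equation is
  demanded on all of M while k may vanish away from \<open>p0\<close>; cut-off frames deliver
  exactly such equations.\<close>

lemma C_local_quotient:
  assumes "\<And>p0. \<exists>k\<in>C. \<exists>l\<in>C. k p0 \<noteq> 0 \<and> (\<forall>p. k p * u p = l p)"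
  shows "u \<in> C"
  unfolding C_iff
proof (intro allI impI)
  fix U \<phi> m assume U: "(U, \<phi>) \<in> A"
  let ?i = "inv_into U \<phi>"
  show "Ck_on m (\<phi> ` U) (\<lambda>x. u (?i x))"
  proof (rule Ck_on_locally)
    fix x assume x: "x \<in> \<phi> ` U"
    obtain k l where kl: "k \<in> C" "l \<in> C" "k (?i x) \<noteq> 0" "\<And>p. k p * u p = l p"
      using assms[of "?i x"] by blast
    have k: "Ck_on m (\<phi> ` U) (\<lambda>x. k (?i x))" "Ck_on m (\<phi> ` U) (\<lambda>x. l (?i x))" for m
      using kl U unfolding C_iff by auto
    let ?S = "\<phi> ` U \<inter> (\<lambda>x. k (?i x)) -` (- {0})"
    have S: "open ?S"
      using Ck_on_imp_continuous_on[OF k(1)] chartD(2)[OF U] by (rule continuous_open_preimage) auto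
    have "Ck_on m ?S (\<lambda>x. l (?i x) * inverse (k (?i x)))"
      by (intro Ck_on_mult Ck_on_inverse S) (use k in \<open>auto intro: Ck_on_subset\<close>)
    then have "Ck_on m ?S (\<lambda>x. u (?i x))"
    proof (rule Ck_on_cong_imp[OF S, rotated])
      show "l (?i y) * inverse (k (?i y)) = u (?i y)" if "y \<in> ?S" for y
        using kl(4)[of "?i y"] that by (auto simp: field_simps)
    qed
    then show "\<exists>S. open S \<and> x \<in> S \<and> Ck_on m S (\<lambda>x. u (?i x))"
      using S x kl(3) by (intro exI[of _ ?S]) auto
  qed
qed

lemma C_inverse: "f \<in> C \<Longrightarrow> (\<And>p. f p \<noteq> 0) \<Longrightarrow> (\<lambda>p. inverse (f p)) \<in> C"
  by (rule C_local_quotient, rule bexI[of _ f], rule bexI[of _ "\<lambda>_. 1"]) auto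

text \<open>In any other chart, every point has a neighbourhood on which the extension by 0 is
  either H composed with a transition map or identically 0.\<close>

lemma C_pullback:
  assumes U: "(U, \<phi>) \<in> A" and S: "open S" "K \<subseteq> S" "S \<subseteq> \<phi> ` U" "compact K"
    and H: "smooth_on S H" "\<And>x. x \<in> S \<Longrightarrow> x \<notin> K \<Longrightarrow> H x = 0"
  shows "(\<lambda>q. if q \<in> U \<and> \<phi> q \<in> S then H (\<phi> q) else 0) \<in> C" (is "?h \<in> C")
  unfolding C_iff
proof (intro allI impI)
  fix U' \<phi>' m assume U': "(U', \<phi>') \<in> A"
  let ?i = "inv_into U' \<phi>'"
  have pre: "open (\<phi>' ` U' \<inter> ?i -` Q)" if "open Q" for Q
    using chartD(4,2)[OF U'] that by (rule continuous_open_preimage)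
  have i: "?i x \<in> U'" "\<phi>' (?i x) = x" if "x \<in> \<phi>' ` U'" for x
    using that chartD(5)[OF U'] by auto
  have Q: "open (U \<inter> \<phi> -` S)"
    using chartD(3,1)[OF U] S(1) by (rule continuous_open_preimage)
  define K' where "K' = inv_into U \<phi> ` K"
  have "compact K'" unfolding K'_def
    using S chartD(4)[OF U] by (intro compact_continuous_image) (auto intro: continuous_on_subset)
  \<comment> \<open>In a Hausdorff space the compact set \<open>K'\<close> is closed; this keeps the
    extension smooth at points outside U.\<close>
  then have closed: "open (- K')" by (simp add: compact_imp_closed open_Compl)
  show "Ck_on m (\<phi>' ` U') (\<lambda>x. ?h (?i x))"
  proof (rule Ck_on_locally)
    fix x assume x: "x \<in> \<phi>' ` U'"
    show "\<exists>W. open W \<and> x \<in> W \<and> Ck_on m W (\<lambda>x. ?h (?i x))"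
    proof (cases "?i x \<in> U \<and> \<phi> (?i x) \<in> S")
      case True
      let ?W = "\<phi>' ` U' \<inter> ?i -` (U \<inter> \<phi> -` S)"
      note W = pre[OF Q]
      have "Ck_on m (\<phi>' ` (U' \<inter> U)) (transition_map (U', \<phi>') (U, \<phi>))"
        using atlas U U' unfolding smooth_atlas_def smooth_on_def by fastforce
      then have tr: "Ck_on m ?W (transition_map (U', \<phi>') (U, \<phi>))"
      proof (rule Ck_on_subset)
        show "?W \<subseteq> \<phi>' ` (U' \<inter> U)" using i by (auto intro!: image_eqI[where x="?i _"] simp: chartD(5)[OF U'])
      qed
      have "Ck_on m ?W (\<lambda>x. H (transition_map (U', \<phi>') (U, \<phi>) x))"
        by (rule Ck_on_compose[OF W S(1) _ tr]) (use H(1) in \<open>auto simp: transition_map_def smooth_on_def\<close>)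
      then have "Ck_on m ?W (\<lambda>x. ?h (?i x))"
        by (rule Ck_on_cong_imp[OF W, rotated]) (auto simp: transition_map_def)
      then show ?thesis using W x True by (intro exI[of _ ?W]) auto
    next
      case False
      let ?W = "\<phi>' ` U' \<inter> ?i -` (- K')"
      have "Ck_on m ?W (\<lambda>x. ?h (?i x))"
      proof (rule Ck_on_cong_imp[OF pre[OF closed] _ Ck_on_const[of _ _ 0]])
        fix y assume "y \<in> ?W"
        then have y: "?i y \<notin> K'" by auto
        have "\<phi> (?i y) \<notin> K" if "?i y \<in> U"
          using y chartD(5)[OF U that] unfolding K'_def by (metis imageI)
        then show "0 = ?h (?i y)" using H(2) by auto
      qed
      moreover have "?i x \<notin> K'"
      proof
        assume "?i x \<in> K'"
        then obtain z where z: "z \<in> K" "?i x = inv_into U \<phi> z" by (auto simp: K'_def)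
        then obtain u where "u \<in> U" "z = \<phi> u" using S by blast
        then show False using False z S chartD(5)[OF U] by auto
      qed
      ultimately show ?thesis using pre[OF closed] x by (intro exI[of _ ?W]) auto
    qed
  qed
qed

section \<open>Tangent vectors and vector fields\<close>

lemma tangent_space_outside: "v \<in> T p \<Longrightarrow> f \<notin> C \<Longrightarrow> v f = 0"
  by (simp add: tangent_space_def)

lemma tangent_add: "v \<in> T p \<Longrightarrow> f \<in> C \<Longrightarrow> h \<in> C \<Longrightarrow> v (\<lambda>x. f x + h x) = v f + v h"
  by (simp add: tangent_space_def plus_fun_def)

lemma tangent_cmult: "v \<in> T p \<Longrightarrow> f \<in> C \<Longrightarrow> v (\<lambda>x. c * f x) = c * v f"
  by (simp add: tangent_space_def)

lemma tangent_mult: "v \<in> T p \<Longrightarrow> f \<in> C \<Longrightarrow> h \<in> C \<Longrightarrow> v (\<lambda>x. f x * h x) = f p * v h + h p * v f"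
  by (simp add: tangent_space_def times_fun_def)

lemma tangent_const: "v \<in> T p \<Longrightarrow> v (\<lambda>x. c) = 0"
  using tangent_mult[of v p "\<lambda>_. 1" "\<lambda>_. 1"] tangent_cmult[of v p "\<lambda>_. 1" c] by simp

lemma tangent_diff: "v \<in> T p \<Longrightarrow> f \<in> C \<Longrightarrow> h \<in> C \<Longrightarrow> v (\<lambda>x. f x - h x) = v f - v h"
  using tangent_add[of v p f "\<lambda>x. - 1 * h x"] tangent_cmult[of v p h "-1"] C_mult[OF C_const, of h "-1"]
  by simp

lemma tangent_sum: "v \<in> T p \<Longrightarrow> (\<And>i. i \<in> I \<Longrightarrow> f i \<in> C) \<Longrightarrow> v (\<lambda>x. \<Sum>i\<in>I. f i x) = (\<Sum>i\<in>I. v (f i))"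
proof (induction I rule: infinite_finite_induct)
  case (insert i I)
  have "v (\<lambda>x. f i x + (\<Sum>i\<in>I. f i x)) = v (f i) + v (\<lambda>x. \<Sum>i\<in>I. f i x)"
    using insert.prems by (intro tangent_add) auto
  then show ?case using insert by simp
qed (auto dest: tangent_const)

lemma tangent_spaceI:
  assumes "\<And>f. f \<notin> C \<Longrightarrow> v f = 0"
    and "\<And>f h. f \<in> C \<Longrightarrow> h \<in> C \<Longrightarrow> v (\<lambda>x. f x + h x) = v f + v h"
    and "\<And>c f. f \<in> C \<Longrightarrow> v (\<lambda>x. c * f x) = c * v f"
    and "\<And>f h. f \<in> C \<Longrightarrow> h \<in> C \<Longrightarrow> v (\<lambda>x. f x * h x) = f p * v h + h p * v f"
  shows "v \<in> T p"
  using assms by (simp add: tangent_space_def plus_fun_def times_fun_def)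

lemma tangent_space_add: "v \<in> T p \<Longrightarrow> w \<in> T p \<Longrightarrow> (\<lambda>f. v f + w f) \<in> T p"
  by (rule tangent_spaceI)
    (simp_all add: tangent_space_outside[of v p] tangent_space_outside[of w p] tangent_add[of v p]
      tangent_add[of w p] tangent_cmult[of v p] tangent_cmult[of w p] tangent_mult[of v p] tangent_mult[of w p]
      algebra_simps)

lemma tangent_space_cmult: "v \<in> T p \<Longrightarrow> (\<lambda>f. c * v f) \<in> T p"
  by (rule tangent_spaceI)
    (simp_all add: tangent_space_outside[of v p] tangent_add[of v p] tangent_cmult[of v p] tangent_mult[of v p]
      algebra_simps)

lemma tangent_space_zero: "(\<lambda>f. 0) \<in> T p"
  by (rule tangent_spaceI) auto

lemma tangent_space_sum: "(\<And>i. i \<in> I \<Longrightarrow> v i \<in> T p) \<Longrightarrow> (\<lambda>f. \<Sum>i\<in>I. v i f) \<in> T p"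
  by (induction I rule: infinite_finite_induct) (auto intro: tangent_space_zero tangent_space_add)

lemma VF_tangent: "X \<in> VF \<Longrightarrow> X p \<in> T p"
  by (simp add: vector_fields_def)

lemma VF_app: "X \<in> VF \<Longrightarrow> f \<in> C \<Longrightarrow> (\<lambda>p. X p f) \<in> C"
  by (simp add: vector_fields_def app_def)

lemma VF_I: "(\<And>p. X p \<in> T p) \<Longrightarrow> (\<And>f. f \<in> C \<Longrightarrow> (\<lambda>p. X p f) \<in> C) \<Longrightarrow> X \<in> VF"
  by (simp add: vector_fields_def app_def)

lemma VF_add: "X \<in> VF \<Longrightarrow> Y \<in> VF \<Longrightarrow> X + Y \<in> VF"
  by (rule VF_I) (auto simp: plus_fun_def VF_app intro: tangent_space_add VF_tangent)

lemma VF_vmul: "f \<in> C \<Longrightarrow> X \<in> VF \<Longrightarrow> vmul f X \<in> VF"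
  by (rule VF_I) (auto simp: vmul_def VF_app intro: tangent_space_cmult VF_tangent)

lemma VF_zero: "0 \<in> VF"
  by (rule VF_I) (auto simp: zero_fun_def tangent_space_zero)

lemma VF_sum: "(\<And>i. i \<in> I \<Longrightarrow> X i \<in> VF) \<Longrightarrow> (\<Sum>i\<in>I. X i) \<in> VF"
  by (induction I rule: infinite_finite_induct) (auto intro: VF_zero VF_add)

lemma VF_lie_bracket: "X \<in> VF \<Longrightarrow> Y \<in> VF \<Longrightarrow> lie_bracket A X Y \<in> VF"
proof (rule VF_I)
  assume X: "X \<in> VF" and Y: "Y \<in> VF"
  note [simp] = VF_app[OF X] VF_app[OF Y]
  note XY = VF_tangent[OF X] VF_tangent[OF Y]
  note [simp] = tangent_add[OF XY(1)] tangent_add[OF XY(2)] tangent_cmult[OF XY(1)] tangent_cmult[OF XY(2)]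
    tangent_mult[OF XY(1)] tangent_mult[OF XY(2)] tangent_space_outside[OF XY(1)] tangent_space_outside[OF XY(2)]
  show "lie_bracket A X Y p \<in> T p" for p
    by (rule tangent_spaceI) (auto simp: lie_bracket_def app_def algebra_simps)
  show "(\<lambda>p. lie_bracket A X Y p f) \<in> C" if "f \<in> C" for f
    using that by (simp add: lie_bracket_def app_def)
qed

text \<open>The frame \<open>E\<close> consists of the coordinate fields cut off by a bump function \<open>\<rho>\<close>, and \<open>X\<close> of the
  coordinates multiplied by \<open>\<rho>\<close>; on the set where \<open>\<rho>\<close> does not vanish, the last two clauses say that
  \<open>E\<close> is a basis of every tangent space, with an explicit dual basis.\<close>

lemma local_frame:
  obtains \<rho> X E where "\<rho> \<in> C" "\<And>i::'n. X i \<in> C" "\<And>i::'n. E i \<in> VF"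
    "\<rho> p0 \<noteq> 0" "\<And>q. \<rho> q = \<rho> p0 \<Longrightarrow> q = p0"
    "\<And>q v f. v \<in> T q \<Longrightarrow> \<rho> q ^ 3 * v f = (\<Sum>i\<in>UNIV. (\<rho> q * v (X i) - X i q * v \<rho>) * E i q f)"
    "\<And>q i j. \<rho> q * E j q (X i) - X i q * E j q \<rho> = (if i = j then \<rho> q ^ 3 else 0)"
proof -
  obtain U \<phi> where U: "(U, \<phi>) \<in> A" "p0 \<in> U" by (rule chart_at)
  let ?i = "inv_into U \<phi>"
  define a where "a = \<phi> p0"
  obtain R where R: "R > 0" "ball a R \<subseteq> \<phi> ` U"
    using chartD(2)[OF U(1)] U(2) open_contains_ball unfolding a_def by blast
  define S where "S = ball a R"
  define r where "r = R / 2"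
  have S: "open S" "convex S" "cball a r \<subseteq> S" "S \<subseteq> \<phi> ` U" "r > 0" "compact (cball a r)"
    using R by (auto simp: S_def r_def)
  define \<beta> where "\<beta> x = flat_exp 0 (r\<^sup>2 + (-1) * (\<Sum>i\<in>UNIV. (x $ i + - a $ i) * (x $ i + - a $ i)))" for x
  have n: "(\<Sum>i\<in>UNIV. (x $ i + - a $ i) * (x $ i + - a $ i)) = (dist a x)\<^sup>2" for x
    by (simp add: dist_norm norm_minus_commute[of a] power2_norm_eq_inner inner_vec_def)
  have \<beta>0: "\<beta> x = 0" if "x \<notin> cball a r" for x
  proof -
    have "r\<^sup>2 \<le> (dist a x)\<^sup>2" using that S(5) by (intro power_mono) auto
    then show ?thesis unfolding \<beta>_def n flat_exp_def by simp
  qed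
  have \<beta>a: "\<beta> a \<noteq> 0" using S(5) by (simp add: \<beta>_def flat_exp_def)
  have \<beta>inj: "x = a" if "\<beta> x = \<beta> a" for x
    using that S(5) unfolding \<beta>_def n by (auto simp: flat_exp_def split: if_splits)
  have co: "Ck_on k W (\<lambda>x. x $ i)" if "open W" for k i and W :: "(real ^ 'n) set"
    using Ck_on_bounded_linear_comp[OF that bounded_linear_vec_nth Ck_on_ident[OF that]] .
  have \<beta>smooth: "Ck_on k W \<beta>" if W: "open W" for k W
    unfolding \<beta>_def
    by (rule Ck_on_compose[OF W open_UNIV UNIV_I _ Ck_on_flat_exp])
      (intro Ck_on_add Ck_on_mult Ck_on_sum Ck_on_const co W)
  \<comment> \<open>Extension by 0 to all of M of a function on the chart ball. It is applied to
    multiples of \<beta>, for which the result is smooth.\<close>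
  define P where "P H = (\<lambda>q. if q \<in> U \<and> \<phi> q \<in> S then H (\<phi> q) else 0)" for H :: "real ^ 'n \<Rightarrow> real"
  have P: "P (\<lambda>x. \<beta> x * H x) \<in> C" if "\<And>k. Ck_on k S H" for H
    unfolding P_def
    by (rule C_pullback[OF U(1) S(1,3,4,6)]) (use that \<beta>0 S(1) in \<open>auto simp: smooth_on_def intro!: Ck_on_mult \<beta>smooth\<close>)
  define \<rho> where "\<rho> = P (\<lambda>x. \<beta> x * 1)"
  define X where "X i = P (\<lambda>x. \<beta> x * x $ i)" for i
  define E where "E i q f = (if f \<in> C then P (\<lambda>x. \<beta> x * frechet_derivative (\<lambda>x. f (?i x)) (at x) (axis i 1)) q else 0)" for i q f
  have \<rho>C: "\<rho> \<in> C" unfolding \<rho>_def by (rule P) (rule Ck_on_const)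
  have XC: "X i \<in> C" for i unfolding X_def by (rule P) (rule co[OF S(1)])
  have fS: "Ck_on k S (\<lambda>x. f (?i x))" if "f \<in> C" for f k
    using that U(1) S(4) unfolding C_iff by (auto intro: Ck_on_subset)
  have fD: "((\<lambda>x. f (?i x)) has_derivative frechet_derivative (\<lambda>x. f (?i x)) (at x)) (at x)"
    if "f \<in> C" "x \<in> S" for f x
    using Ck_on_has_derivative[OF fS[OF that(1)] that(2)] .
  have iphi: "?i (\<phi> q) = q" if "q \<in> U" for q using chartD(5)[OF U(1) that] .
  have phii: "\<phi> (?i x) = x" "?i x \<in> U" if "x \<in> S" for x using S(4) that iphi by auto
  have EC: "E i \<in> VF" for i
  proof (rule VF_I)
    show "(\<lambda>p. E i p f) \<in> C" if f: "f \<in> C" for f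
    proof -
      have "Ck_on k S (\<lambda>x. frechet_derivative (\<lambda>x. f (?i x)) (at x) (axis i 1))" for k
        using fS[OF f, of "Suc k"] by simp
      from P[OF this] show ?thesis using f by (simp add: E_def)
    qed
    fix q
    have "frechet_derivative (\<lambda>x. f (?i x) + h (?i x)) (at x) =
        (\<lambda>v. frechet_derivative (\<lambda>x. f (?i x)) (at x) v + frechet_derivative (\<lambda>x. h (?i x)) (at x) v)"
      if "f \<in> C" "h \<in> C" "x \<in> S" for f h x
      by (rule frechet_derivative_at[OF has_derivative_add[OF fD[OF that(1,3)] fD[OF that(2,3)]], symmetric])
    moreover have "frechet_derivative (\<lambda>x. c * f (?i x)) (at x) = (\<lambda>v. c * frechet_derivative (\<lambda>x. f (?i x)) (at x) v)"
      if "f \<in> C" "x \<in> S" for f c x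
      by (rule frechet_derivative_at[OF has_derivative_mult_right[OF fD[OF that]], symmetric])
    moreover have "frechet_derivative (\<lambda>x. f (?i x) * h (?i x)) (at x) =
        (\<lambda>v. f (?i x) * frechet_derivative (\<lambda>x. h (?i x)) (at x) v + frechet_derivative (\<lambda>x. f (?i x)) (at x) v * h (?i x))"
      if "f \<in> C" "h \<in> C" "x \<in> S" for f h x
      by (rule frechet_derivative_at[OF has_derivative_mult[OF fD[OF that(1,3)] fD[OF that(2,3)]], symmetric])
    ultimately show "E i q \<in> T q"
      by (intro tangent_spaceI) (auto simp: E_def P_def algebra_simps iphi)
  qed
  have \<rho>p0: "\<rho> p0 = \<beta> a" using U(2) R by (auto simp: \<rho>_def P_def S_def a_def)
  have inj: "q = p0" if "\<rho> q = \<rho> p0" for q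
  proof -
    have q: "q \<in> U" "\<beta> (\<phi> q) = \<beta> a"
      using that \<beta>a unfolding \<rho>p0 by (auto simp: \<rho>_def P_def split: if_splits)
    then show ?thesis using \<beta>inj[OF q(2)] iphi U(2) unfolding a_def by metis
  qed
  have span: "\<rho> q ^ 3 * v f = (\<Sum>i\<in>UNIV. (\<rho> q * v (X i) - X i q * v \<rho>) * E i q f)" if v: "v \<in> T q" for q v f
  proof (cases "f \<in> C \<and> q \<in> U \<and> \<phi> q \<in> S")
    case False
    then have "E i q f = 0" for i by (auto simp: E_def P_def)
    moreover have "\<rho> q ^ 3 * v f = 0"
      using False tangent_space_outside[OF v, of f] by (auto simp: \<rho>_def P_def)
    ultimately show ?thesis by simp
  next
    case True
    define b where "b = \<phi> q"
    have f: "f \<in> C" and b: "b \<in> S" "q \<in> U" "?i b = q" using True iphi by (auto simp: b_def)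
    have "smooth_on S (\<lambda>x. f (?i x))" using fS[OF f] by (simp add: smooth_on_def)
    then obtain h where h: "\<And>i. smooth_on S (h i)"
      "\<And>x. x \<in> S \<Longrightarrow> f (?i x) = f (?i b) + (\<Sum>i\<in>UNIV. (x $ i - b $ i) * h i x)"
      "\<And>i. h i b = frechet_derivative (\<lambda>x. f (?i x)) (at b) (axis i 1)"
      by (rule hadamard[OF S(1,2) b(1)]) blast
    define H where "H i = P (\<lambda>x. \<beta> x * h i x)" for i
    have HC: "H i \<in> C" for i unfolding H_def by (rule P) (use h(1) in \<open>auto simp: smooth_on_def\<close>)
    have XH: "(\<lambda>p. X i p - b $ i * \<rho> p) \<in> C" for i using XC \<rho>C by simp
    \<comment> \<open>The Hadamard expansion of f multiplied by \<beta>^2, one factor for the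
      coordinate and one for \<open>h i\<close>. Both sides vanish outside the chart ball, so this
      is an identity of global functions and v can be applied to it.\<close>
    have "\<rho> p * \<rho> p * f p = f q * (\<rho> p * \<rho> p) + (\<Sum>i\<in>UNIV. (X i p - b $ i * \<rho> p) * H i p)" for p
    proof (cases "p \<in> U \<and> \<phi> p \<in> S")
      case True
      then have *: "f p = f q + (\<Sum>i\<in>UNIV. (\<phi> p $ i - b $ i) * h i (\<phi> p))"
        using h(2)[of "\<phi> p"] iphi b by auto
      show ?thesis
        unfolding * using True
        by (simp add: \<rho>_def X_def H_def P_def algebra_simps sum_distrib_left)
    qed (auto simp: \<rho>_def X_def H_def P_def)
    then have "(\<lambda>p. \<rho> p * \<rho> p * f p) = (\<lambda>p. f q * (\<rho> p * \<rho> p) + (\<Sum>i\<in>UNIV. (X i p - b $ i * \<rho> p) * H i p))"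
      by blast
    then have "v (\<lambda>p. \<rho> p * \<rho> p * f p) = v (\<lambda>p. f q * (\<rho> p * \<rho> p) + (\<Sum>i\<in>UNIV. (X i p - b $ i * \<rho> p) * H i p))"
      by simp
    also have "\<dots> = f q * (2 * \<rho> q * v \<rho>) + (\<Sum>i\<in>UNIV. (X i q - b $ i * \<rho> q) * v (H i) + H i q * (v (X i) - b $ i * v \<rho>))"
      using v \<rho>C XC HC XH by (simp add: tangent_mult[OF v] tangent_sum[OF v] tangent_cmult[OF v] tangent_add[OF v] tangent_diff[OF v]
          tangent_const[OF v])
    also have "v (\<lambda>p. \<rho> p * \<rho> p * f p) = \<rho> q * \<rho> q * v f + f q * (2 * \<rho> q * v \<rho>)"
      using \<rho>C f by (simp add: tangent_mult[OF v])
    finally have "\<rho> q * \<rho> q * v f = (\<Sum>i\<in>UNIV. (X i q - b $ i * \<rho> q) * v (H i) + H i q * (v (X i) - b $ i * v \<rho>))"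
      by simp
    \<comment> \<open>At q the factor \<open>X i q - b $ i * \<rho> q\<close> vanishes, which
      removes the unknown \<open>v (H i)\<close>, and \<open>H i q\<close> is the cut-off partial
      derivative of f.\<close>
    also have "\<dots> = (\<Sum>i\<in>UNIV. (v (X i) - b $ i * v \<rho>) * E i q f)"
      using b f h(3) by (intro sum.cong) (auto simp: X_def \<rho>_def H_def E_def P_def b_def)
    \<comment> \<open>A third factor \<open>\<rho> q\<close> turns the coordinate
      \<open>b $ i\<close> into \<open>X i q\<close>, so that the coefficients are built from global
      functions.\<close>
    finally have "\<rho> q ^ 3 * v f = \<rho> q * (\<Sum>i\<in>UNIV. (v (X i) - b $ i * v \<rho>) * E i q f)"
      by (simp add: power3_eq_cube)
    also have "\<dots> = (\<Sum>i\<in>UNIV. (\<rho> q * v (X i) - X i q * v \<rho>) * E i q f)"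
      using b by (simp add: sum_distrib_left algebra_simps X_def \<rho>_def P_def b_def)
    finally show ?thesis .
  qed
  \<comment> \<open>The left-hand side is \<rho>^2 times the derivative of the coordinate X_i /
    \<rho>, written without division; the derivatives of the cut-off cancel.\<close>
  have dual: "\<rho> q * E j q (X i) - X i q * E j q \<rho> = (if i = j then \<rho> q ^ 3 else 0)" for q i j
  proof (cases "q \<in> U \<and> \<phi> q \<in> S")
    case False
    then show ?thesis by (auto simp: E_def P_def \<rho>_def X_def)
  next
    case True
    define x where "x = \<phi> q"
    have x: "x \<in> S" using True by (simp add: x_def)
    let ?d = "frechet_derivative \<beta> (at x)"
    have \<beta>d: "(\<beta> has_derivative ?d) (at x)"
      using Ck_on_has_derivative[OF \<beta>smooth[OF S(1)] x] .
    then have "((\<lambda>x. \<beta> x * x $ i) has_derivative (\<lambda>v. \<beta> x * v $ i + ?d v * x $ i)) (at x)"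
      by (intro has_derivative_mult bounded_linear_imp_has_derivative bounded_linear_vec_nth)
    then have "((\<lambda>x. X i (?i x)) has_derivative (\<lambda>v. \<beta> x * v $ i + ?d v * x $ i)) (at x)"
      by (rule has_derivative_transform_within_open[OF _ S(1) x]) (auto simp: X_def P_def phii)
    then have 1: "frechet_derivative (\<lambda>x. X i (?i x)) (at x) = (\<lambda>v. \<beta> x * v $ i + ?d v * x $ i)"
      by (rule frechet_derivative_at[symmetric])
    have "((\<lambda>x. \<rho> (?i x)) has_derivative ?d) (at x)"
      using \<beta>d by (rule has_derivative_transform_within_open[OF _ S(1) x]) (auto simp: \<rho>_def P_def phii)
    then have 2: "frechet_derivative (\<lambda>x. \<rho> (?i x)) (at x) = ?d"
      by (rule frechet_derivative_at[symmetric])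
    show ?thesis
      using True \<rho>C XC unfolding E_def
      by (simp add: P_def 1[unfolded x_def] 2[unfolded x_def] axis_def)
        (simp add: \<rho>_def X_def P_def algebra_simps power3_eq_cube)
  qed
  show thesis
    by (rule that[OF \<rho>C XC EC _ inj span dual]) (simp_all add: \<rho>p0 \<beta>a)
qed

end

section \<open>The Levi-Civita connection of a Riemannian metric\<close>

context closed_manifold
begin

section \<open>Lie brackets and affine connections on M\<close>

lemma lie_bracket_add:
  assumes X: "X \<in> VF" and Y: "Y \<in> VF" and Z: "Z \<in> VF"
  shows "lie_bracket A X (Y + Z) = lie_bracket A X Y + lie_bracket A X Z"
proof (intro ext)
  fix p f
  show "lie_bracket A X (Y + Z) p f = (lie_bracket A X Y + lie_bracket A X Z) p f"
  proof (cases "f \<in> C")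
    case True
    have "X p (\<lambda>q. Y q f + Z q f) = X p (\<lambda>q. Y q f) + X p (\<lambda>q. Z q f)"
      by (rule tangent_add[OF VF_tangent[OF X] VF_app[OF Y True] VF_app[OF Z True]])
    then show ?thesis using True by (simp add: lie_bracket_def app_def)
  qed (simp add: lie_bracket_def)
qed

lemma lie_bracket_antisym: "lie_bracket A X Y p f = - lie_bracket A Y X p f"
  by (simp add: lie_bracket_def)

lemma lie_bracket_vmul:
  assumes X: "X \<in> VF" and Y: "Y \<in> VF" and h: "h \<in> C"
  shows "lie_bracket A X (vmul h Y) = vmul h (lie_bracket A X Y) + vmul (app X h) Y"
proof (intro ext)
  fix p f
  show "lie_bracket A X (vmul h Y) p f = (vmul h (lie_bracket A X Y) + vmul (app X h) Y) p f"
  proof (cases "f \<in> C")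
    case True
    have "X p (\<lambda>q. h q * Y q f) = h p * X p (\<lambda>q. Y q f) + Y p f * X p h"
      by (rule tangent_mult[OF VF_tangent[OF X] h VF_app[OF Y True]])
    then show ?thesis using True by (simp add: lie_bracket_def app_def vmul_def algebra_simps)
  next
    case False
    then show ?thesis using tangent_space_outside[OF VF_tangent[OF Y] False] by (simp add: lie_bracket_def vmul_def)
  qed
qed

lemma lie_bracket_anti: "lie_bracket A X Y = vmul (\<lambda>_. -1) (lie_bracket A Y X)"
  by (intro ext, subst lie_bracket_antisym) (simp add: vmul_def)

lemma affine_connectionD:
  assumes "affine_connection A D"
  shows "X \<in> VF \<Longrightarrow> Y \<in> VF \<Longrightarrow> D X Y \<in> VF"
    "X \<in> VF \<Longrightarrow> X' \<in> VF \<Longrightarrow> Y \<in> VF \<Longrightarrow> D (X + X') Y = D X Y + D X' Y"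
    "f \<in> C \<Longrightarrow> X \<in> VF \<Longrightarrow> Y \<in> VF \<Longrightarrow> D (vmul f X) Y = vmul f (D X Y)"
    "X \<in> VF \<Longrightarrow> Y \<in> VF \<Longrightarrow> Y' \<in> VF \<Longrightarrow> D X (Y + Y') = D X Y + D X Y'"
    "X \<in> VF \<Longrightarrow> Y \<in> VF \<Longrightarrow> D X (vmul (\<lambda>_. c) Y) = vmul (\<lambda>_. c) (D X Y)"
    "f \<in> C \<Longrightarrow> X \<in> VF \<Longrightarrow> Y \<in> VF \<Longrightarrow> D X (vmul f Y) = vmul f (D X Y) + vmul (app X f) Y"
  using assms unfolding affine_connection_def by blast+

end

locale closed_riemannian = closed_manifold A
  for A :: "('m::t2_space, 'n::finite) chart set" +
  fixes g :: "'m \<Rightarrow> 'm tvec \<Rightarrow> 'm tvec \<Rightarrow> real"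
  assumes metric: "riemannian_metric A g"
begin

section \<open>Pointwise algebra of the metric\<close>

lemma g_sym: "v \<in> T p \<Longrightarrow> w \<in> T p \<Longrightarrow> g p v w = g p w v"
  using metric by (simp add: riemannian_metric_def)

lemma g_add_left: "v \<in> T p \<Longrightarrow> v' \<in> T p \<Longrightarrow> w \<in> T p \<Longrightarrow> g p (\<lambda>f. v f + v' f) w = g p v w + g p v' w"
  using metric by (simp add: riemannian_metric_def plus_fun_def)

lemma g_cmult_left: "v \<in> T p \<Longrightarrow> w \<in> T p \<Longrightarrow> g p (\<lambda>f. c * v f) w = c * g p v w"
  using metric by (simp add: riemannian_metric_def)

lemma g_pos: "v \<in> T p \<Longrightarrow> v \<noteq> (\<lambda>f. 0) \<Longrightarrow> g p v v > 0"
  using metric by (simp add: riemannian_metric_def zero_fun_def)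

lemma g_smooth: "X \<in> VF \<Longrightarrow> Y \<in> VF \<Longrightarrow> (\<lambda>p. g p (X p) (Y p)) \<in> C"
  using metric by (simp add: riemannian_metric_def)

lemma g_add_right: "v \<in> T p \<Longrightarrow> v' \<in> T p \<Longrightarrow> w \<in> T p \<Longrightarrow> g p w (\<lambda>f. v f + v' f) = g p w v + g p w v'"
  using g_add_left[of v p v' w] g_sym[of w p v] g_sym[of w p v'] g_sym[OF _ tangent_space_add, of w p v v'] by simp

lemma g_cmult_right: "v \<in> T p \<Longrightarrow> w \<in> T p \<Longrightarrow> g p w (\<lambda>f. c * v f) = c * g p w v"
  using g_cmult_left[of v p w c] g_sym[of w p v] g_sym[OF _ tangent_space_cmult, of w p v c] by simp

lemma g_zero_left: "w \<in> T p \<Longrightarrow> g p (\<lambda>f. 0) w = 0"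
  using g_cmult_left[OF tangent_space_zero, of w p 0] by simp

lemma g_sum_left:
  "(\<And>i. i \<in> I \<Longrightarrow> v i \<in> T p) \<Longrightarrow> w \<in> T p \<Longrightarrow> g p (\<lambda>f. \<Sum>i\<in>I. v i f) w = (\<Sum>i\<in>I. g p (v i) w)"
proof (induction I rule: infinite_finite_induct)
  case (insert i I)
  have "g p (\<lambda>f. v i f + (\<Sum>i\<in>I. v i f)) w = g p (v i) w + g p (\<lambda>f. \<Sum>i\<in>I. v i f) w"
    using insert.prems by (intro g_add_left tangent_space_sum) auto
  then show ?case using insert by simp
qed (auto simp: g_zero_left)

lemma g_lincomb_left:
  assumes "\<And>i. i \<in> I \<Longrightarrow> v i \<in> T p" "w \<in> T p"
  shows "g p (\<lambda>f. \<Sum>i\<in>I. c i * v i f) w = (\<Sum>i\<in>I. c i * g p (v i) w)"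
  using assms by (subst g_sum_left) (auto simp: g_cmult_left intro!: tangent_space_cmult)

lemma g_eq_zero: "v \<in> T p \<Longrightarrow> g p v v = 0 \<Longrightarrow> v = (\<lambda>f. 0)"
  using g_pos by force

text \<open>Test with the difference of the two fields.\<close>

lemma VF_eqI:
  assumes W: "W \<in> VF" and W': "W' \<in> VF"
    and "\<And>Z. Z \<in> VF \<Longrightarrow> (\<lambda>p. g p (W p) (Z p)) = (\<lambda>p. g p (W' p) (Z p))"
  shows "W = W'"
proof -
  have 1: "W + vmul (\<lambda>_. -1) W' \<in> VF" (is "?Z \<in> VF")
    using W W' by (intro VF_add VF_vmul) auto
  have Zp: "?Z p = (\<lambda>f. W p f + (-1) * W' p f)" for p
    by (simp add: vmul_def plus_fun_def)
  have Z0: "?Z p = (\<lambda>f. 0)" for p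
  proof (rule g_eq_zero)
    show "?Z p \<in> T p" using 1 by (rule VF_tangent)
    note t = VF_tangent[OF 1, of p] VF_tangent[OF W, of p] VF_tangent[OF W', of p]
    have "g p (?Z p) (?Z p) = g p (\<lambda>f. W p f + (-1) * W' p f) (?Z p)" by (simp only: Zp)
    also have "\<dots> = g p (W p) (?Z p) + g p (\<lambda>f. (-1) * W' p f) (?Z p)"
      by (intro g_add_left tangent_space_cmult t)
    also have "\<dots> = g p (W p) (?Z p) - g p (W' p) (?Z p)"
      by (subst g_cmult_left[OF t(3) t(1)]) simp
    finally show "g p (?Z p) (?Z p) = 0" using fun_cong[OF assms(3)[OF 1], of p] by simp
  qed
  then show ?thesis using Z0 unfolding Zp by (simp add: fun_eq_iff)
qed

text \<open>Linearity over the smooth functions makes \<alpha> Z at p depend on the value of Z at p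
  alone. The solutions at the single points need no compatible choice of frames, since each is
  characterised by its pairings with global fields; frames return only in the proof that the
  solution is smooth.\<close>

lemma riesz_representation:
  fixes \<alpha> :: "'m vfield \<Rightarrow> 'm \<Rightarrow> real"
  assumes \<alpha>C: "\<And>Z. Z \<in> VF \<Longrightarrow> \<alpha> Z \<in> C"
    and \<alpha>add: "\<And>Z Z' p. Z \<in> VF \<Longrightarrow> Z' \<in> VF \<Longrightarrow> \<alpha> (Z + Z') p = \<alpha> Z p + \<alpha> Z' p"
    and \<alpha>mul: "\<And>f Z p. f \<in> C \<Longrightarrow> Z \<in> VF \<Longrightarrow> \<alpha> (vmul f Z) p = f p * \<alpha> Z p"
  obtains W where "W \<in> VF" "\<And>Z p. Z \<in> VF \<Longrightarrow> g p (W p) (Z p) = \<alpha> Z p"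
proof -
  have \<alpha>zero: "\<alpha> 0 p = 0" for p
    using \<alpha>mul[OF C_const VF_zero, of 0 p] VF_zero by (simp add: vmul_def zero_fun_def)
  have \<alpha>sum: "\<alpha> (\<Sum>i\<in>I. Z i) p = (\<Sum>i\<in>I. \<alpha> (Z i) p)" if "\<And>i. i \<in> I \<Longrightarrow> Z i \<in> VF" for I p and Z :: "'n \<Rightarrow> _"
    using that by (induction I rule: infinite_finite_induct) (auto simp: \<alpha>zero \<alpha>add VF_sum)
  have frame: "\<exists>\<rho> X E. \<rho> \<in> C \<and> (\<forall>i::'n. X i \<in> C) \<and> (\<forall>i. E i \<in> VF) \<and> \<rho> p0 \<noteq> 0 \<and>
    (\<forall>q v f. v \<in> T q \<longrightarrow> \<rho> q ^ 3 * v f = (\<Sum>i\<in>UNIV. (\<rho> q * v (X i) - X i q * v \<rho>) * E i q f)) \<and>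
    (\<forall>q. \<rho> q \<noteq> 0 \<longrightarrow> det (\<chi> j i. g q (E i q) (E j q) :: real ^ 'n ^ 'n) \<noteq> 0)" for p0
  proof -
    obtain \<rho> X E where F: "\<rho> \<in> C" "\<And>i::'n. X i \<in> C" "\<And>i::'n. E i \<in> VF"
      "\<rho> p0 \<noteq> 0" "\<And>q. \<rho> q = \<rho> p0 \<Longrightarrow> q = p0"
      "\<And>q v f. v \<in> T q \<Longrightarrow> \<rho> q ^ 3 * v f = (\<Sum>i\<in>UNIV. (\<rho> q * v (X i) - X i q * v \<rho>) * E i q f)"
      "\<And>q i j. \<rho> q * E j q (X i) - X i q * E j q \<rho> = (if i = j then \<rho> q ^ 3 else 0)"
      using local_frame[where ?p0.0=p0] by blast
    \<comment> \<open>A kernel vector x of the Gram matrix gives a combination w of the frame with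
      g(w, w) = 0, hence w = 0.\<close>
    have "det (\<chi> j i. g q (E i q) (E j q) :: real ^ 'n ^ 'n) \<noteq> 0" (is "det ?G \<noteq> 0") if q: "\<rho> q \<noteq> 0" for q
    proof -
      note t = VF_tangent[OF F(3)]
      have "x = 0" if x: "?G *v x = 0" for x
      proof -
        define w where "w = (\<lambda>f. \<Sum>i\<in>UNIV. x $ i * E i q f)"
        have wT: "w \<in> T q" unfolding w_def by (intro tangent_space_sum tangent_space_cmult t)
        have "g q w (E j q) = 0" for j
        proof -
          have "g q w (E j q) = (?G *v x) $ j"
            unfolding w_def by (subst g_lincomb_left) (auto simp: t matrix_vector_mult_def mult.commute)
          then show ?thesis using x by simp
        qed
        then have "(\<Sum>j\<in>UNIV. x $ j * g q (E j q) w) = 0"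
          by (intro sum.neutral) (metis g_sym t wT mult_zero_right)
        then have "g q w w = 0"
          by (subst (1) w_def) (simp add: g_lincomb_left t wT)
        then have "w = (\<lambda>f. 0)" by (rule g_eq_zero[OF wT])
        then have w0: "(\<Sum>i\<in>UNIV. x $ i * E i q f) = 0" for f unfolding w_def by (simp add: fun_eq_iff)
        have "x $ i = 0" for i
        proof -
          \<comment> \<open>Evaluating w on the dual basis of the frame isolates
            \<open>x $ i\<close>.\<close>
          have "0 = \<rho> q * (\<Sum>j\<in>UNIV. x $ j * E j q (X i)) - X i q * (\<Sum>j\<in>UNIV. x $ j * E j q \<rho>)"
            by (simp only: w0)
          also have "\<dots> = (\<Sum>j\<in>UNIV. x $ j * (\<rho> q * E j q (X i) - X i q * E j q \<rho>))"
            by (simp add: sum_distrib_left sum_subtractf algebra_simps)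
          also have "\<dots> = (\<Sum>j\<in>UNIV. if i = j then x $ j * \<rho> q ^ 3 else 0)"
            by (intro sum.cong) (auto simp: F(7))
          also have "\<dots> = x $ i * \<rho> q ^ 3" by simp
          finally show ?thesis using q by simp
        qed
        then show "x = 0" by (simp add: vec_eq_iff)
      qed
      then have "\<exists>B. B ** ?G = mat 1"
        using matrix_left_invertible_ker[of ?G] by blast
      then show ?thesis
        by (metis invertible_det_nz invertible_left_inverse)
    qed
    then show ?thesis using F by blast
  qed
  have "\<exists>w\<in>T p. \<forall>Z\<in>VF. g p w (Z p) = \<alpha> Z p" for p
  proof -
    obtain \<rho> X E where F: "\<rho> \<in> C" "\<And>i::'n. X i \<in> C" "\<And>i. E i \<in> VF" "\<rho> p \<noteq> 0"
      "\<And>q v f. v \<in> T q \<Longrightarrow> \<rho> q ^ 3 * v f = (\<Sum>i\<in>UNIV. (\<rho> q * v (X i) - X i q * v \<rho>) * E i q f)"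
      "\<And>q. \<rho> q \<noteq> 0 \<Longrightarrow> det (\<chi> j i. g q (E i q) (E j q) :: real ^ 'n ^ 'n) \<noteq> 0"
      using frame[of p] by blast
    note t = VF_tangent[OF F(3)]
    let ?G = "\<chi> j i. g p (E i p) (E j p) :: real ^ 'n ^ 'n"
    have "invertible ?G" using F(6)[OF F(4)] by (simp add: invertible_det_nz)
    then obtain x where x: "?G *v x = (\<chi> j. \<alpha> (E j) p)"
      by (metis invertible_def matrix_vector_mul_assoc matrix_vector_mul_lid)
    define w where "w = (\<lambda>f. \<Sum>i\<in>UNIV. x $ i * E i p f)"
    have wT: "w \<in> T p" unfolding w_def by (intro tangent_space_sum tangent_space_cmult t)
    have wE: "g p w (E j p) = \<alpha> (E j) p" for j
    proof -
      have "g p w (E j p) = (?G *v x) $ j"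
        unfolding w_def by (subst g_lincomb_left) (auto simp: t matrix_vector_mult_def mult.commute)
      then show ?thesis using x by simp
    qed
    have "g p w (Z p) = \<alpha> Z p" if Z: "Z \<in> VF" for Z
    proof -
      define \<zeta> where "\<zeta> i = (\<lambda>q. \<rho> q * Z q (X i) - X i q * Z q \<rho>)" for i
      have \<zeta>: "\<zeta> i \<in> C" for i unfolding \<zeta>_def using F VF_app[OF Z] by auto
      \<comment> \<open>Multiplied by \<rho>^3, Z is on all of M a combination of the fields
        \<open>E i\<close> with smooth coefficients, so that linearity of \<alpha> applies to it
        directly.\<close>
      have eq: "vmul (\<lambda>q. \<rho> q ^ 3) Z = (\<Sum>i\<in>UNIV. vmul (\<zeta> i) (E i))"
        by (auto simp: fun_eq_iff sum_fun_apply vmul_def \<zeta>_def F(5)[OF VF_tangent[OF Z]])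
      have "\<rho> p ^ 3 * \<alpha> Z p = \<alpha> (vmul (\<lambda>q. \<rho> q ^ 3) Z) p"
        using F(1) Z by (simp add: \<alpha>mul)
      also have "\<dots> = (\<Sum>i\<in>UNIV. \<zeta> i p * \<alpha> (E i) p)"
        unfolding eq using F \<zeta> by (subst \<alpha>sum) (auto simp: \<alpha>mul intro: VF_vmul)
      also have "\<dots> = (\<Sum>i\<in>UNIV. \<zeta> i p * g p (E i p) w)"
        by (simp only: wE[symmetric] g_sym[OF wT t])
      also have "\<dots> = g p (\<lambda>f. \<Sum>i\<in>UNIV. \<zeta> i p * E i p f) w"
        by (subst g_lincomb_left) (auto simp: t wT)
      also have "(\<lambda>f. \<Sum>i\<in>UNIV. \<zeta> i p * E i p f) = (\<lambda>f. \<rho> p ^ 3 * Z p f)"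
        by (simp add: F(5)[OF VF_tangent[OF Z]] \<zeta>_def)
      also have "g p \<dots> w = \<rho> p ^ 3 * g p w (Z p)"
        using g_cmult_left[OF VF_tangent[OF Z] wT] g_sym[OF VF_tangent[OF Z] wT] by simp
      finally show ?thesis using F(4) by simp
    qed
    then show ?thesis using wT by blast
  qed
  then obtain W where W: "\<And>p. W p \<in> T p" "\<And>p Z. Z \<in> VF \<Longrightarrow> g p (W p) (Z p) = \<alpha> Z p"
    by metis
  have "W \<in> VF"
  proof (rule VF_I[OF W(1)])
    fix f assume f: "f \<in> C"
    show "(\<lambda>p. W p f) \<in> C"
    proof (rule C_local_quotient)
      fix p0
      obtain \<rho> X E where F: "\<rho> \<in> C" "\<And>i::'n. X i \<in> C" "\<And>i. E i \<in> VF" "\<rho> p0 \<noteq> 0"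
        "\<And>q v f. v \<in> T q \<Longrightarrow> \<rho> q ^ 3 * v f = (\<Sum>i\<in>UNIV. (\<rho> q * v (X i) - X i q * v \<rho>) * E i q f)"
        "\<And>q. \<rho> q \<noteq> 0 \<Longrightarrow> det (\<chi> j i. g q (E i q) (E j q) :: real ^ 'n ^ 'n) \<noteq> 0"
        using frame[of p0] by blast
      note t = VF_tangent[OF F(3)]
      define G where "G q = (\<chi> j i. g q (E i q) (E j q) :: real ^ 'n ^ 'n)" for q
      \<comment> \<open>The Gram matrix with its k-th column replaced by the right-hand side, as in
        Cramer's rule for the vector \<open>c q\<close> of frame components of \<rho>^3 W.\<close>
      define B where "B k q = (\<chi> i j. if j = k then \<rho> q ^ 3 * \<alpha> (E i) q else G q $ i $ j)" for k q
      define c where "c q = (\<chi> i. \<rho> q * W q (X i) - X i q * W q \<rho>)" for q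
      have det_C: "(\<lambda>q. det (M q)) \<in> C" if "\<And>i j. (\<lambda>q. M q $ i $ j) \<in> C" for M :: "'m \<Rightarrow> real ^ 'n ^ 'n"
        unfolding det_def using that by auto
      have GC: "(\<lambda>q. det (G q)) \<in> C" using F(3) by (intro det_C) (auto simp: G_def g_smooth)
      have BC: "(\<lambda>q. det (B k q)) \<in> C" for k
      proof (rule det_C)
        show "(\<lambda>q. B k q $ i $ j) \<in> C" for i j
          using F \<alpha>C by (cases "j = k") (auto simp: B_def G_def g_smooth)
      qed
      have "\<rho> q ^ 3 * \<alpha> (E j) q = (G q *v c q) $ j" for q j
      proof -
        have "\<rho> q ^ 3 * \<alpha> (E j) q = \<rho> q ^ 3 * g q (W q) (E j q)" by (simp add: W F)
        also have "\<dots> = g q (\<lambda>f. \<rho> q ^ 3 * W q f) (E j q)"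
          by (subst g_cmult_left) (auto simp: W t)
        also have "(\<lambda>f. \<rho> q ^ 3 * W q f) = (\<lambda>f. \<Sum>i\<in>UNIV. c q $ i * E i q f)"
          by (simp add: F(5)[OF W(1)] c_def)
        also have "g q \<dots> (E j q) = (G q *v c q) $ j"
          by (subst g_lincomb_left) (auto simp: t matrix_vector_mult_def mult.commute G_def)
        finally show ?thesis .
      qed
      then have "det (B k q) = c q $ k * det (G q)" for k q
        unfolding B_def by (simp only: cramer_lemma)
      then have eq: "\<rho> q ^ 3 * det (G q) * W q f = (\<Sum>i\<in>UNIV. det (B i q) * E i q f)" for q
        using F(5)[OF W(1), of q f] by (simp add: c_def sum_distrib_left mult_ac)
      show "\<exists>k\<in>C. \<exists>l\<in>C. k p0 \<noteq> 0 \<and> (\<forall>p. k p * W p f = l p)"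
      proof (intro bexI conjI allI)
        show "\<rho> p0 ^ 3 * det (G p0) \<noteq> 0" using F(4) F(6)[of p0] by (simp add: G_def)
        show "\<rho> q ^ 3 * det (G q) * W q f = (\<Sum>i\<in>UNIV. det (B i q) * E i q f)" for q by (rule eq)
        show "(\<lambda>q. \<rho> q ^ 3 * det (G q)) \<in> C" using F(1) GC by simp
        show "(\<lambda>q. \<Sum>i\<in>UNIV. det (B i q) * E i q f) \<in> C"
          using F(3) BC f VF_app by (intro C_sum C_mult) auto
      qed
    qed
  qed
  then show thesis using W(2) that by blast
qed

section \<open>The Koszul expression and the Levi-Civita connection of M\<close>

text \<open>For a torsion-free metric connection this equals 2 g(D X Y, Z), so the connection is
  recovered from one half of it.\<close>

definition koszul :: "'m vfield \<Rightarrow> 'm vfield \<Rightarrow> 'm vfield \<Rightarrow> 'm \<Rightarrow> real"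
  where "koszul X Y Z p =
    X p (\<lambda>q. g q (Y q) (Z q)) + Y p (\<lambda>q. g q (X q) (Z q)) - Z p (\<lambda>q. g q (X q) (Y q)) +
    g p (lie_bracket A X Y p) (Z p) - g p (lie_bracket A X Z p) (Y p) - g p (lie_bracket A Y Z p) (X p)"

lemma g_plus_left: "X \<in> VF \<Longrightarrow> Y \<in> VF \<Longrightarrow> Z \<in> VF \<Longrightarrow> g p ((X + Y) p) (Z p) = g p (X p) (Z p) + g p (Y p) (Z p)"
  using g_add_left[of "X p" p "Y p" "Z p"] by (simp add: plus_fun_def VF_tangent)

lemma g_plus_right: "X \<in> VF \<Longrightarrow> Y \<in> VF \<Longrightarrow> Z \<in> VF \<Longrightarrow> g p (Z p) ((X + Y) p) = g p (Z p) (X p) + g p (Z p) (Y p)"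
  using g_add_right[of "X p" p "Y p" "Z p"] by (simp add: plus_fun_def VF_tangent)

lemma g_vmul_left: "X \<in> VF \<Longrightarrow> Z \<in> VF \<Longrightarrow> g p (vmul h X p) (Z p) = h p * g p (X p) (Z p)"
  using g_cmult_left[of "X p" p "Z p" "h p"] by (simp add: vmul_def VF_tangent)

lemma g_vmul_right: "X \<in> VF \<Longrightarrow> Z \<in> VF \<Longrightarrow> g p (Z p) (vmul h X p) = h p * g p (Z p) (X p)"
  using g_cmult_right[of "X p" p "Z p" "h p"] by (simp add: vmul_def VF_tangent)

lemma g_commute: "X \<in> VF \<Longrightarrow> Z \<in> VF \<Longrightarrow> g p (X p) (Z p) = g p (Z p) (X p)"
  by (simp add: g_sym VF_tangent)

lemma g_bracket_anti:
  assumes "X \<in> VF" "Y \<in> VF" "Z \<in> VF"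
  shows "g p (lie_bracket A X Y p) (Z p) = - g p (lie_bracket A Y X p) (Z p)"
  using g_vmul_left[OF VF_lie_bracket[OF assms(2,1)] assms(3), of p "\<lambda>_. -1"]
  by (subst lie_bracket_anti) simp

lemma koszul_smooth: "X \<in> VF \<Longrightarrow> Y \<in> VF \<Longrightarrow> Z \<in> VF \<Longrightarrow> koszul X Y Z \<in> C"
  unfolding koszul_def[abs_def]
  by (simp add: VF_app[OF _ g_smooth] g_smooth VF_lie_bracket)

lemma g_bracket_add_right:
  assumes "X \<in> VF" "Y \<in> VF" "Y' \<in> VF" "Z \<in> VF"
  shows "g p (lie_bracket A X (Y + Y') p) (Z p) = g p (lie_bracket A X Y p) (Z p) + g p (lie_bracket A X Y' p) (Z p)"
  using assms by (simp only: lie_bracket_add g_plus_left VF_lie_bracket)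

lemma g_bracket_vmul_right:
  assumes "X \<in> VF" "Y \<in> VF" "h \<in> C" "Z \<in> VF"
  shows "g p (lie_bracket A X (vmul h Y) p) (Z p) = h p * g p (lie_bracket A X Y p) (Z p) + X p h * g p (Y p) (Z p)"
proof -
  have "app X h \<in> C" using assms by (simp add: app_def VF_app)
  then show ?thesis
    using assms by (simp only: lie_bracket_vmul g_plus_left g_vmul_left VF_lie_bracket VF_vmul app_def)
qed

lemma deriv_g_add:
  assumes "X \<in> VF" "Y \<in> VF" "Y' \<in> VF" "Z \<in> VF"
  shows "X p (\<lambda>q. g q (Z q) ((Y + Y') q)) = X p (\<lambda>q. g q (Z q) (Y q)) + X p (\<lambda>q. g q (Z q) (Y' q))"
proof -
  have *: "(\<lambda>q. g q (Z q) ((Y + Y') q)) = (\<lambda>q. g q (Z q) (Y q) + g q (Z q) (Y' q))"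
    using assms by (simp only: g_plus_right)
  show ?thesis
    unfolding * by (rule tangent_add[OF VF_tangent[OF assms(1)] g_smooth[OF assms(4,2)] g_smooth[OF assms(4,3)]])
qed

lemma deriv_g_vmul:
  assumes "X \<in> VF" "Y \<in> VF" "h \<in> C" "Z \<in> VF"
  shows "X p (\<lambda>q. g q (Z q) (vmul h Y q)) = h p * X p (\<lambda>q. g q (Z q) (Y q)) + g p (Z p) (Y p) * X p h"
proof -
  have "(\<lambda>q. g q (Z q) (vmul h Y q)) = (\<lambda>q. h q * g q (Z q) (Y q))"
    using assms by (simp only: g_vmul_right)
  then show ?thesis
    using tangent_mult[OF VF_tangent[OF assms(1)] assms(3) g_smooth[OF assms(4,2)]] by simp
qed

lemma deriv_g_commute: "Y \<in> VF \<Longrightarrow> Z \<in> VF \<Longrightarrow> v (\<lambda>q. g q (Y q) (Z q)) = v (\<lambda>q. g q (Z q) (Y q))"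
  by (rule arg_cong[where f=v]) (auto simp: g_commute)

lemma koszul_add3:
  assumes "X \<in> VF" "Y \<in> VF" "Z \<in> VF" "Z' \<in> VF"
  shows "koszul X Y (Z + Z') p = koszul X Y Z p + koszul X Y Z' p"
  unfolding koszul_def deriv_g_add[OF assms(1,3,4,2)] deriv_g_add[OF assms(2,3,4,1)]
    g_bracket_add_right[OF assms(1,3,4,2)] g_bracket_add_right[OF assms(2,3,4,1)]
    g_plus_right[OF assms(3,4) VF_lie_bracket[OF assms(1,2)]]
  by simp

text \<open>Differentiating g(Y, h Z) along X produces X(h) g(Y, Z), and the bracket of X with h Z
  produces it again with the opposite sign; the same happens with X and Y exchanged. What remains is
  linear over the smooth functions, as the representation by a field requires.\<close>

lemma koszul_vmul3:
  assumes "X \<in> VF" "Y \<in> VF" "Z \<in> VF" "h \<in> C"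
  shows "koszul X Y (vmul h Z) p = h p * koszul X Y Z p"
  unfolding koszul_def deriv_g_vmul[OF assms(1,3,4,2)] deriv_g_vmul[OF assms(2,3,4,1)]
    g_bracket_vmul_right[OF assms(1,3,4,2)] g_bracket_vmul_right[OF assms(2,3,4,1)]
    g_vmul_right[OF assms(3) VF_lie_bracket[OF assms(1,2)]]
  using g_commute[OF assms(1,3), of p] g_commute[OF assms(2,3), of p]
  by (simp add: vmul_def algebra_simps)

lemma koszul_metric:
  assumes "X \<in> VF" "Y \<in> VF" "Z \<in> VF"
  shows "koszul X Y Z p + koszul X Z Y p = 2 * X p (\<lambda>q. g q (Y q) (Z q))"
  unfolding koszul_def
  using deriv_g_commute[OF assms(2,3), of "X p"] deriv_g_commute[OF assms(1,3), of "Y p"] deriv_g_commute[OF assms(1,2), of "Z p"]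
    g_bracket_anti[OF assms(2,3,1), of p]
  by simp

lemma koszul_torsion:
  assumes "X \<in> VF" "Y \<in> VF" "Z \<in> VF"
  shows "koszul X Y Z p - koszul Y X Z p = 2 * g p (lie_bracket A X Y p) (Z p)"
  unfolding koszul_def
  using deriv_g_commute[OF assms(1,2), of "Z p"] g_bracket_anti[OF assms(1,2,3), of p]
  by simp

text \<open>Moves an argument from the second slot to the third, so that additivity and the Leibniz
  rule in the second slot follow from linearity in the third. \<open>koszul_swap12\<close> carries
  them on to the first slot, where the bracket cancels the Leibniz term.\<close>

lemma koszul_swap:
  assumes "X \<in> VF" "Y \<in> VF" "Z \<in> VF"
  shows "koszul X Y Z p = 2 * X p (\<lambda>q. g q (Y q) (Z q)) - koszul X Z Y p"
  using koszul_metric[OF assms, of p] by simp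

lemma koszul_add2:
  assumes "X \<in> VF" "Y \<in> VF" "Y' \<in> VF" "Z \<in> VF"
  shows "koszul X (Y + Y') Z p = koszul X Y Z p + koszul X Y' Z p"
  using assms by (simp del: plus_fun_apply add: koszul_swap[of X _ Z] VF_add koszul_add3 deriv_g_add deriv_g_commute[of _ Z])

lemma koszul_vmul2:
  assumes "X \<in> VF" "Y \<in> VF" "h \<in> C" "Z \<in> VF"
  shows "koszul X (vmul h Y) Z p = h p * koszul X Y Z p + 2 * X p h * g p (Y p) (Z p)"
  using assms by (simp del: plus_fun_apply add: koszul_swap[of X _ Z] VF_vmul koszul_vmul3 deriv_g_vmul deriv_g_commute[of _ Z]
      g_commute[of Y Z] algebra_simps)

lemma koszul_swap12:
  assumes "X \<in> VF" "Y \<in> VF" "Z \<in> VF"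
  shows "koszul X Y Z p = koszul Y X Z p - 2 * g p (lie_bracket A Y X p) (Z p)"
  using koszul_torsion[OF assms(2,1,3), of p] by simp

lemma koszul_add1:
  assumes "X \<in> VF" "X' \<in> VF" "Y \<in> VF" "Z \<in> VF"
  shows "koszul (X + X') Y Z p = koszul X Y Z p + koszul X' Y Z p"
  using assms by (simp del: plus_fun_apply add: koszul_swap12[of _ Y Z] VF_add koszul_add2 g_bracket_add_right)

lemma koszul_vmul1:
  assumes "X \<in> VF" "Y \<in> VF" "h \<in> C" "Z \<in> VF"
  shows "koszul (vmul h X) Y Z p = h p * koszul X Y Z p"
  using assms by (simp del: plus_fun_apply add: koszul_swap12[of _ Y Z] VF_vmul koszul_vmul2 g_bracket_vmul_right algebra_simps)

text \<open>Each axiom is an equality of fields; paired with an arbitrary Z it becomes an identity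
  for \<open>koszul\<close>, and nondegeneracy of g returns the equality. The last term of
  \<open>koszul_vmul2\<close> becomes the Leibniz term after halving.\<close>

lemma levi_civita_exists: "\<exists>D. levi_civita A g D"
proof -
  have "\<exists>W\<in>VF. \<forall>Z\<in>VF. \<forall>p. g p (W p) (Z p) = koszul X Y Z p / 2" if X: "X \<in> VF" "Y \<in> VF" for X Y
  proof -
    have "(\<lambda>p. koszul X Y Z p / 2) \<in> C" if "Z \<in> VF" for Z
      using C_mult[OF C_const koszul_smooth[OF X that], of "1/2"] by simp
    then obtain W where "W \<in> VF" "\<And>Z p. Z \<in> VF \<Longrightarrow> g p (W p) (Z p) = koszul X Y Z p / 2"
      by (rule riesz_representation[where \<alpha>="\<lambda>Z p. koszul X Y Z p / 2"])
        (use X in \<open>auto simp: koszul_add3 koszul_vmul3 add_divide_distrib\<close>)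
    then show ?thesis by blast
  qed
  then obtain D where D: "\<And>X Y. X \<in> VF \<Longrightarrow> Y \<in> VF \<Longrightarrow> D X Y \<in> VF"
    "\<And>X Y Z p. X \<in> VF \<Longrightarrow> Y \<in> VF \<Longrightarrow> Z \<in> VF \<Longrightarrow> g p (D X Y p) (Z p) = koszul X Y Z p / 2"
    by metis
  have app: "app X f \<in> C" if "X \<in> VF" "f \<in> C" for X f
    using that by (simp add: app_def VF_app)
  note simps = D(2) VF_add VF_vmul VF_lie_bracket D(1) g_plus_left g_vmul_left
    koszul_add1 koszul_add2 koszul_vmul1 koszul_vmul2 app
  have "affine_connection A D"
    unfolding affine_connection_def
  proof (intro conjI ballI allI)
    show "D X Y \<in> VF" if "X \<in> VF" "Y \<in> VF" for X Y using that by (rule D)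
    show "D (X + X') Y = D X Y + D X' Y" if "X \<in> VF" "X' \<in> VF" "Y \<in> VF" for X X' Y
      using that by (intro VF_eqI VF_add D(1) ext) (simp_all del: plus_fun_apply add: simps add_divide_distrib)
    show "D (vmul f X) Y = vmul f (D X Y)" if "f \<in> C" "X \<in> VF" "Y \<in> VF" for f X Y
      using that by (intro VF_eqI VF_add VF_vmul D(1) ext) (simp_all del: plus_fun_apply add: simps)
    show "D X (Y + Y') = D X Y + D X Y'" if "X \<in> VF" "Y' \<in> VF" "Y \<in> VF" for X Y Y'
      using that by (intro VF_eqI VF_add D(1) ext) (simp_all del: plus_fun_apply add: simps add_divide_distrib)
    show "D X (vmul (\<lambda>_. c) Y) = vmul (\<lambda>_. c) (D X Y)" if "X \<in> VF" "Y \<in> VF" for c X Y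
      using that by (intro VF_eqI VF_vmul D(1) ext C_const)
        (simp_all del: plus_fun_apply add: simps tangent_const[OF VF_tangent])
    show "D X (vmul f Y) = vmul f (D X Y) + vmul (app X f) Y" if "f \<in> C" "X \<in> VF" "Y \<in> VF" for f X Y
      using that by (intro VF_eqI VF_add VF_vmul D(1) ext app)
        (simp_all del: plus_fun_apply add: simps add_divide_distrib, simp add: app_def)
  qed
  moreover have "metric_compatible A g D"
    unfolding metric_compatible_def app_def
  proof (intro ballI ext)
    fix X Y Z p assume *: "X \<in> VF" "Y \<in> VF" "Z \<in> VF"
    show "X p (\<lambda>p. g p (Y p) (Z p)) = g p (D X Y p) (Z p) + g p (Y p) (D X Z p)"
      using * koszul_metric[OF *, of p] by (simp add: g_commute[of Y] D)
  qed
  moreover have "torsion_free A D"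
    unfolding torsion_free_def
  proof (intro ballI)
    fix X Y assume *: "X \<in> VF" "Y \<in> VF"
    have "D X Y = D Y X + lie_bracket A X Y"
    proof (intro VF_eqI VF_add VF_lie_bracket D(1) * ext)
      fix Z p assume Z: "Z \<in> VF"
      show "g p (D X Y p) (Z p) = g p ((D Y X + lie_bracket A X Y) p) (Z p)"
        using * Z koszul_torsion[OF * Z, of p] by (simp only: simps)
    qed
    then show "D X Y - D Y X = lie_bracket A X Y" by simp
  qed
  ultimately show ?thesis unfolding levi_civita_def by blast
qed

end

section \<open>Smooth functions of finitely many real variables\<close>

lemma tendsto_funI:
  fixes f :: "'a \<Rightarrow> 'b \<Rightarrow> 'c::topological_space"
  assumes "\<And>i. ((\<lambda>x. f x i) \<longlongrightarrow> l i) F"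
  shows "(f \<longlongrightarrow> l) F"
proof -
  have "limitin (product_topology (\<lambda>i. euclidean) UNIV) f l F"
    unfolding limitin_componentwise using assms by auto
  then show ?thesis by (simp add: euclidean_product_topology)
qed

text \<open>The increments to which this is applied may have either sign or be 0, and a weak bound
  on the distance from z to a is enough to force z to a.\<close>

lemma mvt_unordered:
  fixes f :: "real \<Rightarrow> real"
  assumes "\<And>x. (f has_real_derivative f' x) (at x)"
  shows "\<exists>z. \<bar>z - a\<bar> \<le> \<bar>b - a\<bar> \<and> f b - f a = (b - a) * f' z"
proof -
  consider "a < b" | "b < a" | "a = b" by linarith
  then show ?thesis
  proof cases
    case 1
    then obtain z where "a < z" "z < b" "f b - f a = (b - a) * f' z"
      using MVT2[of a b f f'] assms by auto
    then show ?thesis by (intro exI[of _ z]) auto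
  next
    case 2
    then obtain z where "b < z" "z < a" "f a - f b = (a - b) * f' z"
      using MVT2[of b a f f'] assms by auto
    then show ?thesis by (intro exI[of _ z]) (auto simp: algebra_simps)
  qed auto
qed

lemma smooth_Rk_cong: "smooth_Rk k F \<Longrightarrow> (\<And>i. i < k \<Longrightarrow> x i = y i) \<Longrightarrow> F x = F y"
  by (simp add: smooth_Rk_def)

lemma smooth_Rk_continuous: "smooth_Rk k F \<Longrightarrow> isCont F x"
  unfolding smooth_Rk_def by (metis Ck_Rk.simps(1) UNIV_I continuous_on_eq_continuous_at open_UNIV)

lemma partial_cong:
  assumes "\<And>x y. (\<And>i. i < k \<Longrightarrow> x i = y i) \<Longrightarrow> F x = F y" "i < k" "\<And>i. i < k \<Longrightarrow> x i = y i"
  shows "partial i F x = partial i F y"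
proof -
  have "F (x(i := t)) = F (y(i := t))" for t by (rule assms(1)) (simp add: assms(3))
  then show ?thesis by (simp add: partial_def assms(2,3))
qed

lemma smooth_Rk_partial:
  assumes "smooth_Rk k F" "i < k"
  shows "smooth_Rk k (partial i F)"
  unfolding smooth_Rk_def
proof (intro conjI allI impI)
  show "partial i F x = partial i F y" if "\<forall>i<k. x i = y i" for x y
    using partial_cong[of k F i x y] smooth_Rk_cong[OF assms(1)] assms(2) that by blast
  show "Ck_Rk m k (partial i F)" for m
    using assms unfolding smooth_Rk_def by (metis Ck_Rk.simps(2))
qed

lemma real_differentiable_deriv:
  fixes f :: "real \<Rightarrow> real"
  shows "f differentiable at x \<Longrightarrow> (f has_real_derivative deriv f x) (at x)"
  using real_differentiable_def DERIV_imp_deriv by metis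

lemma smooth_Rk_partial_derivative:
  assumes "smooth_Rk k F" "i < k"
  shows "((\<lambda>t. F (x(i := t))) has_real_derivative partial i F (x(i := s))) (at s)"
proof -
  have "Ck_Rk (Suc 0) k F" using assms by (simp only: smooth_Rk_def)
  then have "(\<lambda>t. F ((x(i := s))(i := t))) differentiable at ((x(i := s)) i)"
    using assms(2) by (simp only: Ck_Rk.simps)
  then have "(\<lambda>t. F (x(i := t))) differentiable at s" by simp
  from real_differentiable_deriv[OF this] show ?thesis by (simp add: partial_def)
qed

text \<open>The coordinates are moved one at a time. By the mean value theorem each increment is a
  partial derivative at an intermediate point, and the intermediate points tend to a, where the
  partial derivatives are continuous.\<close>

lemma smooth_Rk_line_derivative:
  assumes F: "smooth_Rk k F"
  shows "((\<lambda>e. F (\<lambda>j. a j + e * d j)) has_real_derivative (\<Sum>i<k. partial i F a * d i)) (at 0)"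
proof -
  define P where "P m e = (\<lambda>j. if j < m then a j + e * d j else a j)" for m and e :: real
  have "((\<lambda>e. F (P m e)) has_real_derivative (\<Sum>i<m. partial i F a * d i)) (at 0)" if "m \<le> k" for m
    using that
  proof (induction m)
    case (Suc m)
    then have m: "m < k" by simp
    define Q where "Q e = F ((P m e)(m := a m + e * d m)) - F ((P m e)(m := a m))" for e
    have "\<exists>z. \<bar>z - a m\<bar> \<le> \<bar>a m + e * d m - a m\<bar> \<and> Q e = (a m + e * d m - a m) * partial m F ((P m e)(m := z))" for e
      unfolding Q_def by (rule mvt_unordered) (rule smooth_Rk_partial_derivative[OF F m])
    then obtain z where z: "\<And>e. \<bar>z e - a m\<bar> \<le> \<bar>e * d m\<bar>"
      "\<And>e. Q e = e * d m * partial m F ((P m e)(m := z e))" by (simp) metis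
    have "((\<lambda>e. z e - a m) \<longlongrightarrow> 0) (at 0)"
    proof (rule Lim_null_comparison)
      show "\<forall>\<^sub>F e in at 0. norm (z e - a m) \<le> \<bar>e * d m\<bar>" using z by simp
      show "((\<lambda>e. \<bar>e * d m\<bar>) \<longlongrightarrow> 0) (at 0)" by (auto intro!: tendsto_eq_intros)
    qed
    then have zlim: "(z \<longlongrightarrow> a m) (at 0)" using Lim_null by blast
    have "((\<lambda>e. (P m e)(m := z e)) \<longlongrightarrow> a) (at 0)"
    proof (rule tendsto_funI)
      fix j
      have "((\<lambda>e. a j + e * d j) \<longlongrightarrow> a j) (at 0)" by (auto intro!: tendsto_eq_intros)
      then show "((\<lambda>e. ((P m e)(m := z e)) j) \<longlongrightarrow> a j) (at 0)"
        using zlim by (cases "j = m"; cases "j < m") (auto simp: P_def)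
    qed
    then have "((\<lambda>e. partial m F ((P m e)(m := z e))) \<longlongrightarrow> partial m F a) (at 0)"
      using smooth_Rk_continuous[OF smooth_Rk_partial[OF F m]] isCont_tendsto_compose by blast
    then have "((\<lambda>e. d m * partial m F ((P m e)(m := z e))) \<longlongrightarrow> d m * partial m F a) (at 0)"
      by (rule tendsto_mult_left)
    then have "((\<lambda>e. (Q e - Q 0) / (e - 0)) \<longlongrightarrow> d m * partial m F a) (at 0)"
      by (rule Lim_transform_eventually) (auto simp: eventually_at_filter z(2))
    then have "(Q has_real_derivative d m * partial m F a) (at 0)"
      by (simp add: has_field_derivative_iff)
    with Suc have "((\<lambda>e. F (P m e) + Q e) has_real_derivative (\<Sum>i<m. partial i F a * d i) + d m * partial m F a) (at 0)"
      by (intro DERIV_add) auto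
    moreover have "(P m e)(m := a m + e * d m) = P (Suc m) e" "(P m e)(m := a m) = P m e" for e
      by (auto simp: P_def fun_eq_iff)
    ultimately show ?case by (simp add: Q_def mult.commute)
  qed (simp add: P_def)
  \<comment> \<open>\<open>P k e\<close> differs from the full line only beyond the first k entries,
    which F does not see.\<close>
  from this[OF order_refl] show ?thesis
  proof (rule has_field_derivative_transform_within_open[OF _ open_UNIV UNIV_I])
    show "F (P k e) = F (\<lambda>j. a j + e * d j)" for e
      by (rule smooth_Rk_cong[OF F]) (simp add: P_def)
  qed
qed

section \<open>Symmetry of second partial derivatives\<close>

text \<open>The second difference of F is symmetric in i and j, so both mixed derivatives are limits
  of one quotient. The mean value theorem is applied in direction i to the difference of F in
  direction j, then in direction j to \<open>partial i F\<close>.\<close>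

lemma mixed_difference_quotient:
  assumes F: "smooth_Rk k F" and ij: "i < k" "j < k" "i \<noteq> j"
  shows "((\<lambda>h. (F (x(i := x i + h, j := x j + h)) - F (x(i := x i + h)) - F (x(j := x j + h)) + F x) / h\<^sup>2)
    \<longlongrightarrow> partial j (partial i F) x) (at_right 0)"
proof -
  define \<Delta> where "\<Delta> h = F (x(i := x i + h, j := x j + h)) - F (x(i := x i + h)) - F (x(j := x j + h)) + F x" for h
  have "\<exists>s t. \<bar>s - x i\<bar> \<le> \<bar>h\<bar> \<and> \<bar>t - x j\<bar> \<le> \<bar>h\<bar> \<and> \<Delta> h = h * (h * partial j (partial i F) (x(i := s, j := t)))" for h
  proof -
    let ?\<phi> = "\<lambda>s. F (x(j := x j + h, i := s)) - F (x(i := s))"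
    have "\<exists>s. \<bar>s - x i\<bar> \<le> \<bar>(x i + h) - x i\<bar> \<and> ?\<phi> (x i + h) - ?\<phi> (x i) =
        ((x i + h) - x i) * (partial i F (x(j := x j + h, i := s)) - partial i F (x(i := s)))"
      by (rule mvt_unordered) (intro DERIV_diff smooth_Rk_partial_derivative[OF F ij(1)])
    then obtain s where s: "\<bar>s - x i\<bar> \<le> \<bar>h\<bar>"
      "?\<phi> (x i + h) - ?\<phi> (x i) = h * (partial i F (x(j := x j + h, i := s)) - partial i F (x(i := s)))"
      by auto
    have "\<exists>t. \<bar>t - x j\<bar> \<le> \<bar>(x j + h) - x j\<bar> \<and> partial i F (x(i := s, j := x j + h)) - partial i F (x(i := s, j := x j)) =
        ((x j + h) - x j) * partial j (partial i F) (x(i := s, j := t))"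
      by (rule mvt_unordered) (rule smooth_Rk_partial_derivative[OF smooth_Rk_partial[OF F ij(1)] ij(2)])
    then obtain t where t: "\<bar>t - x j\<bar> \<le> \<bar>h\<bar>"
      "partial i F (x(i := s, j := x j + h)) - partial i F (x(i := s, j := x j)) = h * partial j (partial i F) (x(i := s, j := t))"
      by auto
    have "(x(i := s))(j := x j) = x(i := s)" "x(i := x i) = x" "(x(j := x j + h))(i := x i) = x(j := x j + h)"
      using ij(3) by auto
    then have "\<Delta> h = h * (h * partial j (partial i F) (x(i := s, j := t)))"
      using s(2) t(2) ij(3) by (simp add: \<Delta>_def fun_upd_twist[of j i])
    then show ?thesis using s(1) t(1) by blast
  qed
  then obtain s t where st: "\<And>h. \<bar>s h - x i\<bar> \<le> \<bar>h\<bar>" "\<And>h. \<bar>t h - x j\<bar> \<le> \<bar>h\<bar>"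
    "\<And>h. \<Delta> h = h * (h * partial j (partial i F) (x(i := s h, j := t h)))"
    by metis
  have habs: "((\<lambda>h::real. \<bar>h\<bar>) \<longlongrightarrow> 0) (at_right 0)" by (auto intro!: tendsto_eq_intros)
  have "((\<lambda>h. s h - x i) \<longlongrightarrow> 0) (at_right 0)" "((\<lambda>h. t h - x j) \<longlongrightarrow> 0) (at_right 0)"
    using st by (auto intro!: Lim_null_comparison[OF _ habs])
  then have "(s \<longlongrightarrow> x i) (at_right 0)" "(t \<longlongrightarrow> x j) (at_right 0)"
    using Lim_null by blast+
  then have "((\<lambda>h. x(i := s h, j := t h)) \<longlongrightarrow> x) (at_right 0)"
  proof (intro tendsto_funI)
    fix l assume "(s \<longlongrightarrow> x i) (at_right 0)" "(t \<longlongrightarrow> x j) (at_right 0)"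
    then show "((\<lambda>h. (x(i := s h, j := t h)) l) \<longlongrightarrow> x l) (at_right 0)"
      by (cases "l = j"; cases "l = i") auto
  qed
  then have "((\<lambda>h. partial j (partial i F) (x(i := s h, j := t h))) \<longlongrightarrow> partial j (partial i F) x) (at_right 0)"
    using smooth_Rk_continuous[OF smooth_Rk_partial[OF smooth_Rk_partial[OF F ij(1)] ij(2)]]
      isCont_tendsto_compose by blast
  then have "((\<lambda>h. \<Delta> h / h\<^sup>2) \<longlongrightarrow> partial j (partial i F) x) (at_right 0)"
    by (rule Lim_transform_eventually) (auto simp: eventually_at_filter st(3) power2_eq_square)
  then show ?thesis by (simp add: \<Delta>_def)
qed

lemma partial_commute:
  assumes F: "smooth_Rk k F" and ij: "i < k" "j < k"
  shows "partial i (partial j F) x = partial j (partial i F) x"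
proof (cases "i = j")
  case False
  have "x(j := x j + h, i := x i + h) = x(i := x i + h, j := x j + h)" for h
    using False by (simp add: fun_upd_twist)
  with mixed_difference_quotient[OF F ij(2,1), of x] False
  have "((\<lambda>h. (F (x(i := x i + h, j := x j + h)) - F (x(i := x i + h)) - F (x(j := x j + h)) + F x) / h\<^sup>2)
    \<longlongrightarrow> partial i (partial j F) x) (at_right 0)" by (simp add: algebra_simps)
  then show ?thesis
    using mixed_difference_quotient[OF F ij False, of x] tendsto_unique trivial_limit_at_right_real by blast
qed simp

section \<open>Sums, products and reindexing of smooth functions\<close>

lemma Ck_Rk_SucD: "Ck_Rk (Suc m) k F \<Longrightarrow> Ck_Rk m k F"
proof (induction m arbitrary: F)
  case (Suc m)
  then show ?case by (metis Ck_Rk.simps(2))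
qed simp

lemma partial_const [simp]: "partial i (\<lambda>x. c) = (\<lambda>x. 0)"
  by (simp add: partial_def fun_eq_iff)

lemma Ck_Rk_const: "Ck_Rk m k (\<lambda>x. c)"
  by (induction m arbitrary: c) auto

lemma Ck_Rk_add: "Ck_Rk m k F \<Longrightarrow> Ck_Rk m k G \<Longrightarrow> Ck_Rk m k (\<lambda>x. F x + G x)"
proof (induction m arbitrary: F G)
  case 0
  then show ?case by (auto intro: continuous_on_add)
next
  case (Suc m)
  have "partial i (\<lambda>x. F x + G x) = (\<lambda>x. partial i F x + partial i G x)" if "i < k" for i
    using Suc.prems that unfolding partial_def fun_eq_iff
    by (intro allI DERIV_imp_deriv DERIV_add) (auto intro!: real_differentiable_deriv)
  then show ?case using Suc by (auto intro!: continuous_on_add)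
qed

lemma Ck_Rk_mult: "Ck_Rk m k F \<Longrightarrow> Ck_Rk m k G \<Longrightarrow> Ck_Rk m k (\<lambda>x. F x * G x)"
proof (induction m arbitrary: F G)
  case 0
  then show ?case by (auto intro: continuous_on_mult)
next
  case (Suc m)
  have "partial i (\<lambda>x. F x * G x) = (\<lambda>x. partial i F x * G x + partial i G x * F x)" if "i < k" for i
  proof
    fix x
    have "((\<lambda>t. F (x(i := t)) * G (x(i := t))) has_real_derivative
        partial i F x * G (x(i := x i)) + partial i G x * F (x(i := x i))) (at (x i))"
      using Suc.prems that unfolding partial_def
      by (intro DERIV_mult) (auto intro!: real_differentiable_deriv)
    then show "partial i (\<lambda>x. F x * G x) x = partial i F x * G x + partial i G x * F x"
      by (simp add: partial_def[of i "\<lambda>x. F x * G x"] DERIV_imp_deriv)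
  qed
  then show ?case
    using Suc Ck_Rk_SucD[OF Suc.prems(1)] Ck_Rk_SucD[OF Suc.prems(2)]
    by (auto intro!: continuous_on_mult Ck_Rk_add)
qed

text \<open>Serves to let two cylinder functions read disjoint blocks of entries. By injectivity,
  moving one entry of x moves at most one argument of G.\<close>

lemma Ck_Rk_reindex:
  assumes "inj \<sigma>" "Ck_Rk m l G" "\<And>x y. (\<And>i. i < l \<Longrightarrow> x i = y i) \<Longrightarrow> G x = G y"
  shows "Ck_Rk m k (\<lambda>x. G (\<lambda>j. x (\<sigma> j)))"
  using assms(2,3)
proof (induction m arbitrary: G)
  have cont: "continuous_on UNIV (\<lambda>x. G (\<lambda>j. x (\<sigma> j)))" if "continuous_on UNIV G" for G :: "(nat \<Rightarrow> real) \<Rightarrow> real"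
    using that
    by (rule continuous_on_compose2) (auto intro: continuous_on_coordinatewise_then_product continuous_on_product_coordinates)
  {
    case (0 G)
    show ?case using cont[of G] 0(1) by (simp only: Ck_Rk.simps)
  next
    case (Suc m G)
    show ?case
      unfolding Ck_Rk.simps
    proof (intro conjI allI impI)
      show "continuous_on UNIV (\<lambda>x. G (\<lambda>j. x (\<sigma> j)))"
        using Suc.prems(1) by (intro cont) simp
      fix i
      \<comment> \<open>In the second case \<sigma> hits i at no index below l; then G does not see
        the entry and the partial derivative is 0.\<close>
      consider j where "j < l" "i = \<sigma> j" | "i \<notin> \<sigma> ` {..<l}" by blast
      then have "(\<forall>x. (\<lambda>t. G (\<lambda>j. (x(i := t)) (\<sigma> j))) differentiable at (x i)) \<and>
          Ck_Rk m k (partial i (\<lambda>x. G (\<lambda>j. x (\<sigma> j))))"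
      proof cases
        case 1
        have eq: "(\<lambda>j. (x(i := t)) (\<sigma> j)) = (\<lambda>j. x (\<sigma> j))(j := t)" for x :: "nat \<Rightarrow> real" and t
          using 1(2) assms(1) by (auto simp: fun_eq_iff dest: injD)
        have "(\<lambda>t. G ((\<lambda>j. x (\<sigma> j))(j := t))) differentiable at (x (\<sigma> j))" for x
          using Suc.prems(1) 1(1) unfolding Ck_Rk.simps by blast
        moreover have "partial i (\<lambda>x. G (\<lambda>j. x (\<sigma> j))) = (\<lambda>x. partial j G (\<lambda>j. x (\<sigma> j)))"
          unfolding 1(2) by (simp only: partial_def fun_eq_iff eq[unfolded 1(2)] simp_thms)
        moreover have "Ck_Rk m k (\<lambda>x. partial j G (\<lambda>j. x (\<sigma> j)))"
        proof (rule Suc.IH)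
          show "Ck_Rk m l (partial j G)" using Suc.prems(1) 1(1) by simp
          show "partial j G x = partial j G y" if "\<And>i. i < l \<Longrightarrow> x i = y i" for x y
            using partial_cong[of l G j x y] Suc.prems(2) 1(1) that by blast
        qed
        ultimately show ?thesis unfolding 1(2) by (simp only: eq[unfolded 1(2)] simp_thms)
      next
        case 2
        have eq: "G (\<lambda>j. (x(i := t)) (\<sigma> j)) = G (\<lambda>j. x (\<sigma> j))" for x :: "nat \<Rightarrow> real" and t
          using 2 by (intro Suc.prems(2)) auto
        have "partial i (\<lambda>x. G (\<lambda>j. x (\<sigma> j))) = (\<lambda>x. 0)"
          by (rule ext) (simp only: partial_def eq deriv_const)
        then show ?thesis by (simp only: eq) (simp add: Ck_Rk_const)
      qed
      then show "(\<lambda>t. G (\<lambda>j. (x(i := t)) (\<sigma> j))) differentiable at (x i)"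
        "Ck_Rk m k (partial i (\<lambda>x. G (\<lambda>j. x (\<sigma> j))))" for x by blast+
    qed
  }
qed

lemma smooth_Rk_reindex:
  assumes "smooth_Rk l G" "inj \<sigma>" "\<And>j. j < l \<Longrightarrow> \<sigma> j < k"
  shows "smooth_Rk k (\<lambda>x. G (\<lambda>j. x (\<sigma> j)))"
  unfolding smooth_Rk_def
proof (intro conjI allI impI)
  show "G (\<lambda>j. x (\<sigma> j)) = G (\<lambda>j. y (\<sigma> j))" if "\<forall>i<k. x i = y i" for x y
    using that assms(3) by (intro smooth_Rk_cong[OF assms(1)]) auto
  show "Ck_Rk m k (\<lambda>x. G (\<lambda>j. x (\<sigma> j)))" for m
    by (rule Ck_Rk_reindex[OF assms(2) _ smooth_Rk_cong[OF assms(1)]]) (use assms(1) in \<open>auto simp: smooth_Rk_def\<close>)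
qed

lemma smooth_Rk_add: "smooth_Rk k F \<Longrightarrow> smooth_Rk k G \<Longrightarrow> smooth_Rk k (\<lambda>x. F x + G x)"
  by (auto simp: smooth_Rk_def intro: Ck_Rk_add) metis

lemma smooth_Rk_mult: "smooth_Rk k F \<Longrightarrow> smooth_Rk k G \<Longrightarrow> smooth_Rk k (\<lambda>x. F x * G x)"
  by (auto simp: smooth_Rk_def intro: Ck_Rk_mult) metis

section \<open>The algebra of cylinder functions\<close>

text \<open>The two lists of functions are concatenated: F keeps the first k entries and G reads the
  next l, shifted by k. Over a common list, sums and products of cylinder functions are those of F
  and G.\<close>

lemma cyl_functions_common_rep:
  assumes "u \<in> cyl_functions A" "v \<in> cyl_functions A"
  obtains k F G f where "cyl_rep A k F f u" "cyl_rep A k G f v"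
proof -
  obtain k F f where u: "cyl_rep A k F f u" using assms(1) by (auto simp: cyl_functions_def)
  obtain l G h where v: "cyl_rep A l G h v" using assms(2) by (auto simp: cyl_functions_def)
  let ?f = "\<lambda>i. if i < k then f i else h (i - k)"
  have "smooth_Rk (k + l) (\<lambda>x. F (\<lambda>j. x j))"
    using u smooth_Rk_reindex[of k F "\<lambda>j. j" "k + l"] by (simp add: cyl_rep_def inj_def)
  moreover have "smooth_Rk (k + l) (\<lambda>x. G (\<lambda>j. x (j + k)))"
    using v smooth_Rk_reindex[of l G "\<lambda>j. j + k" "k + l"] by (simp add: cyl_rep_def inj_def)
  moreover have "F (\<lambda>j. star (?f j) \<mu>) = F (\<lambda>j. star (f j) \<mu>)" for \<mu>
    using u by (intro smooth_Rk_cong[of k F]) (auto simp: cyl_rep_def)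
  ultimately have "cyl_rep A (k + l) F ?f u" "cyl_rep A (k + l) (\<lambda>x. G (\<lambda>j. x (j + k))) ?f v"
    using u v by (auto simp: cyl_rep_def)
  then show thesis by (rule that)
qed

lemma cyl_functions_add:
  assumes "u \<in> cyl_functions A" "v \<in> cyl_functions A"
  shows "(\<lambda>\<mu>. u \<mu> + v \<mu>) \<in> cyl_functions A"
proof -
  obtain k F G f where "cyl_rep A k F f u" "cyl_rep A k G f v"
    using assms by (rule cyl_functions_common_rep)
  then have "cyl_rep A k (\<lambda>x. F x + G x) f (\<lambda>\<mu>. u \<mu> + v \<mu>)"
    by (auto simp: cyl_rep_def intro: smooth_Rk_add)
  then show ?thesis by (auto simp: cyl_functions_def)
qed

lemma cyl_functions_mult:
  assumes "u \<in> cyl_functions A" "v \<in> cyl_functions A"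
  shows "(\<lambda>\<mu>. u \<mu> * v \<mu>) \<in> cyl_functions A"
proof -
  obtain k F G f where "cyl_rep A k F f u" "cyl_rep A k G f v"
    using assms by (rule cyl_functions_common_rep)
  then have "cyl_rep A k (\<lambda>x. F x * G x) f (\<lambda>\<mu>. u \<mu> * v \<mu>)"
    by (auto simp: cyl_rep_def intro: smooth_Rk_mult)
  then show ?thesis by (auto simp: cyl_functions_def)
qed

lemma cyl_functions_const [simp]: "(\<lambda>\<mu>. c) \<in> cyl_functions A"
proof -
  have "cyl_rep A 0 (\<lambda>x. c) f (\<lambda>\<mu>. c)" for f
    by (simp add: cyl_rep_def smooth_Rk_def Ck_Rk_const)
  then show ?thesis by (auto simp: cyl_functions_def)
qed

lemma cyl_functions_star [simp]:
  assumes "f \<in> smooth_functions A"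
  shows "star f \<in> cyl_functions A"
proof -
  have "partial 0 (\<lambda>x. x 0) = (\<lambda>x. 1)"
    by (simp add: partial_def fun_eq_iff)
  \<comment> \<open>One unfolding is enough, because the first partial derivative is already
    constant.\<close>
  then have "Ck_Rk m 1 (\<lambda>x. x 0)" for m
    by (cases m) (auto simp: Ck_Rk_const continuous_on_product_coordinates)
  then have "cyl_rep A 1 (\<lambda>x. x 0) (\<lambda>_. f) (star f)"
    using assms by (simp add: cyl_rep_def smooth_Rk_def)
  then show ?thesis by (auto simp: cyl_functions_def)
qed

lemma cyl_functions_sum: "(\<And>i. i \<in> I \<Longrightarrow> u i \<in> cyl_functions A) \<Longrightarrow> (\<lambda>\<mu>. \<Sum>i\<in>I. u i \<mu>) \<in> cyl_functions A"
  by (induction I rule: infinite_finite_induct) (auto intro: cyl_functions_add)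

lemma cyl_functions_partial:
  assumes "cyl_rep A k F f u" "i < k"
  shows "(\<lambda>\<mu>. partial i F (\<lambda>j. star (f j) \<mu>)) \<in> cyl_functions A"
proof -
  have "cyl_rep A k (partial i F) f (\<lambda>\<mu>. partial i F (\<lambda>j. star (f j) \<mu>))"
    using assms by (auto simp: cyl_rep_def intro: smooth_Rk_partial)
  then show ?thesis by (auto simp: cyl_functions_def)
qed

section \<open>The differential of a cylinder function\<close>

lemma prob_space_meas_of: "prob_space (meas_of \<mu>)" and sets_meas_of [measurable_cong, simp]: "sets (meas_of \<mu>) = sets borel"
  using meas_of[of \<mu>] by (auto simp: space_prob_algebra)

lemma space_meas_of [simp]: "space (meas_of \<mu>) = UNIV"
  using sets_eq_imp_space_eq[OF sets_meas_of] by simp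

text \<open>For 0 \<le> e \<le> 1 this is (1 - e) \<mu> + e \<delta>_p, built by drawing a Bernoulli
  variable and then a point: in this form, general facts on kernels make it a probability measure on
  the Borel sets.\<close>

definition mix :: "real \<Rightarrow> 'm::topological_space pmeas \<Rightarrow> 'm \<Rightarrow> 'm pmeas"
  where "mix e \<mu> p = Abs_pmeas (measure_pmf (bernoulli_pmf e) \<bind> (\<lambda>b. if b then return borel p else meas_of \<mu>))"

lemma kernel_mix:
  "(\<lambda>b. if b then return borel p else meas_of \<mu>) \<in> measure_pmf (bernoulli_pmf e) \<rightarrow>\<^sub>M prob_algebra borel"
  by (auto simp: measurable_def space_prob_algebra prob_space_return prob_space_meas_of)

lemma meas_of_mix:
  "meas_of (mix e \<mu> p) = measure_pmf (bernoulli_pmf e) \<bind> (\<lambda>b. if b then return borel p else meas_of \<mu>)"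
proof -
  have "measure_pmf (bernoulli_pmf e) \<in> space (prob_algebra (measure_pmf (bernoulli_pmf e)))"
    by (simp add: space_prob_algebra prob_space_measure_pmf)
  from sets_bind'[OF this kernel_mix] prob_space_bind'[OF this kernel_mix]
  show ?thesis unfolding mix_def by (subst Abs_pmeas_inverse) (auto simp: space_prob_algebra)
qed

context closed_manifold
begin

abbreviation "FC \<equiv> cyl_functions A"
abbreviation "CVF \<equiv> cyl_vector_fields A"

lemma C_measurable: "f \<in> C \<Longrightarrow> f \<in> borel_measurable borel"
  by (intro borel_measurable_continuous_onI C_continuous)

lemma C_integrable: "f \<in> C \<Longrightarrow> integrable (meas_of \<mu>) f"
proof -
  assume f: "f \<in> C"
  interpret prob_space "meas_of \<mu>" by (rule prob_space_meas_of)
  from C_bounded[OF f] obtain B where "\<And>p. \<bar>f p\<bar> \<le> B" by blast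
  then show ?thesis
    using C_measurable[OF f] by (intro integrable_const_bound[of _ B]) auto
qed

lemma star_const [simp]: "star (\<lambda>p. c) \<mu> = c"
  using prob_space.prob_space[OF prob_space_meas_of, of \<mu>] by (simp add: star_def)

lemma star_add: "f \<in> C \<Longrightarrow> h \<in> C \<Longrightarrow> star (\<lambda>p. f p + h p) \<mu> = star f \<mu> + star h \<mu>"
  by (simp add: star_def C_integrable)

lemma star_cmult: "star (\<lambda>p. c * f p) \<mu> = c * star f \<mu>"
  by (simp add: star_def)

lemma star_diff: "f \<in> C \<Longrightarrow> h \<in> C \<Longrightarrow> star (\<lambda>p. f p - h p) \<mu> = star f \<mu> - star h \<mu>"
  by (simp add: star_def C_integrable)

lemma star_sum: "(\<And>i. i \<in> I \<Longrightarrow> f i \<in> C) \<Longrightarrow> star (\<lambda>p. \<Sum>i\<in>I. f i p) \<mu> = (\<Sum>i\<in>I. star (f i) \<mu>)"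
  by (simp add: star_def C_integrable)

lemma star_mix:
  assumes f: "f \<in> C" and e: "0 \<le> e" "e \<le> 1"
  shows "star f (mix e \<mu> p) = (1 - e) * star f \<mu> + e * f p"
proof -
  \<comment> \<open>Integration against a bind is evaluated for a bounded integrand; compactness of
    M provides the bound.\<close>
  from C_bounded[OF f] obtain B where B: "\<And>p. \<bar>f p\<bar> \<le> B" by blast
  have "star f (mix e \<mu> p) = (\<integral>b. integral\<^sup>L (if b then return borel p else meas_of \<mu>) f \<partial>measure_pmf (bernoulli_pmf e))"
    unfolding star_def meas_of_mix
  proof (rule integral_bind[where K=borel and B'=1 and B=B])
    show "(\<lambda>b. if b then return borel p else meas_of \<mu>) \<in> measure_pmf (bernoulli_pmf e) \<rightarrow>\<^sub>M subprob_algebra borel"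
      by (rule measurable_prob_algebraD[OF kernel_mix])
    show "AE x in measure_pmf (bernoulli_pmf e). emeasure (if x then return borel p else meas_of \<mu>)
        (space (if x then return borel p else meas_of \<mu>)) \<le> ennreal 1"
      using prob_space.emeasure_space_1[OF prob_space_meas_of, of \<mu>] by auto
  qed (use B C_measurable[OF f] in \<open>auto intro: finite_measure.intro measure_pmf.finite_measure_axioms\<close>)
  also have "\<dots> = (1 - e) * star f \<mu> + e * f p"
    using e C_measurable[OF f] by (simp add: star_def integral_return)
  finally show ?thesis .
qed

text \<open>The differential of a cylinder function at \<open>\<mu>\<close> is the differential of the function
  \<open>p \<mapsto> d/de u((1 - e) \<mu> + e \<delta>\<^sub>p)\<close>, which depends on \<open>u\<close> alone and not on its representation.\<close>

definition flat_derivative :: "('m pmeas \<Rightarrow> real) \<Rightarrow> 'm pmeas \<Rightarrow> ('m \<Rightarrow> real) \<Rightarrow> bool"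
  where "flat_derivative u \<mu> \<phi> \<longleftrightarrow> \<phi> \<in> C \<and>
    (\<forall>p. ((\<lambda>e. u (mix e \<mu> p)) has_real_derivative (\<phi> p - star \<phi> \<mu>)) (at 0 within {0..1}))"

text \<open>The derivative along the curves determines \<phi> minus its mean, hence \<phi> up to a
  constant, and derivations annihilate constants.\<close>

lemma flat_derivative_unique:
  assumes "flat_derivative u \<mu> \<phi>" "flat_derivative u \<mu> \<psi>" "v \<in> T p"
  shows "v \<phi> = v \<psi>"
proof -
  have C: "\<phi> \<in> C" "\<psi> \<in> C" using assms by (auto simp: flat_derivative_def)
  have "\<phi> q - star \<phi> \<mu> = \<psi> q - star \<psi> \<mu>" for q
  proof (rule tendsto_unique)
    show "at 0 within {0..1::real} \<noteq> bot" by (simp add: trivial_limit_within islimpt_Icc)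
    show "((\<lambda>e. (u (mix e \<mu> q) - u (mix 0 \<mu> q)) / (e - 0)) \<longlongrightarrow> \<phi> q - star \<phi> \<mu>) (at 0 within {0..1})"
      "((\<lambda>e. (u (mix e \<mu> q) - u (mix 0 \<mu> q)) / (e - 0)) \<longlongrightarrow> \<psi> q - star \<psi> \<mu>) (at 0 within {0..1})"
      using assms by (simp_all add: flat_derivative_def has_field_derivative_iff)
  qed
  then have "\<phi> = (\<lambda>q. \<psi> q + (star \<phi> \<mu> - star \<psi> \<mu>))" by (auto simp: fun_eq_iff algebra_simps)
  then have "v \<phi> = v (\<lambda>q. \<psi> q + (star \<phi> \<mu> - star \<psi> \<mu>))" by simp
  also have "\<dots> = v \<psi>" using tangent_add[OF assms(3) C(2) C_const] tangent_const[OF assms(3)] by simp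
  finally show ?thesis .
qed

lemma flat_derivative_rep:
  assumes "cyl_rep A k F f u"
  shows "flat_derivative u \<mu> (\<lambda>p. \<Sum>i<k. partial i F (\<lambda>j. star (f j) \<mu>) * f i p)"
proof -
  have F: "smooth_Rk k F" and f: "\<And>i. i < k \<Longrightarrow> f i \<in> C" and u: "u = (\<lambda>\<mu>. F (\<lambda>i. star (f i) \<mu>))"
    using assms by (auto simp: cyl_rep_def)
  let ?a = "\<lambda>j. star (f j) \<mu>"
  let ?\<phi> = "\<lambda>p. \<Sum>i<k. partial i F ?a * f i p"
  have "?\<phi> \<in> C" by (intro C_sum C_mult C_const f) simp
  moreover have "((\<lambda>e. u (mix e \<mu> p)) has_real_derivative (?\<phi> p - star ?\<phi> \<mu>)) (at 0 within {0..1})" for p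
  proof (rule has_field_derivative_transform_within[where d=1])
    have "star ?\<phi> \<mu> = (\<Sum>i<k. partial i F ?a * ?a i)"
      by (subst star_sum) (intro C_mult C_const f, simp_all add: star_cmult)
    then have e: "(\<Sum>i<k. partial i F ?a * (f i p - ?a i)) = ?\<phi> p - star ?\<phi> \<mu>"
      by (simp add: right_diff_distrib sum_subtractf)
    \<comment> \<open>Along the curve the integral of \<open>f j\<close> is affine in e, with slope
      \<open>f j p - ?a j\<close>.\<close>
    show "((\<lambda>e. F (\<lambda>j. ?a j + e * (f j p - ?a j))) has_real_derivative (?\<phi> p - star ?\<phi> \<mu>)) (at 0 within {0..1})"
      unfolding e[symmetric] by (rule has_field_derivative_at_within[OF smooth_Rk_line_derivative[OF F]])
    show "F (\<lambda>j. ?a j + e * (f j p - ?a j)) = u (mix e \<mu> p)" if "e \<in> {0..1}" for e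
      unfolding u using that by (intro smooth_Rk_cong[OF F]) (simp add: star_mix f algebra_simps)
  qed auto
  ultimately show ?thesis by (simp add: flat_derivative_def)
qed

lemma flat_derivative_exists: "u \<in> FC \<Longrightarrow> \<exists>\<phi>. flat_derivative u \<mu> \<phi>"
  using flat_derivative_rep unfolding cyl_functions_def by blast

text \<open>The functions obtained from any two representations of u are flat derivatives of u, so
  tangent vectors do not distinguish them. Off the tangent space \<open>differential\<close> is 0 by
  convention, which settles the remaining v.\<close>

lemma cyl_differential_rep:
  assumes "cyl_rep A k F f u"
  shows "cyl_differential A u = (\<lambda>\<mu> p v. \<Sum>i<k. partial i F (\<lambda>j. star (f j) \<mu>) * differential A (f i) p v)"
  unfolding cyl_differential_def
proof (rule the_equality)
  let ?\<omega> = "\<lambda>k F f \<mu> p v. \<Sum>i<k. partial i F (\<lambda>j. star (f j) \<mu>) * differential A (f i) p v"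
  have val: "?\<omega> k F f \<mu> p v = v (\<lambda>p. \<Sum>i<k. partial i F (\<lambda>j. star (f j) \<mu>) * f i p)"
    if "cyl_rep A k F f u" "v \<in> T p" for k F f \<mu> p v
  proof -
    have "v (\<lambda>p. \<Sum>i<k. partial i F (\<lambda>j. star (f j) \<mu>) * f i p) = (\<Sum>i<k. v (\<lambda>p. partial i F (\<lambda>j. star (f j) \<mu>) * f i p))"
      using that by (intro tangent_sum[OF that(2)]) (auto simp: cyl_rep_def)
    also have "\<dots> = ?\<omega> k F f \<mu> p v"
      using that by (intro sum.cong refl) (auto simp: differential_def cyl_rep_def tangent_cmult[OF that(2)])
    finally show ?thesis by simp
  qed
  show "\<exists>l G h. cyl_rep A l G h u \<and> ?\<omega> k F f = ?\<omega> l G h"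
    using assms by blast
  fix \<omega> assume "\<exists>l G h. cyl_rep A l G h u \<and> \<omega> = ?\<omega> l G h"
  then obtain l G h where G: "cyl_rep A l G h u" "\<omega> = ?\<omega> l G h" by blast
  have "?\<omega> l G h \<mu> p v = ?\<omega> k F f \<mu> p v" for \<mu> p v
  proof (cases "v \<in> T p")
    case True
    then show ?thesis
      using val[OF G(1) True] val[OF assms True]
        flat_derivative_unique[OF flat_derivative_rep[OF G(1)] flat_derivative_rep[OF assms] True] by simp
  qed (simp add: differential_def)
  then show "\<omega> = ?\<omega> k F f" unfolding G(2) by (intro ext)
qed

lemma cyl_differential_eq:
  assumes "u \<in> FC" "flat_derivative u \<mu> \<phi>" "v \<in> T p"
  shows "cyl_differential A u \<mu> p v = v \<phi>"
proof -
  obtain k F f where rep: "cyl_rep A k F f u" using assms(1) by (auto simp: cyl_functions_def)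
  have "v (\<lambda>p. \<Sum>i<k. partial i F (\<lambda>j. star (f j) \<mu>) * f i p) = (\<Sum>i<k. v (\<lambda>p. partial i F (\<lambda>j. star (f j) \<mu>) * f i p))"
    using rep by (intro tangent_sum[OF assms(3)]) (auto simp: cyl_rep_def)
  also have "\<dots> = cyl_differential A u \<mu> p v"
    unfolding cyl_differential_rep[OF rep]
    using rep assms(3) by (intro sum.cong refl) (auto simp: differential_def cyl_rep_def tangent_cmult[OF assms(3)])
  finally show ?thesis
    using flat_derivative_unique[OF flat_derivative_rep[OF rep] assms(2,3)] by simp
qed

text \<open>Any flat derivative computes the action, whether or not it comes from a representation.
  The sum and Leibniz rules for \<open>act\<close> thus reduce to those for real functions of
  e.\<close>

lemma act_eq:
  assumes "u \<in> FC" "flat_derivative u \<mu> \<phi>" "\<And>p. V \<mu> p \<in> T p"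
  shows "act A V u \<mu> = star (\<lambda>p. V \<mu> p \<phi>) \<mu>"
  unfolding act_def star_def using cyl_differential_eq[OF assms(1,2,3)] by simp

text \<open>A cylinder function sees a measure only through integrals of smooth functions, and for
  these \<open>star_mix\<close> gives the value at e = 0.\<close>

lemma cyl_function_mix_0: "u \<in> FC \<Longrightarrow> u (mix 0 \<mu> p) = u \<mu>"
proof -
  assume "u \<in> FC"
  then obtain k F f where "cyl_rep A k F f u" by (auto simp: cyl_functions_def)
  then have "smooth_Rk k F" "\<And>i. i < k \<Longrightarrow> f i \<in> C" "u = (\<lambda>\<mu>. F (\<lambda>i. star (f i) \<mu>))"
    by (auto simp: cyl_rep_def)
  then show ?thesis by (auto intro!: smooth_Rk_cong[of k F] simp: star_mix)
qed

lemma flat_derivative_star: "f \<in> C \<Longrightarrow> flat_derivative (star f) \<mu> f"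
  unfolding flat_derivative_def
proof (intro conjI allI)
  fix p assume f: "f \<in> C"
  have "((\<lambda>e. (1 - e) * star f \<mu> + e * f p) has_real_derivative (f p - star f \<mu>)) (at 0 within {0..1})"
    by (auto intro!: derivative_eq_intros)
  then show "((\<lambda>e. star f (mix e \<mu> p)) has_real_derivative (f p - star f \<mu>)) (at 0 within {0..1})"
    by (rule has_field_derivative_transform_within[where d=1]) (auto simp: star_mix f)
qed

lemma flat_derivative_add:
  assumes "flat_derivative u \<mu> \<phi>" "flat_derivative v \<mu> \<psi>"
  shows "flat_derivative (\<lambda>\<mu>. u \<mu> + v \<mu>) \<mu> (\<lambda>p. \<phi> p + \<psi> p)"
  using assms unfolding flat_derivative_def
  by (auto simp: star_add intro!: derivative_eq_intros)

lemma flat_derivative_mult: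
  assumes "flat_derivative u \<mu> \<phi>" "flat_derivative v \<mu> \<psi>" "u \<in> FC" "v \<in> FC"
  shows "flat_derivative (\<lambda>\<mu>. u \<mu> * v \<mu>) \<mu> (\<lambda>p. u \<mu> * \<psi> p + v \<mu> * \<phi> p)"
proof -
  have C: "\<phi> \<in> C" "\<psi> \<in> C" using assms by (auto simp: flat_derivative_def)
  have d: "((\<lambda>e. u (mix e \<mu> p) * v (mix e \<mu> p)) has_real_derivative
      (\<phi> p - star \<phi> \<mu>) * v (mix 0 \<mu> p) + (\<psi> p - star \<psi> \<mu>) * u (mix 0 \<mu> p)) (at 0 within {0..1})" for p
    using assms unfolding flat_derivative_def by (intro DERIV_mult) auto
  have s: "star (\<lambda>p. u \<mu> * \<psi> p + v \<mu> * \<phi> p) \<mu> = u \<mu> * star \<psi> \<mu> + v \<mu> * star \<phi> \<mu>"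
    using star_add[OF C_mult[OF C_const C(2)] C_mult[OF C_const C(1)]] by (simp add: star_cmult)
  have "((\<lambda>e. u (mix e \<mu> p) * v (mix e \<mu> p)) has_real_derivative
      (u \<mu> * \<psi> p + v \<mu> * \<phi> p - star (\<lambda>p. u \<mu> * \<psi> p + v \<mu> * \<phi> p) \<mu>)) (at 0 within {0..1})" for p
    by (rule DERIV_cong[OF d]) (simp only: s cyl_function_mix_0[OF assms(3)] cyl_function_mix_0[OF assms(4)], simp add: algebra_simps)
  then show ?thesis
    using C by (simp add: flat_derivative_def)
qed

section \<open>The module of cylinder vector fields\<close>

lemma tensor_sum_apply: "tensor_sum n u w \<mu> p h = (\<Sum>j<n. u j \<mu> * w j p h)"
  by (induction n) (auto simp: tensor_sum_def tensor_def)

lemma CVF_E: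
  assumes "V \<in> CVF"
  obtains n :: nat and u w where "\<And>j. j < n \<Longrightarrow> u j \<in> FC" "\<And>j. j < n \<Longrightarrow> w j \<in> VF"
    "\<And>\<mu> p h. V \<mu> p h = (\<Sum>j<n. u j \<mu> * w j p h)"
proof -
  obtain n u w where "\<forall>j<n. u j \<in> FC \<and> w j \<in> VF" "V = tensor_sum n u w"
    using assms by (auto simp: cyl_vector_fields_def)
  then show thesis by (intro that[of n u w]) (auto simp: tensor_sum_apply)
qed

lemma CVF_I:
  fixes n :: nat
  assumes "\<And>j. j < n \<Longrightarrow> u j \<in> FC" "\<And>j. j < n \<Longrightarrow> w j \<in> VF" "\<And>\<mu> p h. V \<mu> p h = (\<Sum>j<n. u j \<mu> * w j p h)"
  shows "V \<in> CVF"
proof -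
  have "V = tensor_sum n u w" by (simp add: fun_eq_iff tensor_sum_apply assms(3))
  then show ?thesis unfolding cyl_vector_fields_def using assms(1,2) by blast
qed

lemma CVF_eval:
  assumes "V \<in> CVF"
  shows "V \<mu> \<in> VF"
proof -
  obtain n :: nat and u w where V: "\<And>j. j < n \<Longrightarrow> u j \<in> FC" "\<And>j. j < n \<Longrightarrow> w j \<in> VF"
    "\<And>\<mu> p h. V \<mu> p h = (\<Sum>j<n. u j \<mu> * w j p h)"
    using assms by (rule CVF_E) blast
  have "V \<mu> = (\<Sum>j<n. vmul (\<lambda>_. u j \<mu>) (w j))"
    by (simp add: fun_eq_iff sum_fun_apply vmul_def V(3))
  also have "\<dots> \<in> VF"
    by (intro VF_sum VF_vmul C_const V(2)) simp
  finally show ?thesis .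
qed

lemma CVF_add:
  assumes "V \<in> CVF" "Z \<in> CVF"
  shows "V + Z \<in> CVF"
proof -
  obtain n :: nat and u w where V: "\<And>j. j < n \<Longrightarrow> u j \<in> FC" "\<And>j. j < n \<Longrightarrow> w j \<in> VF"
    "\<And>\<mu> p h. V \<mu> p h = (\<Sum>j<n. u j \<mu> * w j p h)"
    using assms(1) by (rule CVF_E) blast
  obtain m :: nat and b y where Z: "\<And>j. j < m \<Longrightarrow> b j \<in> FC" "\<And>j. j < m \<Longrightarrow> y j \<in> VF"
    "\<And>\<mu> p h. Z \<mu> p h = (\<Sum>j<m. b j \<mu> * y j p h)"
    using assms(2) by (rule CVF_E) blast
  show ?thesis
  proof (rule CVF_I)
    let ?u = "\<lambda>j. if j < n then u j else b (j - n)" and ?w = "\<lambda>j. if j < n then w j else y (j - n)"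
    have "(\<Sum>j<n + m. ?u j \<mu> * ?w j p h) = (\<Sum>j<n. ?u j \<mu> * ?w j p h) + (\<Sum>j<m. ?u (n + j) \<mu> * ?w (n + j) p h)" for \<mu> p h
      by (induction m) auto
    then show "(V + Z) \<mu> p h = (\<Sum>j<n + m. ?u j \<mu> * ?w j p h)" for \<mu> p h
      by (simp add: V Z)
  qed (use V Z in auto)
qed

lemma CVF_cmul:
  assumes "v \<in> FC" "V \<in> CVF"
  shows "cmul v V \<in> CVF"
proof -
  obtain n :: nat and u w where V: "\<And>j. j < n \<Longrightarrow> u j \<in> FC" "\<And>j. j < n \<Longrightarrow> w j \<in> VF"
    "\<And>\<mu> p h. V \<mu> p h = (\<Sum>j<n. u j \<mu> * w j p h)"
    using assms(2) by (rule CVF_E) blast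
  show ?thesis
    by (rule CVF_I[of n "\<lambda>j \<mu>. v \<mu> * u j \<mu>" w])
      (use V assms(1) in \<open>auto simp: cmul_def sum_distrib_left mult.assoc intro: cyl_functions_mult\<close>)
qed

lemma CVF_tensor: "u \<in> FC \<Longrightarrow> w \<in> VF \<Longrightarrow> tensor u w \<in> CVF"
  by (rule CVF_I[of 1 "\<lambda>_. u" "\<lambda>_. w"]) (auto simp: tensor_def)

lemma CVF_zero: "(\<lambda>\<mu> p h. 0) \<in> CVF"
  by (rule CVF_I[of 0]) auto

lemma CVF_sum: "(\<And>i. i \<in> I \<Longrightarrow> V i \<in> CVF) \<Longrightarrow> (\<Sum>i\<in>I. V i) \<in> CVF"
  using CVF_zero by (induction I rule: infinite_finite_induct) (auto simp: zero_fun_def intro: CVF_add)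

lemma CVF_diff: "V \<in> CVF \<Longrightarrow> Z \<in> CVF \<Longrightarrow> V - Z \<in> CVF"
proof -
  assume "V \<in> CVF" "Z \<in> CVF"
  then have "V + cmul (\<lambda>_. -1) Z \<in> CVF" by (intro CVF_add CVF_cmul) auto
  moreover have "V + cmul (\<lambda>_. -1) Z = V - Z" by (auto simp: fun_eq_iff cmul_def)
  ultimately show ?thesis by simp
qed

lemma CVF_tangent: "V \<in> CVF \<Longrightarrow> V \<mu> p \<in> T p"
  using CVF_eval VF_tangent by blast

lemma CVF_app: "V \<in> CVF \<Longrightarrow> f \<in> C \<Longrightarrow> (\<lambda>p. V \<mu> p f) \<in> C"
  using CVF_eval VF_app by blast

section \<open>The action on cylinder functions\<close>

lemma act_star: "V \<in> CVF \<Longrightarrow> f \<in> C \<Longrightarrow> act A V (star f) \<mu> = star (\<lambda>p. V \<mu> p f) \<mu>"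
  by (rule act_eq) (auto intro: flat_derivative_star CVF_tangent)

lemma act_const [simp]: "V \<in> CVF \<Longrightarrow> act A V (\<lambda>\<mu>. c) \<mu> = 0"
proof -
  assume V: "V \<in> CVF"
  have "star (\<lambda>p. c) = (\<lambda>\<mu> :: 'm pmeas. c)" by (simp add: fun_eq_iff)
  then show ?thesis using act_star[OF V C_const, of c \<mu>] tangent_const[OF CVF_tangent[OF V]] by simp
qed

lemma act_add:
  assumes V: "V \<in> CVF" and uv: "u \<in> FC" "v \<in> FC"
  shows "act A V (\<lambda>\<mu>. u \<mu> + v \<mu>) \<mu> = act A V u \<mu> + act A V v \<mu>"
proof -
  obtain \<phi> \<psi> where d: "flat_derivative u \<mu> \<phi>" "flat_derivative v \<mu> \<psi>"
    using flat_derivative_exists uv by blast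
  then have C: "\<phi> \<in> C" "\<psi> \<in> C" by (auto simp: flat_derivative_def)
  note t = CVF_tangent[OF V]
  have "act A V (\<lambda>\<mu>. u \<mu> + v \<mu>) \<mu> = star (\<lambda>p. V \<mu> p (\<lambda>p. \<phi> p + \<psi> p)) \<mu>"
    by (rule act_eq[OF cyl_functions_add[OF uv] flat_derivative_add[OF d] t])
  also have "\<dots> = star (\<lambda>p. V \<mu> p \<phi> + V \<mu> p \<psi>) \<mu>"
    by (simp add: tangent_add[OF t C])
  also have "\<dots> = star (\<lambda>p. V \<mu> p \<phi>) \<mu> + star (\<lambda>p. V \<mu> p \<psi>) \<mu>"
    by (rule star_add[OF CVF_app[OF V C(1)] CVF_app[OF V C(2)]])
  finally show ?thesis using act_eq[OF uv(1) d(1) t] act_eq[OF uv(2) d(2) t] by simp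
qed

lemma act_mult:
  assumes V: "V \<in> CVF" and uv: "u \<in> FC" "v \<in> FC"
  shows "act A V (\<lambda>\<mu>. u \<mu> * v \<mu>) \<mu> = u \<mu> * act A V v \<mu> + v \<mu> * act A V u \<mu>"
proof -
  obtain \<phi> \<psi> where d: "flat_derivative u \<mu> \<phi>" "flat_derivative v \<mu> \<psi>"
    using flat_derivative_exists uv by blast
  then have C: "\<phi> \<in> C" "\<psi> \<in> C" by (auto simp: flat_derivative_def)
  note t = CVF_tangent[OF V]
  have "act A V (\<lambda>\<mu>. u \<mu> * v \<mu>) \<mu> = star (\<lambda>p. V \<mu> p (\<lambda>p. u \<mu> * \<psi> p + v \<mu> * \<phi> p)) \<mu>"
    by (rule act_eq[OF cyl_functions_mult[OF uv] flat_derivative_mult[OF d uv] t])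
  also have "\<dots> = star (\<lambda>p. u \<mu> * V \<mu> p \<psi> + v \<mu> * V \<mu> p \<phi>) \<mu>"
    by (simp only: tangent_add[OF t C_mult[OF C_const C(2)] C_mult[OF C_const C(1)]]
        tangent_cmult[OF t C(1)] tangent_cmult[OF t C(2)])
  also have "\<dots> = u \<mu> * star (\<lambda>p. V \<mu> p \<psi>) \<mu> + v \<mu> * star (\<lambda>p. V \<mu> p \<phi>) \<mu>"
    using CVF_app[OF V C(1)] CVF_app[OF V C(2)] by (simp add: star_add star_cmult)
  finally show ?thesis using act_eq[OF uv(1) d(1) t] act_eq[OF uv(2) d(2) t] by simp
qed

lemma act_sum:
  assumes V: "V \<in> CVF" and "\<And>i. i \<in> I \<Longrightarrow> u i \<in> FC"
  shows "act A V (\<lambda>\<mu>. \<Sum>i\<in>I. u i \<mu>) \<mu> = (\<Sum>i\<in>I. act A V (u i) \<mu>)"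
  using assms(2)
proof (induction I rule: infinite_finite_induct)
  case (insert i I)
  have "act A V (\<lambda>\<mu>. u i \<mu> + (\<Sum>i\<in>I. u i \<mu>)) \<mu> = act A V (u i) \<mu> + act A V (\<lambda>\<mu>. \<Sum>i\<in>I. u i \<mu>) \<mu>"
    using insert.prems by (intro act_add V cyl_functions_sum) auto
  then show ?case using insert by simp
qed (auto simp: V)

lemma act_add_field:
  assumes V: "V \<in> CVF" and Z: "Z \<in> CVF" and u: "u \<in> FC"
  shows "act A (V + Z) u \<mu> = act A V u \<mu> + act A Z u \<mu>"
proof -
  obtain \<phi> where d: "flat_derivative u \<mu> \<phi>" using flat_derivative_exists u by blast
  then have C: "\<phi> \<in> C" by (auto simp: flat_derivative_def)
  show ?thesis
    using act_eq[where V="V + Z", OF u d CVF_tangent[OF CVF_add[OF V Z]]]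
      act_eq[where V=V, OF u d CVF_tangent[OF V]] act_eq[where V=Z, OF u d CVF_tangent[OF Z]]
      star_add[OF CVF_app[OF V C] CVF_app[OF Z C], of \<mu> \<mu> \<mu>] by simp
qed

lemma act_cmul_field:
  assumes V: "V \<in> CVF" and v: "v \<in> FC" and u: "u \<in> FC"
  shows "act A (cmul v V) u \<mu> = v \<mu> * act A V u \<mu>"
proof -
  obtain \<phi> where d: "flat_derivative u \<mu> \<phi>" using flat_derivative_exists u by blast
  show ?thesis
    using act_eq[where V="cmul v V", OF u d CVF_tangent[OF CVF_cmul[OF v V]]]
      act_eq[where V=V, OF u d CVF_tangent[OF V]]
    by (simp add: cmul_def star_cmult)
qed

lemma act_rep:
  assumes V: "V \<in> CVF" and rep: "cyl_rep A k F f u"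
  shows "act A V u \<mu> = (\<Sum>i<k. partial i F (\<lambda>j. star (f j) \<mu>) * star (\<lambda>p. V \<mu> p (f i)) \<mu>)"
proof -
  have u: "u \<in> FC" using rep by (auto simp: cyl_functions_def)
  have f: "f i \<in> C" if "i < k" for i using rep that by (auto simp: cyl_rep_def)
  note t = CVF_tangent[OF V]
  have "V \<mu> p (\<lambda>p. \<Sum>i<k. partial i F (\<lambda>j. star (f j) \<mu>) * f i p) =
      (\<Sum>i<k. partial i F (\<lambda>j. star (f j) \<mu>) * V \<mu> p (f i))" for p
  proof -
    have "V \<mu> p (\<lambda>p. \<Sum>i<k. partial i F (\<lambda>j. star (f j) \<mu>) * f i p) =
        (\<Sum>i<k. V \<mu> p (\<lambda>p. partial i F (\<lambda>j. star (f j) \<mu>) * f i p))"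
      using f by (intro tangent_sum[OF t]) auto
    also have "\<dots> = (\<Sum>i<k. partial i F (\<lambda>j. star (f j) \<mu>) * V \<mu> p (f i))"
      by (intro sum.cong refl tangent_cmult[OF t] f) simp
    finally show ?thesis .
  qed
  then have "act A V u \<mu> = star (\<lambda>p. \<Sum>i<k. partial i F (\<lambda>j. star (f j) \<mu>) * V \<mu> p (f i)) \<mu>"
    using act_eq[OF u flat_derivative_rep[OF rep] t] by simp
  also have "\<dots> = (\<Sum>i<k. partial i F (\<lambda>j. star (f j) \<mu>) * star (\<lambda>p. V \<mu> p (f i)) \<mu>)"
    using CVF_app[OF V f] by (subst star_sum) (auto simp: star_cmult)
  finally show ?thesis .
qed

text \<open>The measure occurs in the field and in the integration. Expanding V separates the two
  into products of \<open>u j \<mu>\<close> and the integral of a smooth function that does not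
  depend on \<mu>.\<close>

lemma star_CVF_app:
  assumes V: "V \<in> CVF" and f: "f \<in> C"
  shows "(\<lambda>\<mu>. star (\<lambda>p. V \<mu> p f) \<mu>) \<in> FC"
proof -
  obtain n :: nat and u w where w: "\<And>j. j < n \<Longrightarrow> u j \<in> FC" "\<And>j. j < n \<Longrightarrow> w j \<in> VF"
    "\<And>\<mu> p h. V \<mu> p h = (\<Sum>j<n. u j \<mu> * w j p h)"
    using assms(1) by (rule CVF_E) blast
  have "star (\<lambda>p. V \<mu> p f) \<mu> = (\<Sum>j<n. u j \<mu> * star (\<lambda>p. w j p f) \<mu>)" for \<mu>
    unfolding w(3) using VF_app[OF w(2) f] by (subst star_sum) (auto simp: star_cmult)
  then show ?thesis
    by (simp only:) (intro cyl_functions_sum cyl_functions_mult w(1) cyl_functions_star[OF VF_app[OF w(2) f]]; simp)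
qed

lemma act_cyl:
  assumes V: "V \<in> CVF" and u: "u \<in> FC"
  shows "act A V u \<in> FC"
proof -
  obtain k F f where rep: "cyl_rep A k F f u" using u by (auto simp: cyl_functions_def)
  then have f: "f i \<in> C" if "i < k" for i using that by (auto simp: cyl_rep_def)
  have "act A V u = (\<lambda>\<mu>. \<Sum>i<k. partial i F (\<lambda>j. star (f j) \<mu>) * star (\<lambda>p. V \<mu> p (f i)) \<mu>)"
    using act_rep[OF V rep] by (simp add: fun_eq_iff)
  then show ?thesis
    by (simp only:) (intro cyl_functions_sum cyl_functions_mult cyl_functions_partial[OF rep] star_CVF_app[OF V f]; simp)
qed

end

section \<open>Connections on cylinder vector fields\<close>

lemma mix_atom:
  fixes p :: "'m::t2_space"
  assumes "0 < e" "e \<le> 1"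
  shows "measure (meas_of (mix e \<mu> p)) {p} > 0"
proof -
  interpret prob_space "meas_of (mix e \<mu> p)" by (rule prob_space_meas_of)
  have "measure_pmf (bernoulli_pmf e) \<in> space (prob_algebra (measure_pmf (bernoulli_pmf e)))"
    by (simp add: space_prob_algebra prob_space_measure_pmf)
  moreover have "{p} \<in> sets borel" by (intro borel_closed) simp
  ultimately have "emeasure (meas_of (mix e \<mu> p)) {p} =
      (\<integral>\<^sup>+b. emeasure (if b then return borel p else meas_of \<mu>) {p} \<partial>measure_pmf (bernoulli_pmf e))"
    unfolding meas_of_mix by (rule emeasure_bind_prob_algebra[OF _ kernel_mix])
  also have "\<dots> = ennreal e + emeasure (meas_of \<mu>) {p} * ennreal (1 - e)"
    using assms by simp
  finally have "emeasure (meas_of (mix e \<mu> p)) {p} \<ge> ennreal e" by simp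
  then have "emeasure (meas_of (mix e \<mu> p)) {p} \<noteq> 0" using assms(1) by auto
  then show ?thesis by (simp add: emeasure_eq_measure zero_less_measure_iff)
qed

context closed_manifold
begin

section \<open>Fields are determined by their action\<close>

lemma cyl_function_mix_tendsto:
  assumes u: "u \<in> FC"
  shows "((\<lambda>e. u (mix e \<mu> p)) \<longlongrightarrow> u \<mu>) (at 0 within {0..1})"
proof -
  obtain \<phi> where "flat_derivative u \<mu> \<phi>" using flat_derivative_exists u by blast
  then have "((\<lambda>e. u (mix e \<mu> p)) has_real_derivative (\<phi> p - star \<phi> \<mu>)) (at 0 within {0..1})"
    by (simp add: flat_derivative_def)
  then have "continuous (at 0 within {0..1}) (\<lambda>e. u (mix e \<mu> p))"
    by (rule DERIV_continuous)
  then show ?thesis by (simp add: continuous_within cyl_function_mix_0[OF u])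
qed

text \<open>For fixed p and h the numbers \<open>w j p h\<close> are constants. This is what allows
  the values of a cylinder field to be differentiated in \<mu> one by one.\<close>

lemma CVF_component: "V \<in> CVF \<Longrightarrow> (\<lambda>\<mu>. V \<mu> p h) \<in> FC"
proof -
  assume "V \<in> CVF"
  then obtain n :: nat and u w where V: "\<And>j. j < n \<Longrightarrow> u j \<in> FC" "\<And>j. j < n \<Longrightarrow> w j \<in> VF"
    "\<And>\<mu> p h. V \<mu> p h = (\<Sum>j<n. u j \<mu> * w j p h)"
    by (rule CVF_E) blast
  show ?thesis unfolding V(3) by (intro cyl_functions_sum cyl_functions_mult V(1) cyl_functions_const) simp
qed

lemma CVF_vanishes:
  assumes V: "V \<in> CVF" and "\<And>e. 0 < e \<Longrightarrow> e \<le> 1 \<Longrightarrow> V (mix e \<mu> p) p = (\<lambda>f. 0)"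
  shows "V \<mu> p = (\<lambda>f. 0)"
proof
  fix f
  show "V \<mu> p f = 0"
  proof (rule tendsto_unique)
    show "at 0 within {0..1::real} \<noteq> bot" by (simp add: trivial_limit_within islimpt_Icc)
    show "((\<lambda>e. V (mix e \<mu> p) p f) \<longlongrightarrow> V \<mu> p f) (at 0 within {0..1})"
      by (rule cyl_function_mix_tendsto[OF CVF_component[OF V]])
    show "((\<lambda>e. V (mix e \<mu> p) p f) \<longlongrightarrow> 0) (at 0 within {0..1})"
    proof (rule tendsto_eventually)
      show "\<forall>\<^sub>F e in at 0 within {0..1}. V (mix e \<mu> p) p f = 0"
        unfolding eventually_at_filter
        by (intro always_eventually allI impI fun_cong[OF assms(2)]) simp_all
    qed
  qed
qed

text \<open>The test functions are \<open>h / (1 + n\<^sup>2 (h\<^sub>0\<^sup>2 + h\<^sup>2))\<close>, where \<open>h\<^sub>0\<close> vanishes only at \<open>p0\<close> and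
  \<open>h(p0) = 0\<close>: their derivatives along \<open>W\<close> are uniformly bounded and converge to \<open>W h\<close> at \<open>p0\<close> and to
  0 elsewhere.\<close>

lemma divergence_free_vanishes_at_atom:
  assumes W: "W \<in> VF" and atom: "measure (meas_of \<mu>) {p0} > 0"
    and div_free: "\<And>f. f \<in> C \<Longrightarrow> star (\<lambda>p. W p f) \<mu> = 0"
  shows "W p0 = (\<lambda>f. 0)"
proof -
  obtain \<rho> X E where F: "\<rho> \<in> C" "\<And>i::'n. X i \<in> C" "\<And>i::'n. E i \<in> VF"
    "\<rho> p0 \<noteq> 0" "\<And>q. \<rho> q = \<rho> p0 \<Longrightarrow> q = p0"
    "\<And>q v f. v \<in> T q \<Longrightarrow> \<rho> q ^ 3 * v f = (\<Sum>i\<in>UNIV. (\<rho> q * v (X i) - X i q * v \<rho>) * E i q f)"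
    "\<And>q i j. \<rho> q * E j q (X i) - X i q * E j q \<rho> = (if i = j then \<rho> q ^ 3 else 0)"
    using local_frame[where ?p0.0=p0] by blast
  note t = VF_tangent[OF W]
  have key: "W p0 h = 0" if h: "h \<in> C" "h p0 = 0" for h
  proof -
    define h0 where "h0 = (\<lambda>q. \<rho> q - \<rho> p0)"
    define r where "r = (\<lambda>q. h0 q * h0 q + h q * h q)"
    define k where "k n = (\<lambda>q. h q * inverse (1 + (real n)\<^sup>2 * r q))" for n
    have h0: "h0 \<in> C" unfolding h0_def using F(1) by simp
    have rC: "r \<in> C" unfolding r_def using h0 h by simp
    have r0: "0 \<le> r q" for q by (simp add: r_def)
    have pos: "1 + (real n)\<^sup>2 * r q > 0" for n q using r0[of q] by (simp add: add_pos_nonneg)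
    have denC: "(\<lambda>q. 1 + (real n)\<^sup>2 * r q) \<in> C" for n using rC by simp
    have kC: "k n \<in> C" for n
      unfolding k_def using h(1) C_inverse[OF denC] pos by (simp add: less_imp_neq[THEN not_sym])
    have Wr: "W q r = 2 * (h0 q * W q h0 + h q * W q h)" for q
    proof -
      have "W q r = W q (\<lambda>q. h0 q * h0 q) + W q (\<lambda>q. h q * h q)"
        unfolding r_def by (rule tangent_add[OF t C_mult[OF h0 h0] C_mult[OF h(1) h(1)]])
      then show ?thesis
        using tangent_mult[OF t h0 h0, of q] tangent_mult[OF t h(1) h(1), of q] by simp
    qed
    have Wk: "W q (k n) = W q h / (1 + (real n)\<^sup>2 * r q) - h q * (real n)\<^sup>2 * W q r / (1 + (real n)\<^sup>2 * r q)\<^sup>2" for n q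
    proof -
      let ?d = "\<lambda>q. 1 + (real n)\<^sup>2 * r q"
      have "h = (\<lambda>q. ?d q * k n q)" using pos[of n] by (auto simp: k_def fun_eq_iff field_simps less_imp_neq[THEN not_sym])
      then have "W q h = W q (\<lambda>q. ?d q * k n q)" by simp
      also have "\<dots> = ?d q * W q (k n) + k n q * W q ?d"
        by (rule tangent_mult[OF t denC kC])
      also have "W q ?d = (real n)\<^sup>2 * W q r"
        using tangent_add[OF t C_const C_mult[OF C_const rC]] tangent_const[OF t] tangent_cmult[OF t rC] by simp
      finally have "?d q * W q (k n) = W q h - k n q * ((real n)\<^sup>2 * W q r)" by simp
      then have e: "W q (k n) = (W q h - k n q * ((real n)\<^sup>2 * W q r)) / ?d q"
        using pos[of n q] by (simp add: field_simps)
      have alg: "(a - x * inverse d * (s * c)) / d = a / d - x * s * c / d\<^sup>2" if "d \<noteq> 0" for a x d s c :: real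
        using that by (simp add: field_simps power2_eq_square)
      have nz: "?d q \<noteq> 0" using pos[of n q] by simp
      have kq: "k n q = h q * inverse (?d q)" by (simp add: k_def)
      show ?thesis unfolding e kq by (rule alg[OF nz])
    qed
    obtain B1 where B1: "\<And>q. \<bar>W q h\<bar> \<le> B1" using C_bounded[OF VF_app[OF W h(1)]] by blast
    obtain B0 where B0: "\<And>q. \<bar>W q h0\<bar> \<le> B0" using C_bounded[OF VF_app[OF W h0]] by blast
    define B where "B = max B0 B1"
    have B: "\<bar>W q h\<bar> \<le> B" "\<bar>W q h0\<bar> \<le> B" "B \<ge> 0" for q
      using B1[of q] B0[of q] by (auto simp: B_def)
    \<comment> \<open>The first term of the quotient rule is at most B. In the second, |h W r| \<le>
      4 B r, because W r = 2 (h0 W h0 + h W h) and both |h h0| and h^2 are at most r; then n^2 r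
      \<le> (1 + n^2 r)^2 absorbs the denominator.\<close>
    have bound: "\<bar>W q (k n)\<bar> \<le> B + 4 * B" for n q
    proof -
      let ?d = "1 + (real n)\<^sup>2 * r q" and ?s = "(real n)\<^sup>2"
      have div: "\<bar>x / y\<bar> \<le> c" if "\<bar>x\<bar> \<le> c * y" "0 < y" for x y c :: real
        using that by (simp add: abs_divide divide_le_eq)
      have "2 * (\<bar>h q\<bar> * \<bar>h0 q\<bar>) \<le> r q"
        using sum_squares_bound[of "\<bar>h q\<bar>" "\<bar>h0 q\<bar>"] by (simp add: r_def power2_eq_square)
      moreover have "0 \<le> \<bar>h q\<bar> * \<bar>h0 q\<bar>" by simp
      ultimately have "\<bar>h q\<bar> * \<bar>h0 q\<bar> \<le> r q" by linarith
      moreover have "\<bar>h q\<bar> * \<bar>h q\<bar> \<le> r q" by (simp add: r_def)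
      moreover have "\<bar>h q * W q r\<bar> \<le> 2 * ((\<bar>h q\<bar> * \<bar>h0 q\<bar>) * B + (\<bar>h q\<bar> * \<bar>h q\<bar>) * B)"
      proof -
        have "h q * W q r = 2 * ((h q * h0 q) * W q h0 + (h q * h q) * W q h)"
          by (simp add: Wr algebra_simps)
        then have "\<bar>h q * W q r\<bar> = 2 * \<bar>(h q * h0 q) * W q h0 + (h q * h q) * W q h\<bar>"
          by (simp only: abs_mult abs_numeral)
        also have "\<dots> \<le> 2 * (\<bar>h q * h0 q\<bar> * \<bar>W q h0\<bar> + \<bar>h q * h q\<bar> * \<bar>W q h\<bar>)"
          using abs_triangle_ineq[of "(h q * h0 q) * W q h0" "(h q * h q) * W q h"] by (simp add: abs_mult)
        also have "\<dots> \<le> 2 * (\<bar>h q * h0 q\<bar> * B + \<bar>h q * h q\<bar> * B)"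
          by (intro mult_left_mono add_mono B) auto
        finally show ?thesis by (simp add: abs_mult)
      qed
      ultimately have "\<bar>h q * W q r\<bar> \<le> 2 * (r q * B + r q * B)"
        using mult_right_mono[OF _ B(3)] by (smt (verit))
      then have "\<bar>h q * W q r\<bar> * ?s \<le> 2 * (r q * B + r q * B) * ?s"
        by (rule mult_right_mono) simp
      then have "\<bar>h q * ?s * W q r\<bar> \<le> 4 * B * (?s * r q)"
        by (simp add: abs_mult algebra_simps)
      also have "\<dots> \<le> 4 * B * ?d\<^sup>2"
      proof (rule mult_left_mono)
        have "0 \<le> ?s * r q" using r0 by simp
        moreover have "y \<le> (1 + y)\<^sup>2" if "0 \<le> y" for y :: real
          using that zero_le_power2[of y] by (simp add: power2_sum del: zero_le_power2)
        ultimately show "?s * r q \<le> ?d\<^sup>2" by blast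
      qed (use B(3) in simp)
      finally have "\<bar>h q * ?s * W q r\<bar> \<le> 4 * B * ?d\<^sup>2" .
      from div[OF this zero_less_power[OF pos]] have "\<bar>h q * ?s * W q r / ?d\<^sup>2\<bar> \<le> 4 * B" .
      moreover have "\<bar>W q h / ?d\<bar> \<le> B"
      proof -
        have "\<bar>W q h\<bar> \<le> B * ?d" using B(1)[of q] B(3) r0[of q] by (simp add: distrib_left add_increasing2)
        then show ?thesis by (rule div[OF _ pos])
      qed
      ultimately show ?thesis
        unfolding Wk by (intro order_trans[OF abs_triangle_ineq4] add_mono)
    qed
    \<comment> \<open>At \<open>p0\<close> both h and r vanish, so the value is
      \<open>W p0 h\<close> for every n; elsewhere r > 0 and both terms decay like n^-2.\<close>
    have lim: "(\<lambda>n. W q (k n)) \<longlonglongrightarrow> indicator {p0} q * W p0 h" for q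
    proof (cases "q = p0")
      case True
      then have "W q (k n) = W p0 h" for n using h(2) by (simp add: Wk r_def h0_def)
      then show ?thesis using True by simp
    next
      case False
      then have "h0 q \<noteq> 0" using F(5) by (auto simp: h0_def)
      then have "r q > 0" unfolding r_def using not_sum_squares_lt_zero[of "h0 q" "h q"]
        by (metis add_pos_nonneg not_real_square_gt_zero zero_le_square)
      then have "(\<lambda>n. 1 / (1 + (real n)\<^sup>2 * r q)) \<longlonglongrightarrow> 0"
        "(\<lambda>n. (real n)\<^sup>2 / (1 + (real n)\<^sup>2 * r q)\<^sup>2) \<longlonglongrightarrow> 0"
        by real_asymp+
      then have "(\<lambda>n. W q h * (1 / (1 + (real n)\<^sup>2 * r q)) - (h q * W q r) * ((real n)\<^sup>2 / (1 + (real n)\<^sup>2 * r q)\<^sup>2))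
          \<longlonglongrightarrow> W q h * 0 - (h q * W q r) * 0"
        by (intro tendsto_diff tendsto_mult_left)
      then show ?thesis using False by (simp add: Wk mult_ac)
    qed
    have "(\<lambda>n. integral\<^sup>L (meas_of \<mu>) (\<lambda>q. W q (k n))) \<longlonglongrightarrow> integral\<^sup>L (meas_of \<mu>) (\<lambda>q. indicator {p0} q * W p0 h)"
    proof (rule integral_dominated_convergence[where w="\<lambda>_. B + 4 * B"])
      show "integrable (meas_of \<mu>) (\<lambda>_. B + 4 * B)" using C_integrable[OF C_const] by blast
      show "(\<lambda>q. W q (k n)) \<in> borel_measurable (meas_of \<mu>)" for n
        using borel_measurable_integrable[OF C_integrable[OF VF_app[OF W kC]]] .
      show "(\<lambda>q. indicator {p0} q * W p0 h) \<in> borel_measurable (meas_of \<mu>)"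
        by measurable
    qed (use lim bound in auto)
    moreover have "integral\<^sup>L (meas_of \<mu>) (\<lambda>q. W q (k n)) = 0" for n
      using div_free[OF kC] by (simp add: star_def)
    moreover have "integral\<^sup>L (meas_of \<mu>) (\<lambda>q. indicator {p0} q * W p0 h) = measure (meas_of \<mu>) {p0} * W p0 h"
      by simp
    ultimately have "(\<lambda>n. 0) \<longlonglongrightarrow> measure (meas_of \<mu>) {p0} * W p0 h" by (simp only:)
    then show ?thesis using atom by (simp add: LIMSEQ_const_iff)
  qed
  have "W p0 f = 0" for f
  proof -
    have "\<rho> p0 * W p0 (X i) - X i p0 * W p0 \<rho> = 0" for i
    proof -
      \<comment> \<open>This combination of the cut-off coordinates vanishes at \<open>p0\<close>,
        so \<open>key\<close> applies; its derivative is the i-th frame component of \<rho>^3 W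
        there.\<close>
      have "W p0 (\<lambda>q. \<rho> p0 * X i q - X i p0 * \<rho> q) = 0"
        using F by (intro key) auto
      then show ?thesis
        using tangent_diff[OF t C_mult[OF C_const F(2)] C_mult[OF C_const F(1)]]
        by (simp add: tangent_cmult[OF t F(1)] tangent_cmult[OF t F(2)])
    qed
    then have "\<rho> p0 ^ 3 * W p0 f = 0" by (subst F(6)[OF t]) simp
    then show ?thesis using F(4) by simp
  qed
  then show ?thesis by blast
qed

lemma CVF_eqI:
  assumes V: "V \<in> CVF" and Z: "Z \<in> CVF"
    and eq: "\<And>f \<mu>. f \<in> C \<Longrightarrow> act A V (star f) \<mu> = act A Z (star f) \<mu>"
  shows "V = Z"
proof -
  have D: "V - Z \<in> CVF" using V Z by (rule CVF_diff)
  have "(V - Z) \<mu> p = (\<lambda>f. 0)" for \<mu> p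
  proof (rule CVF_vanishes[OF D])
    fix e :: real assume e: "0 < e" "e \<le> 1"
    let ?\<nu> = "mix e \<mu> p"
    show "(V - Z) ?\<nu> p = (\<lambda>f. 0)"
    proof (rule divergence_free_vanishes_at_atom[OF CVF_eval[OF D] mix_atom[OF e]])
      fix f assume f: "f \<in> C"
      have "star (\<lambda>q. (V - Z) ?\<nu> q f) ?\<nu> = star (\<lambda>q. V ?\<nu> q f) ?\<nu> - star (\<lambda>q. Z ?\<nu> q f) ?\<nu>"
        using star_diff[OF CVF_app[OF V f] CVF_app[OF Z f]] by simp
      then show "star (\<lambda>q. (V - Z) ?\<nu> q f) ?\<nu> = 0"
        using eq[OF f, of ?\<nu>] act_star[OF V f] act_star[OF Z f] by simp
    qed
  qed
  then show ?thesis by (simp add: fun_eq_iff)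
qed

section \<open>The intrinsic connection and the commutator of two actions\<close>

text \<open>The right-hand side is the value of \<open>nabla_int\<close> computed from a
  representation of Z, and the left-hand side mentions none; hence the description that defines
  \<open>nabla_int\<close> has only one solution.\<close>

lemma nabla_int_tensor_sum:
  assumes V: "V \<in> CVF" and u: "\<And>j. j < n \<Longrightarrow> u j \<in> FC" and Z: "\<And>\<mu> p h. Z \<mu> p h = (\<Sum>j<n. u j \<mu> * w j p h)"
  shows "act A V (\<lambda>\<nu>. Z \<nu> p h) \<mu> = (\<Sum>j<n. act A V (u j) \<mu> * w j p h)"
proof -
  have "act A V (\<lambda>\<nu>. Z \<nu> p h) \<mu> = (\<Sum>j<n. act A V (\<lambda>\<nu>. u j \<nu> * w j p h) \<mu>)"
    unfolding Z by (intro act_sum V cyl_functions_mult u cyl_functions_const) simp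
  also have "\<dots> = (\<Sum>j<n. act A V (u j) \<mu> * w j p h)"
    by (intro sum.cong refl, subst act_mult[OF V u cyl_functions_const]) (auto simp: V)
  finally show ?thesis .
qed

lemma nabla_int_eq:
  assumes V: "V \<in> CVF" and Z: "Z \<in> CVF"
  shows "nabla_int A V Z = (\<lambda>\<mu> p h. act A V (\<lambda>\<nu>. Z \<nu> p h) \<mu>)"
  unfolding nabla_int_def
proof (rule the_equality)
  have eq: "tensor_sum n (\<lambda>j. act A V (u j)) w = (\<lambda>\<mu> p h. act A V (\<lambda>\<nu>. Z \<nu> p h) \<mu>)"
    if "\<forall>j<n. u j \<in> FC \<and> w j \<in> VF" "Z = tensor_sum n u w" for n u w
    using nabla_int_tensor_sum[OF V, of n u Z w] that by (simp add: fun_eq_iff tensor_sum_apply)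
  obtain n u w where *: "\<forall>j<n. u j \<in> FC \<and> w j \<in> VF" "Z = tensor_sum n u w"
    using Z by (auto simp: cyl_vector_fields_def)
  show "\<exists>n u w. (\<forall>j<n. u j \<in> FC \<and> w j \<in> VF) \<and> Z = tensor_sum n u w \<and>
      (\<lambda>\<mu> p h. act A V (\<lambda>\<nu>. Z \<nu> p h) \<mu>) = tensor_sum n (\<lambda>j. act A V (u j)) w"
    using * eq[OF *] by metis
  show "Y = (\<lambda>\<mu> p h. act A V (\<lambda>\<nu>. Z \<nu> p h) \<mu>)"
    if "\<exists>n u w. (\<forall>j<n. u j \<in> FC \<and> w j \<in> VF) \<and> Z = tensor_sum n u w \<and> Y = tensor_sum n (\<lambda>j. act A V (u j)) w" for Y
    using that eq by metis
qed

lemma nabla_int_CVF: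
  assumes V: "V \<in> CVF" and Z: "Z \<in> CVF"
  shows "nabla_int A V Z \<in> CVF"
proof -
  obtain n :: nat and u w where Zs: "\<And>j. j < n \<Longrightarrow> u j \<in> FC" "\<And>j. j < n \<Longrightarrow> w j \<in> VF"
    "\<And>\<mu> p h. Z \<mu> p h = (\<Sum>j<n. u j \<mu> * w j p h)"
    using Z by (rule CVF_E) blast
  have nab: "act A V (\<lambda>\<nu>. Z \<nu> p h) \<mu> = (\<Sum>j<n. act A V (u j) \<mu> * w j p h)" for p h \<mu>
    by (rule nabla_int_tensor_sum[OF V _ Zs(3)]) (rule Zs(1))
  show ?thesis
    unfolding nabla_int_eq[OF V Z]
    by (rule CVF_I[where u="\<lambda>j. act A V (u j)" and w=w and n=n])
      (simp_all only: act_cyl[OF V Zs(1)] Zs(2) nab)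
qed

text \<open>Product rule for a functional in which \<mu> occurs twice: differentiating the
  coefficients of Z gives \<open>nabla_int\<close>, differentiating the integration gives the
  derivative along V_\<mu> of the function Z_\<mu> f with the field held fixed.\<close>

lemma act_star_field:
  assumes V: "V \<in> CVF" and Z: "Z \<in> CVF" and f: "f \<in> C"
  shows "act A V (\<lambda>\<mu>. star (\<lambda>p. Z \<mu> p f) \<mu>) \<mu> =
    star (\<lambda>p. nabla_int A V Z \<mu> p f) \<mu> + star (\<lambda>p. V \<mu> p (\<lambda>q. Z \<mu> q f)) \<mu>"
proof -
  obtain n :: nat and u w where Zs: "\<And>j. j < n \<Longrightarrow> u j \<in> FC" "\<And>j. j < n \<Longrightarrow> w j \<in> VF"
    "\<And>\<mu> p h. Z \<mu> p h = (\<Sum>j<n. u j \<mu> * w j p h)"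
    using Z by (rule CVF_E) blast
  have nab: "act A V (\<lambda>\<nu>. Z \<nu> p h) \<mu> = (\<Sum>j<n. act A V (u j) \<mu> * w j p h)" for p h \<mu>
    by (rule nabla_int_tensor_sum[OF V _ Zs(3)]) (rule Zs(1))
  have wf: "(\<lambda>q. w j q f) \<in> C" if "j < n" for j using VF_app[OF Zs(2)[OF that] f] .
  have lin: "star (\<lambda>p. \<Sum>j<n. c j * w j p f) \<nu> = (\<Sum>j<n. c j * star (\<lambda>p. w j p f) \<nu>)" for c \<nu>
    by (subst star_sum) (auto intro!: C_mult wf simp: star_cmult)
  have "act A V (\<lambda>\<mu>. star (\<lambda>p. Z \<mu> p f) \<mu>) \<mu> = act A V (\<lambda>\<mu>. \<Sum>j<n. u j \<mu> * star (\<lambda>p. w j p f) \<mu>) \<mu>"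
    unfolding Zs(3) lin ..
  also have "\<dots> = (\<Sum>j<n. act A V (\<lambda>\<mu>. u j \<mu> * star (\<lambda>p. w j p f) \<mu>) \<mu>)"
    by (intro act_sum V cyl_functions_mult Zs(1) cyl_functions_star wf) simp_all
  also have "\<dots> = (\<Sum>j<n. u j \<mu> * star (\<lambda>p. V \<mu> p (\<lambda>q. w j q f)) \<mu> + star (\<lambda>p. w j p f) \<mu> * act A V (u j) \<mu>)"
    by (intro sum.cong refl, subst act_mult[OF V Zs(1) cyl_functions_star[OF wf]]) (auto simp: act_star[OF V wf])
  also have "\<dots> = (\<Sum>j<n. act A V (u j) \<mu> * star (\<lambda>p. w j p f) \<mu>) + (\<Sum>j<n. u j \<mu> * star (\<lambda>p. V \<mu> p (\<lambda>q. w j q f)) \<mu>)"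
    by (simp add: sum.distrib mult.commute)
  also have "(\<Sum>j<n. act A V (u j) \<mu> * star (\<lambda>p. w j p f) \<mu>) = star (\<lambda>p. nabla_int A V Z \<mu> p f) \<mu>"
    unfolding nabla_int_eq[OF V Z] nab lin ..
  also have "(\<Sum>j<n. u j \<mu> * star (\<lambda>p. V \<mu> p (\<lambda>q. w j q f)) \<mu>) = star (\<lambda>p. V \<mu> p (\<lambda>q. Z \<mu> q f)) \<mu>"
  proof -
    have "V \<mu> p (\<lambda>q. Z \<mu> q f) = (\<Sum>j<n. u j \<mu> * V \<mu> p (\<lambda>q. w j q f))" for p
    proof -
      have "V \<mu> p (\<lambda>q. Z \<mu> q f) = (\<Sum>j<n. V \<mu> p (\<lambda>q. u j \<mu> * w j q f))"
        unfolding Zs(3) by (intro tangent_sum[OF CVF_tangent[OF V]] C_mult C_const wf) simp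
      also have "\<dots> = (\<Sum>j<n. u j \<mu> * V \<mu> p (\<lambda>q. w j q f))"
        by (intro sum.cong refl tangent_cmult[OF CVF_tangent[OF V]] wf) simp
      finally show ?thesis .
    qed
    moreover have "star (\<lambda>p. \<Sum>j<n. u j \<mu> * V \<mu> p (\<lambda>q. w j q f)) \<mu> = (\<Sum>j<n. u j \<mu> * star (\<lambda>p. V \<mu> p (\<lambda>q. w j q f)) \<mu>)"
      by (subst star_sum) (auto intro!: C_mult CVF_app[OF V wf] simp: star_cmult)
    ultimately show ?thesis by simp
  qed
  finally show ?thesis .
qed

text \<open>The second partial derivatives of F enter both iterated actions through the same
  symmetric matrix and cancel. What is left is of first order and determined by the commutator on
  the functions \<open>star (f i)\<close>.\<close>

lemma act_act_commutator:
  assumes V: "V \<in> CVF" and Z: "Z \<in> CVF" and rep: "cyl_rep A k F f u"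
  shows "act A V (act A Z u) \<mu> - act A Z (act A V u) \<mu> =
    (\<Sum>i<k. partial i F (\<lambda>j. star (f j) \<mu>) *
      (act A V (\<lambda>\<mu>. star (\<lambda>p. Z \<mu> p (f i)) \<mu>) \<mu> - act A Z (\<lambda>\<mu>. star (\<lambda>p. V \<mu> p (f i)) \<mu>) \<mu>))"
proof -
  have f: "f i \<in> C" if "i < k" for i using rep that by (auto simp: cyl_rep_def)
  have F: "smooth_Rk k F" using rep by (auto simp: cyl_rep_def)
  define P where "P i = (\<lambda>\<mu>. partial i F (\<lambda>j. star (f j) \<mu>))" for i
  define s where "s V i = (\<lambda>\<mu>. star (\<lambda>p. V \<mu> p (f i)) \<mu>)" for V :: "'m cvfield" and i
  define H where "H i j = partial j (partial i F) (\<lambda>j. star (f j) \<mu>)" for i j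
  have Prep: "cyl_rep A k (partial i F) f (P i)" if "i < k" for i
    using rep that by (auto simp: cyl_rep_def P_def intro: smooth_Rk_partial)
  have act: "act A V (act A Z u) \<mu> = (\<Sum>i<k. P i \<mu> * act A V (s Z i) \<mu>) + (\<Sum>i<k. \<Sum>j<k. H i j * s V j \<mu> * s Z i \<mu>)"
    if V: "V \<in> CVF" and Z: "Z \<in> CVF" for V Z
  proof -
    have PC: "P i \<in> FC" if "i < k" for i unfolding P_def by (rule cyl_functions_partial[OF rep that])
    have sC: "s Z i \<in> FC" if "i < k" for i unfolding s_def by (rule star_CVF_app[OF Z f[OF that]])
    have "act A Z u = (\<lambda>\<mu>. \<Sum>i<k. P i \<mu> * s Z i \<mu>)"
      using act_rep[OF Z rep] by (simp add: fun_eq_iff P_def s_def)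
    then have "act A V (act A Z u) \<mu> = (\<Sum>i<k. act A V (\<lambda>\<mu>. P i \<mu> * s Z i \<mu>) \<mu>)"
      by (simp only:) (intro act_sum V cyl_functions_mult PC sC; simp)
    also have "\<dots> = (\<Sum>i<k. P i \<mu> * act A V (s Z i) \<mu> + s Z i \<mu> * act A V (P i) \<mu>)"
      by (intro sum.cong refl act_mult V PC sC) auto
    also have "\<dots> = (\<Sum>i<k. P i \<mu> * act A V (s Z i) \<mu> + (\<Sum>j<k. H i j * s V j \<mu> * s Z i \<mu>))"
      by (intro sum.cong refl) (simp add: act_rep[OF V Prep] H_def s_def sum_distrib_left mult_ac)
    finally show ?thesis by (simp add: sum.distrib)
  qed
  \<comment> \<open>Exchanging the summations and using the symmetry of H identifies the
    second-order terms of the two orders.\<close>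
  have "(\<Sum>i<k. \<Sum>j<k. H i j * s V j \<mu> * s Z i \<mu>) = (\<Sum>j<k. \<Sum>i<k. H i j * s V j \<mu> * s Z i \<mu>)"
    by (rule sum.swap)
  also have "\<dots> = (\<Sum>i<k. \<Sum>j<k. H i j * s Z j \<mu> * s V i \<mu>)"
    by (intro sum.cong refl) (simp add: H_def partial_commute[OF F])
  finally show ?thesis
    unfolding act[OF V Z] act[OF Z V]
    by (simp add: right_diff_distrib sum_subtractf P_def s_def)
qed

section \<open>Lifting a connection from M\<close>

lemma affine_connection_zero:
  assumes "affine_connection A D" "X \<in> VF" "Y \<in> VF"
  shows "D 0 Y = 0" "D X 0 = 0"
proof -
  have z: "vmul (\<lambda>_. 0) Y = (0 :: 'm vfield)" for Y by (simp add: vmul_def fun_eq_iff)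
  show "D 0 Y = 0" using affine_connectionD(3)[OF assms(1) C_const assms(2,3), of 0] by (simp add: z)
  show "D X 0 = 0" using affine_connectionD(5)[OF assms(1) assms(2,3), of 0] by (simp add: z)
qed

lemma affine_connection_sum:
  assumes D: "affine_connection A D"
    and X: "\<And>i. i \<in> I \<Longrightarrow> X i \<in> VF" and Y: "\<And>j. j \<in> J \<Longrightarrow> Y j \<in> VF"
  shows "D (\<Sum>i\<in>I. X i) (\<Sum>j\<in>J. Y j) = (\<Sum>i\<in>I. \<Sum>j\<in>J. D (X i) (Y j))"
proof -
  have 1: "D X' (\<Sum>j\<in>J. Y j) = (\<Sum>j\<in>J. D X' (Y j))" if "X' \<in> VF" for X'
    using Y by (induction J rule: infinite_finite_induct)
      (auto simp del: plus_fun_apply simp: affine_connection_zero(2)[OF D that VF_zero] affine_connectionD(4)[OF D that] VF_sum)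
  have "(\<Sum>j\<in>J. Y j) \<in> VF" using Y by (rule VF_sum)
  then have "D (\<Sum>i\<in>I. X i) (\<Sum>j\<in>J. Y j) = (\<Sum>i\<in>I. D (X i) (\<Sum>j\<in>J. Y j))"
    using X by (induction I rule: infinite_finite_induct)
      (auto simp del: plus_fun_apply simp: affine_connection_zero(1)[OF D VF_zero] affine_connectionD(2)[OF D] VF_sum)
  then show ?thesis using X 1 by simp
qed

text \<open>At fixed \<mu> the coefficients of V and Z are constants on M, so D expands bilinearly
  without Leibniz terms, and the products of the coefficients are cylinder functions.\<close>

lemma Omega_CVF:
  assumes D: "affine_connection A D" and V: "V \<in> CVF" and Z: "Z \<in> CVF"
  shows "Omega D Z V \<in> CVF"
proof -
  obtain n :: nat and u w where Vs: "\<And>j. j < n \<Longrightarrow> u j \<in> FC" "\<And>j. j < n \<Longrightarrow> w j \<in> VF"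
    "\<And>\<mu> p h. V \<mu> p h = (\<Sum>j<n. u j \<mu> * w j p h)"
    using V by (rule CVF_E) blast
  obtain m :: nat and b y where Zs: "\<And>j. j < m \<Longrightarrow> b j \<in> FC" "\<And>j. j < m \<Longrightarrow> y j \<in> VF"
    "\<And>\<mu> p h. Z \<mu> p h = (\<Sum>j<m. b j \<mu> * y j p h)"
    using Z by (rule CVF_E) blast
  have "D (V \<mu>) (Z \<mu>) = (\<Sum>i<n. \<Sum>j<m. tensor (\<lambda>\<mu>. u i \<mu> * b j \<mu>) (D (w i) (y j))) \<mu>" for \<mu>
  proof -
    have "V \<mu> = (\<Sum>j<n. vmul (\<lambda>_. u j \<mu>) (w j))" "Z \<mu> = (\<Sum>j<m. vmul (\<lambda>_. b j \<mu>) (y j))"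
      by (simp_all add: fun_eq_iff sum_fun_apply vmul_def Vs(3) Zs(3))
    then have "D (V \<mu>) (Z \<mu>) = (\<Sum>i<n. \<Sum>j<m. D (vmul (\<lambda>_. u i \<mu>) (w i)) (vmul (\<lambda>_. b j \<mu>) (y j)))"
      by (simp only:) (intro affine_connection_sum[OF D] VF_vmul C_const Vs Zs; simp)
    also have "\<dots> = (\<Sum>i<n. \<Sum>j<m. vmul (\<lambda>_. u i \<mu>) (vmul (\<lambda>_. b j \<mu>) (D (w i) (y j))))"
      by (intro sum.cong refl)
        (simp add: affine_connectionD(3)[OF D C_const] affine_connectionD(5)[OF D] Vs(2) Zs(2) VF_vmul,
          simp add: vmul_def mult_ac)
    also have "\<dots> = (\<Sum>i<n. \<Sum>j<m. tensor (\<lambda>\<mu>. u i \<mu> * b j \<mu>) (D (w i) (y j))) \<mu>"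
      by (simp add: fun_eq_iff sum_fun_apply vmul_def tensor_def mult.assoc)
    finally show ?thesis .
  qed
  then have "Omega D Z V = (\<Sum>i<n. \<Sum>j<m. tensor (\<lambda>\<mu>. u i \<mu> * b j \<mu>) (D (w i) (y j)))"
    by (simp add: Omega_def fun_eq_iff)
  also have "\<dots> \<in> CVF"
    by (intro CVF_sum CVF_tensor cyl_functions_mult Vs(1) Zs(1) affine_connectionD(1)[OF D] Vs(2) Zs(2)) auto
  finally show ?thesis .
qed

text \<open>Turns multiplication by a cylinder function into multiplication by a constant on M, over
  which D is linear in both arguments.\<close>

lemma cmul_eval: "cmul v V \<mu> = vmul (\<lambda>_. v \<mu>) (V \<mu>)"
  by (simp add: cmul_def vmul_def)

lemma end_valued_form_Omega:
  assumes D: "affine_connection A D"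
  shows "end_valued_form A (Omega D)"
  unfolding end_valued_form_def
proof (intro conjI ballI)
  show "Omega D Z V \<in> CVF" if "V \<in> CVF" "Z \<in> CVF" for V Z using Omega_CVF[OF D that] .
  show "Omega D Z (V + V') = Omega D Z V + Omega D Z V'" if "V \<in> CVF" "V' \<in> CVF" "Z \<in> CVF" for V V' Z
    using affine_connectionD(2)[OF D CVF_eval[OF that(1)] CVF_eval[OF that(2)] CVF_eval[OF that(3)]]
    unfolding Omega_def plus_fun_def[of V V'] by (simp only: plus_fun_def[of "\<lambda>\<mu>. D (V \<mu>) (Z \<mu>)"])
  show "Omega D (Z + Z') V = Omega D Z V + Omega D Z' V" if "V \<in> CVF" "Z \<in> CVF" "Z' \<in> CVF" for V Z Z'
    using affine_connectionD(4)[OF D CVF_eval[OF that(1)] CVF_eval[OF that(2)] CVF_eval[OF that(3)]]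
    unfolding Omega_def plus_fun_def[of Z Z'] by (simp only: plus_fun_def[of "\<lambda>\<mu>. D (V \<mu>) (Z \<mu>)"])
  fix v V Z assume *: "v \<in> FC" "V \<in> CVF" "Z \<in> CVF"
  show "Omega D Z (cmul v V) = cmul v (Omega D Z V)"
    using affine_connectionD(3)[OF D C_const CVF_eval[OF *(2)] CVF_eval[OF *(3)]]
    by (intro ext) (simp add: Omega_def cmul_eval)
  show "Omega D (cmul v Z) V = cmul v (Omega D Z V)"
    using affine_connectionD(5)[OF D CVF_eval[OF *(2)] CVF_eval[OF *(3)]]
    by (intro ext) (simp add: Omega_def cmul_eval)
qed

text \<open>The axioms hold for \<open>nabla_int\<close> by the rules for \<open>act\<close> on the
  components of a field, and adding a form bilinear over the cylinder functions preserves them.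
  Homogeneity over the reals is the Leibniz rule for a constant.\<close>

lemma cyl_affine_connection_lifted:
  assumes D: "affine_connection A D"
  shows "cyl_affine_connection A (lifted_connection A D)"
proof -
  note Om = end_valued_form_Omega[OF D, unfolded end_valued_form_def]
  show ?thesis
    unfolding cyl_affine_connection_def
  proof (intro conjI ballI allI)
    show "lifted_connection A D V Z \<in> CVF" if "V \<in> CVF" "Z \<in> CVF" for V Z
      unfolding lifted_connection_def by (intro CVF_add nabla_int_CVF Omega_CVF D that)
    show "lifted_connection A D (V + V') Z = lifted_connection A D V Z + lifted_connection A D V' Z"
      if "V \<in> CVF" "V' \<in> CVF" "Z \<in> CVF" for V V' Z
    proof -
      have "nabla_int A (V + V') Z = nabla_int A V Z + nabla_int A V' Z"
        using that by (intro ext) (simp add: nabla_int_eq CVF_add act_add_field CVF_component)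
      then show ?thesis using Om that by (simp add: lifted_connection_def algebra_simps)
    qed
    show "lifted_connection A D V (Z + Z') = lifted_connection A D V Z + lifted_connection A D V Z'"
      if "V \<in> CVF" "Z \<in> CVF" "Z' \<in> CVF" for V Z Z'
    proof -
      have "nabla_int A V (Z + Z') = nabla_int A V Z + nabla_int A V Z'"
        using that by (intro ext) (simp add: nabla_int_eq CVF_add act_add CVF_component)
      then show ?thesis using Om that by (simp add: lifted_connection_def algebra_simps)
    qed
    have cm: "cmul v (V + Z) = cmul v V + cmul v Z" for v and V Z :: "'m cvfield"
      by (simp add: cmul_def fun_eq_iff algebra_simps)
    have leib: "lifted_connection A D V (cmul v Z) = cmul v (lifted_connection A D V Z) + cmul (act A V v) Z"
      if "v \<in> FC" "V \<in> CVF" "Z \<in> CVF" for v V Z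
    proof -
      have "nabla_int A V (cmul v Z) = cmul v (nabla_int A V Z) + cmul (act A V v) Z"
      proof (intro ext)
        fix \<mu> p h
        show "nabla_int A V (cmul v Z) \<mu> p h = (cmul v (nabla_int A V Z) + cmul (act A V v) Z) \<mu> p h"
          using act_mult[OF that(2,1) CVF_component[OF that(3)], of p h \<mu>]
          by (simp add: nabla_int_eq CVF_cmul that) (simp add: cmul_def mult.commute)
      qed
      then show ?thesis using Om that by (simp add: lifted_connection_def cm algebra_simps)
    qed
    then show "lifted_connection A D V (cmul v Z) = cmul v (lifted_connection A D V Z) + cmul (act A V v) Z"
      if "v \<in> FC" "V \<in> CVF" "Z \<in> CVF" for v V Z using that by blast
    show "lifted_connection A D V (cmul (\<lambda>_. c) Z) = cmul (\<lambda>_. c) (lifted_connection A D V Z)"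
      if "V \<in> CVF" "Z \<in> CVF" for c V Z
    proof -
      have "cmul (act A V (\<lambda>_. c)) Z = 0" using that by (simp add: cmul_def fun_eq_iff)
      then show ?thesis using leib[OF cyl_functions_const that, of c] by simp
    qed
    show "lifted_connection A D (cmul v V) Z = cmul v (lifted_connection A D V Z)"
      if "v \<in> FC" "V \<in> CVF" "Z \<in> CVF" for v V Z
    proof -
      have "nabla_int A (cmul v V) Z = cmul v (nabla_int A V Z)"
        using that by (intro ext) (simp add: nabla_int_eq CVF_cmul act_cmul_field CVF_component, simp add: cmul_def)
      then show ?thesis using Om that by (simp add: lifted_connection_def cm)
    qed
  qed
qed

end

context closed_riemannian
begin

section \<open>The bracket of cylinder fields and torsion\<close>

text \<open>The bracket is the antisymmetrised Levi-Civita connection of M, so the claim follows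
  from the one for \<open>Omega\<close>.\<close>

lemma CVF_lie_bracket:
  assumes V: "V \<in> CVF" and Z: "Z \<in> CVF"
  shows "(\<lambda>\<mu>. lie_bracket A (V \<mu>) (Z \<mu>)) \<in> CVF"
proof -
  obtain D where D: "levi_civita A g D" using levi_civita_exists by blast
  then have "affine_connection A D" by (simp add: levi_civita_def)
  then have "Omega D Z V - Omega D V Z \<in> CVF" by (intro CVF_diff Omega_CVF V Z)
  moreover have "Omega D Z V - Omega D V Z = (\<lambda>\<mu>. lie_bracket A (V \<mu>) (Z \<mu>))"
  proof
    fix \<mu>
    have "D (V \<mu>) (Z \<mu>) - D (Z \<mu>) (V \<mu>) = lie_bracket A (V \<mu>) (Z \<mu>)"
      using D CVF_eval[OF V] CVF_eval[OF Z] by (simp add: levi_civita_def torsion_free_def)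
    then show "(Omega D Z V - Omega D V Z) \<mu> = lie_bracket A (V \<mu>) (Z \<mu>)"
      by (simp add: Omega_def)
  qed
  ultimately show ?thesis by simp
qed

lemma cyl_bracket_eq:
  assumes V: "V \<in> CVF" and Z: "Z \<in> CVF"
  shows "cyl_bracket A V Z = nabla_int A V Z - nabla_int A Z V + (\<lambda>\<mu>. lie_bracket A (V \<mu>) (Z \<mu>))" (is "_ = ?Y")
  unfolding cyl_bracket_def
proof (rule the_equality)
  note n = nabla_int_CVF[OF V Z] nabla_int_CVF[OF Z V] CVF_lie_bracket[OF V Z]
  have Y: "?Y \<in> CVF" by (intro CVF_add CVF_diff n)
  have act: "act A ?Y u = act A V (act A Z u) - act A Z (act A V u)" if u: "u \<in> FC" for u
  proof
    fix \<mu>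
    obtain k F f where rep: "cyl_rep A k F f u" using u by (auto simp: cyl_functions_def)
    \<comment> \<open>The commutator and the action of \<open>?Y\<close> are combinations of the
      same partial derivatives of F, so it suffices to compare coefficients, that is, the actions on
      \<open>star (f i)\<close>.\<close>
    have "star (\<lambda>p. ?Y \<mu> p (f i)) \<mu> =
        act A V (\<lambda>\<mu>. star (\<lambda>p. Z \<mu> p (f i)) \<mu>) \<mu> - act A Z (\<lambda>\<mu>. star (\<lambda>p. V \<mu> p (f i)) \<mu>) \<mu>" if "i < k" for i
    proof -
      have f: "f i \<in> C" using rep that by (auto simp: cyl_rep_def)
      note a = CVF_app[OF n(1) f, of \<mu>] CVF_app[OF n(2) f, of \<mu>]
        CVF_app[OF V CVF_app[OF Z f], of \<mu> \<mu>] CVF_app[OF Z CVF_app[OF V f], of \<mu> \<mu>]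
      have "?Y \<mu> p (f i) = nabla_int A V Z \<mu> p (f i) - nabla_int A Z V \<mu> p (f i) +
          (V \<mu> p (\<lambda>q. Z \<mu> q (f i)) - Z \<mu> p (\<lambda>q. V \<mu> q (f i)))" for p
        using f by (simp add: lie_bracket_def app_def)
      then have "star (\<lambda>p. ?Y \<mu> p (f i)) \<mu> =
          star (\<lambda>p. nabla_int A V Z \<mu> p (f i)) \<mu> - star (\<lambda>p. nabla_int A Z V \<mu> p (f i)) \<mu> +
          (star (\<lambda>p. V \<mu> p (\<lambda>q. Z \<mu> q (f i))) \<mu> - star (\<lambda>p. Z \<mu> p (\<lambda>q. V \<mu> q (f i))) \<mu>)"
        by (simp only: star_add[OF C_diff[OF a(1,2)] C_diff[OF a(3,4)]] star_diff[OF a(1,2)] star_diff[OF a(3,4)])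
      then show ?thesis by (simp add: act_star_field[OF V Z f] act_star_field[OF Z V f])
    qed
    then show "act A ?Y u \<mu> = (act A V (act A Z u) - act A Z (act A V u)) \<mu>"
      unfolding minus_apply[of "act A V (act A Z u)"] act_act_commutator[OF V Z rep] act_rep[OF Y rep]
      by (intro sum.cong refl) (simp del: plus_fun_apply minus_apply)
  qed
  show "?Y \<in> CVF \<and> (\<forall>u\<in>FC. act A ?Y u = act A V (act A Z u) - act A Z (act A V u))"
    using Y act by blast
  fix Y' assume Y': "Y' \<in> CVF \<and> (\<forall>u\<in>FC. act A Y' u = act A V (act A Z u) - act A Z (act A V u))"
  show "Y' = ?Y"
    by (rule CVF_eqI) (use Y Y' act in simp_all)
qed

lemma cyl_torsion_free_lifted:
  assumes D: "affine_connection A D" and t: "torsion_free A D"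
  shows "cyl_torsion_free A (lifted_connection A D)"
  unfolding cyl_torsion_free_def
proof (intro ballI)
  fix V Z assume VZ: "V \<in> CVF" "Z \<in> CVF"
  have "Omega D Z V - Omega D V Z = (\<lambda>\<mu>. lie_bracket A (V \<mu>) (Z \<mu>))"
  proof
    fix \<mu>
    have "D (V \<mu>) (Z \<mu>) - D (Z \<mu>) (V \<mu>) = lie_bracket A (V \<mu>) (Z \<mu>)"
      using t CVF_eval[OF VZ(1)] CVF_eval[OF VZ(2)] by (simp add: torsion_free_def)
    then show "(Omega D Z V - Omega D V Z) \<mu> = lie_bracket A (V \<mu>) (Z \<mu>)"
      by (simp add: Omega_def)
  qed
  then show "lifted_connection A D V Z - lifted_connection A D Z V = cyl_bracket A V Z"
    unfolding cyl_bracket_eq[OF VZ] lifted_connection_def by (simp add: algebra_simps)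
qed

section \<open>The metric on cylinder fields\<close>

lemma Gder_star: "Gder g V Z \<mu> = star (\<lambda>p. g p (V \<mu> p) (Z \<mu> p)) \<mu>"
  by (simp add: Gder_def star_def)

lemma g_CVF: "V \<in> CVF \<Longrightarrow> Z \<in> CVF \<Longrightarrow> (\<lambda>p. g p (V \<mu> p) (Z \<mu> p)) \<in> C"
  by (intro g_smooth CVF_eval)

lemma Gder_commute: "V \<in> CVF \<Longrightarrow> Z \<in> CVF \<Longrightarrow> Gder g V Z = Gder g Z V"
  by (simp add: fun_eq_iff Gder_star g_commute[OF CVF_eval CVF_eval])

lemma Gder_add_left:
  assumes "V \<in> CVF" "V' \<in> CVF" "Z \<in> CVF"
  shows "Gder g (V + V') Z = Gder g V Z + Gder g V' Z"
proof
  fix \<mu>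
  have "g p ((V + V') \<mu> p) (Z \<mu> p) = g p (V \<mu> p) (Z \<mu> p) + g p (V' \<mu> p) (Z \<mu> p)" for p
    using g_plus_left[OF CVF_eval[OF assms(1)] CVF_eval[OF assms(2)] CVF_eval[OF assms(3)]] by simp
  then show "Gder g (V + V') Z \<mu> = (Gder g V Z + Gder g V' Z) \<mu>"
    using star_add[OF g_CVF[OF assms(1,3)] g_CVF[OF assms(2,3)]] by (simp add: Gder_star)
qed

lemma Gder_add_right:
  assumes "V \<in> CVF" "V' \<in> CVF" "Z \<in> CVF"
  shows "Gder g Z (V + V') = Gder g Z V + Gder g Z V'"
  using Gder_add_left[OF assms] Gder_commute CVF_add assms by metis

lemma Gder_definite:
  assumes V: "V \<in> CVF" and "Gder g V V = 0"
  shows "V = 0"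
proof -
  have "V \<mu> p = (\<lambda>f. 0)" for \<mu> p
  proof (rule CVF_vanishes[OF V])
    fix e :: real assume e: "0 < e" "e \<le> 1"
    let ?\<nu> = "mix e \<mu> p"
    let ?f = "\<lambda>q. g q (V ?\<nu> q) (V ?\<nu> q)"
    have nonneg: "?f q \<ge> 0" for q
    proof (cases "V ?\<nu> q = (\<lambda>f. 0)")
      case True
      then show ?thesis using g_zero_left[OF tangent_space_zero] by simp
    qed (use g_pos CVF_tangent[OF V] in \<open>auto intro: less_imp_le\<close>)
    then have "star ?f \<mu> \<ge> 0" by (simp add: star_def)
    \<comment> \<open>With the field frozen at \<open>?\<nu>\<close>, g(V, V) is a fixed smooth
      function, and its integral against \<open>?\<nu>\<close> splits off the value at p with weight
      e.\<close>
    moreover have "(1 - e) * star ?f \<mu> + e * ?f p = 0"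
      using star_mix[OF g_CVF[OF V V], of e ?\<nu> \<mu> p] e fun_cong[OF assms(2), of ?\<nu>]
      by (simp add: Gder_star)
    ultimately have "e * ?f p \<le> 0" using e by (smt (verit) mult_nonneg_nonneg)
    then have "?f p = 0" using e nonneg[of p] by (smt (verit) mult_pos_pos)
    then show "V ?\<nu> p = (\<lambda>f. 0)" by (rule g_eq_zero[OF CVF_tangent[OF V]])
  qed
  then show ?thesis by (simp add: fun_eq_iff)
qed

text \<open>Product rule with three factors: the coefficients of V, those of Z, and the measure in
  the integral of g(w_i, y_j). The first two give \<open>nabla_int\<close>; in the third both fields
  are frozen and V1 differentiates along M.\<close>

lemma act_Gder:
  assumes V1: "V1 \<in> CVF" and V: "V \<in> CVF" and Z: "Z \<in> CVF"
  shows "act A V1 (Gder g V Z) \<mu> = Gder g (nabla_int A V1 V) Z \<mu> + Gder g V (nabla_int A V1 Z) \<mu> +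
    star (\<lambda>p. V1 \<mu> p (\<lambda>q. g q (V \<mu> q) (Z \<mu> q))) \<mu>"
proof -
  obtain n :: nat and u w where Vs: "\<And>j. j < n \<Longrightarrow> u j \<in> FC" "\<And>j. j < n \<Longrightarrow> w j \<in> VF"
    "\<And>\<mu> p h. V \<mu> p h = (\<Sum>j<n. u j \<mu> * w j p h)"
    using V by (rule CVF_E) blast
  obtain m :: nat and b y where Zs: "\<And>j. j < m \<Longrightarrow> b j \<in> FC" "\<And>j. j < m \<Longrightarrow> y j \<in> VF"
    "\<And>\<mu> p h. Z \<mu> p h = (\<Sum>j<m. b j \<mu> * y j p h)"
    using Z by (rule CVF_E) blast
  define G where "G i j = (\<lambda>p. g p (w i p) (y j p))" for i j
  have G: "G i j \<in> C" if "i < n" "j < m" for i j unfolding G_def using g_smooth Vs(2) Zs(2) that by blast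
  have g_lin: "g p (\<lambda>h. \<Sum>i<n. c i * w i p h) (\<lambda>h. \<Sum>j<m. d j * y j p h) = (\<Sum>i<n. \<Sum>j<m. c i * d j * G i j p)"
    for p and c d :: "nat \<Rightarrow> real"
  proof -
    have tw: "w i p \<in> T p" if "i < n" for i using VF_tangent[OF Vs(2)[OF that]] .
    have ty: "y j p \<in> T p" if "j < m" for j using VF_tangent[OF Zs(2)[OF that]] .
    have tz: "(\<lambda>h. \<Sum>j<m. d j * y j p h) \<in> T p" by (intro tangent_space_sum tangent_space_cmult ty) simp
    have "g p (\<lambda>h. \<Sum>i<n. c i * w i p h) (\<lambda>h. \<Sum>j<m. d j * y j p h) =
        (\<Sum>i<n. c i * g p (w i p) (\<lambda>h. \<Sum>j<m. d j * y j p h))"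
      by (rule g_lincomb_left[OF _ tz]) (simp add: tw)
    also have "\<dots> = (\<Sum>i<n. c i * g p (\<lambda>h. \<Sum>j<m. d j * y j p h) (w i p))"
      by (intro sum.cong refl arg_cong2[where f="(*)"] g_sym tw tz) simp
    also have "\<dots> = (\<Sum>i<n. c i * (\<Sum>j<m. d j * g p (y j p) (w i p)))"
      by (intro sum.cong refl arg_cong2[where f="(*)"] g_lincomb_left) (simp_all add: ty tw)
    also have "\<dots> = (\<Sum>i<n. \<Sum>j<m. c i * d j * G i j p)"
      unfolding sum_distrib_left G_def
      by (intro sum.cong refl) (simp add: g_sym[OF ty tw])
    finally show ?thesis .
  qed
  have star_lin: "star (\<lambda>p. g p (\<lambda>h. \<Sum>i<n. c i * w i p h) (\<lambda>h. \<Sum>j<m. d j * y j p h)) \<nu> =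
      (\<Sum>i<n. \<Sum>j<m. c i * d j * star (G i j) \<nu>)" for \<nu> and c d :: "nat \<Rightarrow> real"
  proof -
    have "star (\<lambda>p. \<Sum>i<n. \<Sum>j<m. c i * d j * G i j p) \<nu> = (\<Sum>i<n. star (\<lambda>p. \<Sum>j<m. c i * d j * G i j p) \<nu>)"
      by (rule star_sum) (intro C_sum C_mult C_const G; simp)
    also have "\<dots> = (\<Sum>i<n. \<Sum>j<m. star (\<lambda>p. c i * d j * G i j p) \<nu>)"
      by (intro sum.cong refl star_sum C_mult C_const G; simp)
    finally show ?thesis by (simp add: g_lin star_cmult)
  qed
  have Vp: "V \<nu> p = (\<lambda>h. \<Sum>i<n. u i \<nu> * w i p h)" and Zp: "Z \<nu> p = (\<lambda>h. \<Sum>j<m. b j \<nu> * y j p h)" for \<nu> p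
    by (simp_all add: fun_eq_iff Vs(3) Zs(3))
  have nV: "nabla_int A V1 V \<mu> p = (\<lambda>h. \<Sum>i<n. act A V1 (u i) \<mu> * w i p h)" for p
    unfolding nabla_int_eq[OF V1 V]
    by (intro ext nabla_int_tensor_sum[OF V1 _ Vs(3)]) (rule Vs(1))
  have nZ: "nabla_int A V1 Z \<mu> p = (\<lambda>h. \<Sum>j<m. act A V1 (b j) \<mu> * y j p h)" for p
    unfolding nabla_int_eq[OF V1 Z]
    by (intro ext nabla_int_tensor_sum[OF V1 _ Zs(3)]) (rule Zs(1))
  have "Gder g V Z = (\<lambda>\<nu>. \<Sum>i<n. \<Sum>j<m. u i \<nu> * b j \<nu> * star (G i j) \<nu>)"
    by (simp only: fun_eq_iff Gder_star Vp Zp star_lin simp_thms)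
  then have "act A V1 (Gder g V Z) \<mu> = (\<Sum>i<n. \<Sum>j<m. act A V1 (\<lambda>\<nu>. u i \<nu> * b j \<nu> * star (G i j) \<nu>) \<mu>)"
  proof (simp only:)
    have FCij: "(\<lambda>\<nu>. u i \<nu> * b j \<nu> * star (G i j) \<nu>) \<in> FC" if "i < n" "j < m" for i j
      by (intro cyl_functions_mult Vs(1) Zs(1) cyl_functions_star G that)
    have "act A V1 (\<lambda>\<nu>. \<Sum>i<n. \<Sum>j<m. u i \<nu> * b j \<nu> * star (G i j) \<nu>) \<mu> =
        (\<Sum>i<n. act A V1 (\<lambda>\<nu>. \<Sum>j<m. u i \<nu> * b j \<nu> * star (G i j) \<nu>) \<mu>)"
      by (intro act_sum[OF V1] cyl_functions_sum FCij; simp)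
    also have "\<dots> = (\<Sum>i<n. \<Sum>j<m. act A V1 (\<lambda>\<nu>. u i \<nu> * b j \<nu> * star (G i j) \<nu>) \<mu>)"
      by (intro sum.cong refl act_sum[OF V1] FCij; simp)
    finally show "act A V1 (\<lambda>\<nu>. \<Sum>i<n. \<Sum>j<m. u i \<nu> * b j \<nu> * star (G i j) \<nu>) \<mu> =
        (\<Sum>i<n. \<Sum>j<m. act A V1 (\<lambda>\<nu>. u i \<nu> * b j \<nu> * star (G i j) \<nu>) \<mu>)" .
  qed
  also have "\<dots> = (\<Sum>i<n. \<Sum>j<m. act A V1 (u i) \<mu> * b j \<mu> * star (G i j) \<mu> + u i \<mu> * act A V1 (b j) \<mu> * star (G i j) \<mu> +
      u i \<mu> * b j \<mu> * star (\<lambda>p. V1 \<mu> p (G i j)) \<mu>)"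
  proof (intro sum.cong refl)
    fix i j assume "i \<in> {..<n}" "j \<in> {..<m}"
    then have ij: "u i \<in> FC" "b j \<in> FC" "G i j \<in> C" using Vs(1) Zs(1) G by auto
    show "act A V1 (\<lambda>\<nu>. u i \<nu> * b j \<nu> * star (G i j) \<nu>) \<mu> = act A V1 (u i) \<mu> * b j \<mu> * star (G i j) \<mu> +
        u i \<mu> * act A V1 (b j) \<mu> * star (G i j) \<mu> + u i \<mu> * b j \<mu> * star (\<lambda>p. V1 \<mu> p (G i j)) \<mu>"
      using act_mult[OF V1 cyl_functions_mult[OF ij(1,2)] cyl_functions_star[OF ij(3)], of \<mu>]
        act_mult[OF V1 ij(1,2), of \<mu>] act_star[OF V1 ij(3), of \<mu>]
      by (simp add: algebra_simps)
  qed
  also have "\<dots> = (\<Sum>i<n. \<Sum>j<m. act A V1 (u i) \<mu> * b j \<mu> * star (G i j) \<mu>) +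
      (\<Sum>i<n. \<Sum>j<m. u i \<mu> * act A V1 (b j) \<mu> * star (G i j) \<mu>) +
      (\<Sum>i<n. \<Sum>j<m. u i \<mu> * b j \<mu> * star (\<lambda>p. V1 \<mu> p (G i j)) \<mu>)"
    by (simp add: sum.distrib)
  also have "(\<Sum>i<n. \<Sum>j<m. act A V1 (u i) \<mu> * b j \<mu> * star (G i j) \<mu>) = Gder g (nabla_int A V1 V) Z \<mu>"
    by (simp only: Gder_star nV Zp star_lin)
  also have "(\<Sum>i<n. \<Sum>j<m. u i \<mu> * act A V1 (b j) \<mu> * star (G i j) \<mu>) = Gder g V (nabla_int A V1 Z) \<mu>"
    by (simp only: Gder_star nZ Vp star_lin)
  also have "(\<Sum>i<n. \<Sum>j<m. u i \<mu> * b j \<mu> * star (\<lambda>p. V1 \<mu> p (G i j)) \<mu>) =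
      star (\<lambda>p. V1 \<mu> p (\<lambda>q. g q (V \<mu> q) (Z \<mu> q))) \<mu>"
  proof -
    note t = CVF_tangent[OF V1]
    have "V1 \<mu> p (\<lambda>q. \<Sum>i<n. \<Sum>j<m. u i \<mu> * b j \<mu> * G i j q) = (\<Sum>i<n. \<Sum>j<m. u i \<mu> * b j \<mu> * V1 \<mu> p (G i j))" for p
    proof -
      have "V1 \<mu> p (\<lambda>q. \<Sum>i<n. \<Sum>j<m. u i \<mu> * b j \<mu> * G i j q) = (\<Sum>i<n. V1 \<mu> p (\<lambda>q. \<Sum>j<m. u i \<mu> * b j \<mu> * G i j q))"
        by (rule tangent_sum[OF t]) (intro C_sum C_mult C_const G; simp)
      also have "\<dots> = (\<Sum>i<n. \<Sum>j<m. V1 \<mu> p (\<lambda>q. u i \<mu> * b j \<mu> * G i j q))"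
        by (intro sum.cong refl tangent_sum[OF t] C_mult C_const G; simp)
      also have "\<dots> = (\<Sum>i<n. \<Sum>j<m. u i \<mu> * b j \<mu> * V1 \<mu> p (G i j))"
        by (intro sum.cong refl tangent_cmult[OF t] G; simp)
      finally show ?thesis .
    qed
    then have "star (\<lambda>p. V1 \<mu> p (\<lambda>q. g q (V \<mu> q) (Z \<mu> q))) \<mu> = star (\<lambda>p. \<Sum>i<n. \<Sum>j<m. u i \<mu> * b j \<mu> * V1 \<mu> p (G i j)) \<mu>"
      by (simp only: Vp Zp g_lin)
    also have "\<dots> = (\<Sum>i<n. star (\<lambda>p. \<Sum>j<m. u i \<mu> * b j \<mu> * V1 \<mu> p (G i j)) \<mu>)"
      by (rule star_sum) (intro C_sum C_mult C_const CVF_app[OF V1 G]; simp)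
    also have "\<dots> = (\<Sum>i<n. \<Sum>j<m. star (\<lambda>p. u i \<mu> * b j \<mu> * V1 \<mu> p (G i j)) \<mu>)"
      by (intro sum.cong refl star_sum C_mult C_const CVF_app[OF V1 G]; simp)
    finally show ?thesis by (simp add: star_cmult)
  qed
  finally show ?thesis .
qed

lemma cyl_metric_compatible_lifted:
  assumes D: "affine_connection A D" and m: "metric_compatible A g D"
  shows "cyl_metric_compatible A g (lifted_connection A D)"
  unfolding cyl_metric_compatible_def
proof (intro ballI ext)
  fix V1 V Z \<mu> assume V1: "V1 \<in> CVF" and V: "V \<in> CVF" and Z: "Z \<in> CVF"
  note n = nabla_int_CVF[OF V1 V] nabla_int_CVF[OF V1 Z] Omega_CVF[OF D V1 V] Omega_CVF[OF D V1 Z]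
  have "V1 \<mu> p (\<lambda>q. g q (V \<mu> q) (Z \<mu> q)) = g p (Omega D V V1 \<mu> p) (Z \<mu> p) + g p (V \<mu> p) (Omega D Z V1 \<mu> p)" for p
    using m CVF_eval[OF V1, of \<mu>] CVF_eval[OF V, of \<mu>] CVF_eval[OF Z, of \<mu>]
    by (simp add: metric_compatible_def app_def fun_eq_iff Omega_def)
  then have "star (\<lambda>p. V1 \<mu> p (\<lambda>q. g q (V \<mu> q) (Z \<mu> q))) \<mu> = Gder g (Omega D V V1) Z \<mu> + Gder g V (Omega D Z V1) \<mu>"
    by (simp add: Gder_star star_add[OF g_CVF[OF n(3) Z] g_CVF[OF V n(4)]])
  then show "act A V1 (Gder g V Z) \<mu> =
      (Gder g (lifted_connection A D V1 V) Z + Gder g V (lifted_connection A D V1 Z)) \<mu>"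
    by (simp add: act_Gder[OF V1 V Z] lifted_connection_def Gder_add_left[OF n(1,3) Z] Gder_add_right[OF n(2,4) V])
qed

text \<open>The difference \<open>S\<close> of two Levi-Civita connections is symmetric, and \<open>\<langle>S(V, Z), W\<rangle>\<close> is
  antisymmetric in \<open>Z\<close> and \<open>W\<close>; permuting the arguments cyclically gives \<open>S = 0\<close>.\<close>

lemma cyl_levi_civita_unique:
  assumes N: "cyl_levi_civita A g N" and N': "cyl_levi_civita A g N'" and VZ: "V \<in> CVF" "Z \<in> CVF"
  shows "N V Z = N' V Z"
proof -
  define S where "S V Z = N V Z - N' V Z" for V Z
  have NC: "N V Z \<in> CVF" "N' V Z \<in> CVF" if "V \<in> CVF" "Z \<in> CVF" for V Z
    using N N' that by (auto simp: cyl_levi_civita_def cyl_affine_connection_def)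
  have SC: "S V Z \<in> CVF" if "V \<in> CVF" "Z \<in> CVF" for V Z
    unfolding S_def by (intro CVF_diff NC that)
  have sym: "S V Z = S Z V" if "V \<in> CVF" "Z \<in> CVF" for V Z
  proof -
    have "N V Z - N Z V = N' V Z - N' Z V"
      using N N' that by (simp add: cyl_levi_civita_def cyl_torsion_free_def)
    then show ?thesis unfolding S_def by (simp add: algebra_simps)
  qed
  have anti: "Gder g (S V Z) W = - Gder g (S V W) Z" if "V \<in> CVF" "Z \<in> CVF" "W \<in> CVF" for V Z W
  proof -
    have N_S: "N V Z = S V Z + N' V Z" "N V W = S V W + N' V W" by (simp_all add: S_def)
    have "Gder g (N V Z) W + Gder g Z (N V W) = Gder g (N' V Z) W + Gder g Z (N' V W)"
      using N N' that by (simp add: cyl_levi_civita_def cyl_metric_compatible_def)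
    then have "Gder g (S V Z) W + Gder g Z (S V W) = 0"
      unfolding N_S Gder_add_left[OF SC[OF that(1,2)] NC(2)[OF that(1,2)] that(3)]
        Gder_add_right[OF SC[OF that(1,3)] NC(2)[OF that(1,3)] that(2)]
      by (simp add: algebra_simps)
    then show ?thesis
      using Gder_commute[OF that(2) SC[OF that(1,3)]] by (simp add: eq_neg_iff_add_eq_0)
  qed
  have "Gder g (S V Z) W = 0" if W: "W \<in> CVF" for W
  proof -
    \<comment> \<open>Each round applies antisymmetry and then symmetry of S; after three rounds the
      expression equals its own negative.\<close>
    have "Gder g (S V Z) W = - Gder g (S W V) Z" using anti[OF VZ W] sym[OF VZ(1) W] by simp
    also have "\<dots> = Gder g (S Z W) V" using anti[OF W VZ] sym[OF W VZ(2)] by simp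
    also have "\<dots> = - Gder g (S V Z) W" using anti[OF VZ(2) W VZ(1)] sym[OF VZ] by simp
    finally show ?thesis by (simp add: fun_eq_iff)
  qed
  \<comment> \<open>Take W to be \<open>S V Z\<close> itself.\<close>
  then have "S V Z = 0" using Gder_definite SC VZ by blast
  then show ?thesis by (simp add: S_def)
qed

end

theorem theorem1p1:
  fixes A :: "('m::{second_countable_topology, t2_space}, 'n::finite) chart set"
    and g :: "'m \<Rightarrow> 'm tvec \<Rightarrow> 'm tvec \<Rightarrow> real"
  assumes "compact (UNIV :: 'm set)"
    and "connected (UNIV :: 'm set)"
    and "smooth_atlas A"
    and "oriented_atlas A"
    and "riemannian_metric A g"
  shows "(\<forall>D. affine_connection A D \<longrightarrow> end_valued_form A (Omega D)) \<and>
    (\<forall>D. affine_connection A D \<longrightarrow> cyl_affine_connection A (lifted_connection A D)) \<and>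
    (\<forall>D. affine_connection A D \<longrightarrow>
       (metric_compatible A g D \<longrightarrow> cyl_metric_compatible A g (lifted_connection A D)) \<and>
       (torsion_free A D \<longrightarrow> cyl_torsion_free A (lifted_connection A D))) \<and>
    (\<exists>D. levi_civita A g D) \<and>
    (\<forall>D. levi_civita A g D \<longrightarrow>
       cyl_levi_civita A g (lifted_connection A D) \<and>
       (\<forall>N. cyl_levi_civita A g N \<longrightarrow>
          (\<forall>V\<in>cyl_vector_fields A. \<forall>Z\<in>cyl_vector_fields A. N V Z = lifted_connection A D V Z)))"
proof -
  interpret closed_riemannian A g
    by unfold_locales (fact assms)+
  have lc: "cyl_levi_civita A g (lifted_connection A D)" if "levi_civita A g D" for D
    using that cyl_affine_connection_lifted cyl_metric_compatible_lifted cyl_torsion_free_lifted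
    unfolding levi_civita_def cyl_levi_civita_def by blast
  show ?thesis
  proof (intro conjI allI impI ballI)
    show "\<exists>D. levi_civita A g D" by (rule levi_civita_exists)
    fix D N V Z
    assume D: "levi_civita A g D" and N: "cyl_levi_civita A g N" and VZ: "V \<in> CVF" "Z \<in> CVF"
    show "N V Z = lifted_connection A D V Z"
      by (rule cyl_levi_civita_unique[OF N lc[OF D] VZ])
  qed (rule end_valued_form_Omega cyl_affine_connection_lifted cyl_metric_compatible_lifted
      cyl_torsion_free_lifted lc, assumption+)+
qed

end
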